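(* Let $n\ge2$ and let $G$ be a domain in $\mathbb{R}^n$ with boundary of positive capacity. Let $\alpha\in(0,1)$ and choose $s\in(0,1)$ so small that $(1+s)\alpha+s<1$. Then the capacity test function $$u_\alpha(z)=\operatorname{cap}\bigl(G,\ \overline{B}^n(z,\alpha\,d(z,\partial G))\bigr),\qquad z\in G,$$ is continuous on $G$ and satisfies the Harnack inequality with parameters $(s,C)$, where $$C=\left(\frac{\log\alpha}{\log((1+s)\alpha+s)}\right)^{n-1}.$$
   Context: Harnack inequality: a continuous function $u:G\to(0,\infty)$ satisfies the Harnack inequality (is a Harnack function) with parameters $(s,C)$, $0<s<1<C$, if for every $z\in G$ and all $x\in\overline{B}^n(z,s\,d(z,\partial G))$ one has $u(z)\le C\,u(x)$. Capacity: for a condenser $(A,F)$, i.e. $A\subset\mathbb{R}^n$ open and non-empty and $F\subset A$ compact and non-empty, $\operatorname{cap}(A,F)=\inf_u\int_{\mathbb{R}^n}|\nabla u|^n\,dm$, the infimum being over all non-negative $\mathrm{ACL}^n$ functions $u$ with compact support in $A$ and $u\ge 1$ on $F$. A compact set $F$ is of capacity zero if $\operatorname{cap}(A,F)=0$ for some bounded domain $A\supset F$ (this does not depend on $A$), and otherwise of positive capacity; by Möbius invariance these notions extend to compact subsets of $\mathbb{R}^n\cup\{\infty\}$. Here $d(z,\partial G)$ is the Euclidean distance from $z$ to $\partial G$, and $\overline{B}^n(z,r)$ is the closed Euclidean ball with center $z$ and radius $r$. *)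

theory Defs
  imports "HOL-Analysis.Analysis"
begin

text \<open>Throughout, \<open>\<real>\<^sup>n\<close> is an arbitrary type of class \<^class>\<open>euclidean_space\<close> with \<open>n = DIM('a)\<close>,
  and coordinates are taken with respect to \<open>Basis\<close>.\<close>

section \<open>Functions of class ACL and \<open>ACL\<^sup>p\<close>\<close>

text \<open>The sets of \<open>D\<close> are finitely many non-overlapping compact subintervals of \<open>{a..b}\<close>;
  \<open>D division_of \<Union>D\<close> expresses exactly this, without requiring that they cover \<open>{a..b}\<close>.\<close>

definition abs_continuous_interval :: "real \<Rightarrow> real \<Rightarrow> (real \<Rightarrow> real) \<Rightarrow> bool" where
  "abs_continuous_interval a b f \<longleftrightarrow>
     (\<forall>\<epsilon>>0. \<exists>\<delta>>0. \<forall>D. D division_of \<Union>D \<and> \<Union>D \<subseteq> {a..b} \<and> (\<Sum>K\<in>D. Sup K - Inf K) < \<delta> \<longrightarrow>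
        (\<Sum>K\<in>D. \<bar>f (Sup K) - f (Inf K)\<bar>) < \<epsilon>)"

text \<open>The point with \<open>i\<close>-th coordinate \<open>t\<close> and remaining coordinates \<open>y\<close>.\<close>

definition line_point :: "'a::euclidean_space \<Rightarrow> ('a \<Rightarrow> real) \<Rightarrow> real \<Rightarrow> 'a" where
  "line_point i y t = t *\<^sub>R i + (\<Sum>b\<in>Basis - {i}. y b *\<^sub>R b)"

text \<open>A segment of \<open>cbox a b\<close> parallel to the \<open>i\<close>-th axis is given by its remaining coordinates
  \<open>y\<close>; ``almost every'' refers to \<open>(n-1)\<close>-dimensional Lebesgue measure in \<open>y\<close>.\<close>

definition ACL_on :: "'a::euclidean_space set \<Rightarrow> ('a \<Rightarrow> real) \<Rightarrow> bool" where
  "ACL_on U u \<longleftrightarrow> continuous_on U u \<and>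
     (\<forall>a b. cbox a b \<subseteq> U \<longrightarrow>
       (\<forall>i\<in>Basis. AE y in (\<Pi>\<^sub>M j\<in>Basis - {i}. lborel).
          (\<forall>j\<in>Basis - {i}. a \<bullet> j \<le> y j \<and> y j \<le> b \<bullet> j) \<longrightarrow>
          abs_continuous_interval (a \<bullet> i) (b \<bullet> i) (\<lambda>t. u (line_point i y t))))"

text \<open>An ACL function has partial derivatives almost everywhere. Where one fails to exist,
  \<^const>\<open>deriv\<close> returns an unspecified value, which affects only a null set.\<close>

definition partial_deriv :: "'a::euclidean_space \<Rightarrow> ('a \<Rightarrow> real) \<Rightarrow> 'a \<Rightarrow> real" where
  "partial_deriv i u x = deriv (\<lambda>t. u (x + t *\<^sub>R i)) 0"

definition grad :: "('a::euclidean_space \<Rightarrow> real) \<Rightarrow> 'a \<Rightarrow> 'a" where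
  "grad u x = (\<Sum>i\<in>Basis. partial_deriv i u x *\<^sub>R i)"

definition ACLp_on :: "nat \<Rightarrow> 'a::euclidean_space set \<Rightarrow> ('a \<Rightarrow> real) \<Rightarrow> bool" where
  "ACLp_on p U u \<longleftrightarrow> ACL_on U u \<and>
     (\<forall>K. compact K \<and> K \<subseteq> U \<longrightarrow>
       (\<forall>i\<in>Basis. set_integrable lebesgue K (\<lambda>x. \<bar>partial_deriv i u x\<bar> ^ p)))"

section \<open>Capacity of a condenser\<close>

definition condenser_admissible :: "'a::euclidean_space set \<Rightarrow> 'a set \<Rightarrow> ('a \<Rightarrow> real) set" where
  "condenser_admissible A F =
     {u. ACLp_on DIM('a) UNIV u \<and> (\<forall>x. 0 \<le> u x) \<and> (\<forall>x\<in>F. 1 \<le> u x) \<and>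
         compact (closure {x. u x \<noteq> 0}) \<and> closure {x. u x \<noteq> 0} \<subseteq> A}"

definition condenser_cap :: "'a::euclidean_space set \<Rightarrow> 'a set \<Rightarrow> ennreal" where
  "condenser_cap A F =
     (INF u\<in>condenser_admissible A F. \<integral>\<^sup>+x. ennreal (norm (grad u x) ^ DIM('a)) \<partial>lebesgue)"

section \<open>Sets of capacity zero in \<open>\<real>\<^sup>n \<union> {\<infinity>}\<close>\<close>

definition capacity_zero :: "'a::euclidean_space set \<Rightarrow> bool" where
  "capacity_zero F \<longleftrightarrow> compact F \<and>
     (\<exists>A. open A \<and> connected A \<and> A \<noteq> {} \<and> bounded A \<and> F \<subseteq> A \<and> condenser_cap A F = 0)"

text \<open>In the one-point compactification, \<open>None\<close> is the point \<open>\<infinity>\<close>.\<close>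

abbreviation extended_space :: "'a::euclidean_space option topology" where
  "extended_space \<equiv> Alexandroff_compactification euclidean"

definition sphere_inversion ::
    "'a::euclidean_space \<Rightarrow> real \<Rightarrow> 'a option \<Rightarrow> 'a option" where
  "sphere_inversion c r p = (case p of
      None \<Rightarrow> Some c
    | Some x \<Rightarrow> if x = c then None else Some (c + (r\<^sup>2 / (norm (x - c))\<^sup>2) *\<^sub>R (x - c)))"

text \<open>Reflection in the hyperplane \<open>{x. x \<bullet> a = t}\<close>, where \<open>a \<noteq> 0\<close>.\<close>

definition hyperplane_reflection ::
    "'a::euclidean_space \<Rightarrow> real \<Rightarrow> 'a option \<Rightarrow> 'a option" where
  "hyperplane_reflection a t = map_option (\<lambda>x. x - (2 * (x \<bullet> a - t) / (norm a)\<^sup>2) *\<^sub>R a)"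

inductive moebius_map :: "('a::euclidean_space option \<Rightarrow> 'a option) \<Rightarrow> bool" where
  inversion: "0 < r \<Longrightarrow> moebius_map (sphere_inversion c r)"
| reflection: "a \<noteq> 0 \<Longrightarrow> moebius_map (hyperplane_reflection a t)"
| comp: "moebius_map f \<Longrightarrow> moebius_map g \<Longrightarrow> moebius_map (f \<circ> g)"

text \<open>A compact set has capacity zero if some Moebius transformation carries it to a compact subset
  of \<open>\<real>\<^sup>n\<close> of capacity zero. The whole space, the only set that cannot be moved into \<open>\<real>\<^sup>n\<close>, thus
  counts as having positive capacity.\<close>

definition ext_capacity_zero :: "'a::euclidean_space option set \<Rightarrow> bool" where
  "ext_capacity_zero E \<longleftrightarrow> compactin extended_space E \<and>
     (\<exists>f F. moebius_map f \<and> f ` E = Some ` F \<and> capacity_zero F)"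

definition ext_positive_capacity :: "'a::euclidean_space option set \<Rightarrow> bool" where
  "ext_positive_capacity E \<longleftrightarrow> compactin extended_space E \<and> \<not> ext_capacity_zero E"

text \<open>The boundary taken in \<open>\<real>\<^sup>n \<union> {\<infinity>}\<close>; it contains \<open>\<infinity>\<close> iff \<open>G\<close> is unbounded.\<close>

definition ext_boundary :: "'a::euclidean_space set \<Rightarrow> 'a option set" where
  "ext_boundary G = extended_space frontier_of (Some ` G)"

section \<open>Harnack functions and the capacity test function\<close>

definition harnack_function ::
    "'a::euclidean_space set \<Rightarrow> ('a \<Rightarrow> real) \<Rightarrow> real \<Rightarrow> real \<Rightarrow> bool" where
  "harnack_function G u s C \<longleftrightarrow> 0 < s \<and> s < 1 \<and> 1 < C \<and>
     continuous_on G u \<and> (\<forall>z\<in>G. 0 < u z) \<and>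
     (\<forall>z\<in>G. \<forall>x\<in>cball z (s * infdist z (frontier G)). u z \<le> C * u x)"

text \<open>\<^const>\<open>enn2real\<close> sends \<open>\<infinity>\<close> to \<open>0\<close>, so positivity of the test function, which is part of
  \<^const>\<open>harnack_function\<close>, includes finiteness of the capacities.\<close>

definition cap_test_function :: "'a::euclidean_space set \<Rightarrow> real \<Rightarrow> 'a \<Rightarrow> real" where
  "cap_test_function G \<alpha> z = enn2real (condenser_cap G (cball z (\<alpha> * infdist z (frontier G))))"

end

theory Submission
  imports Defs
begin

text \<open>
  For a point \<open>z\<close> of \<open>G\<close> let \<open>R = d(z, \<partial>G)\<close>, let \<open>K z\<close> be the closed ball of radius \<open>\<alpha> R\<close> about \<open>z\<close>, and let
  \<open>x\<close> be a point with \<open>|x - z| = t R\<close>, where \<open>t \<le> s\<close>. The inequality \<open>u z \<le> C * u x\<close> is proved by a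
  deformation: a homeomorphism \<open>T\<close> of the space that is the identity outside \<open>ball z R\<close> and maps \<open>K z\<close>
  into \<open>K x\<close> turns every test function \<open>v\<close> of the condenser \<open>(G, K x)\<close> into a test function \<open>v \<circ> T\<close> of
  \<open>(G, K z)\<close>. If the adjoint derivative of \<open>T\<close> expands vectors so little that the \<open>n\<close>-th power of the
  expansion is at most \<open>k ^ (n - 1)\<close> times the Jacobian, then change of variables gives
  \<open>u z \<le> k ^ (n - 1) * u x\<close> (\<open>condenser_cap_transport\<close>).

  Since \<open>d(x, \<partial>G) \<ge> (1 - t) R\<close>, it suffices that \<open>T\<close> maps \<open>K z\<close> into the ball of radius \<open>r R\<close> about \<open>x\<close>,
  where \<open>r = \<alpha> (1 - t)\<close>. In units of \<open>R\<close>, \<open>T\<close> is the radial power map that takes the radius \<open>\<alpha>\<close> to \<open>r\<close>,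
  followed by translations of the concentric spheres towards \<open>x\<close> which are complete on the sphere of
  radius \<open>r\<close> and fade out linearly towards the unit sphere (\<open>unit_deformation\<close>). With
  \<open>\<kappa> = log r / log \<alpha>\<close> and \<open>\<epsilon> = t / (1 - r)\<close> its dilatation \<open>k\<close> is the larger of \<open>\<kappa> (1 + \<epsilon>)\<close> and
  \<open>1 / (\<kappa> (1 - \<epsilon>))\<close> (\<open>radial_shift_dilatation_square\<close>), and both are at most
  \<open>log \<alpha> / log ((1 + t) \<alpha> + t)\<close> (\<open>deformation_dilatation_le\<close>), which is the base of the power \<open>C\<close> for \<open>t = s\<close>.
  The constant tends to \<open>1\<close> with \<open>t\<close> and the roles of \<open>x\<close> and \<open>z\<close> can be exchanged, so the same
  inequality yields continuity.

  Test functions are only of class \<open>ACL\<^sup>n\<close>, and the composition of such a function with \<open>T\<close> is not easily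
  controlled. They are therefore first replaced by \<open>C\<^sup>1\<close> functions of no greater energy
  (\<open>smooth_approximation\<close>): the gradient of a mollified function is the mollified gradient, and Jensen's
  inequality shows that averaging does not increase the energy. The commutation is an integration by parts
  along almost every line parallel to an axis. It rests on Lebesgue's theorem that an absolutely continuous
  function is differentiable almost everywhere and is the integral of its derivative, which is proved with
  Vitali's covering theorem. Conversely, a continuous function that is \<open>C\<^sup>1\<close> with bounded gradient off a
  closed null set meeting the lines parallel to the axes in finite sets is a test function
  (\<open>piecewise_C1_admissible\<close>); this covers \<open>v \<circ> T\<close>.

  It remains to see that \<open>u\<close> is positive. If a ball in \<open>G\<close> had capacity zero, the inversion about its
  centre, being conformal, would map the boundary of \<open>G\<close> to a compact set of capacity zero
  (\<open>ext_capacity_zero_if_cball\<close>). If \<open>G\<close> is the whole space, its boundary is \<open>\<infinity>\<close>, which is carried to a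
  point, and points have capacity zero (\<open>condenser_cap_point\<close>). Both contradict the hypothesis.
\<close>

section \<open>Absolutely continuous functions on an interval\<close>

definition increment :: "(real \<Rightarrow> real) \<Rightarrow> real set \<Rightarrow> real" where
  "increment f K = f (Sup K) - f (Inf K)"

lemma increment_Icc [simp]: "c \<le> e \<Longrightarrow> increment f {c..e} = f e - f c"
  by (simp add: increment_def)

lemma division_member_Icc:
  assumes "D division_of S" "K \<in> D"
  obtains c e :: real where "c \<le> e" "K = {c..e}"
  using division_ofD(3,4)[OF assms(1)] assms(2)
  by (metis atLeastatMost_empty_iff2 box_real(2))

lemma sum_increment_division:
  assumes "q division_of {c..e::real}" "c \<le> e"
  shows "(\<Sum>K\<in>q. increment f K) = f e - f c"
proof -
  note q = division_ofD[OF assms(1)]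
  let ?p = "(\<lambda>K. (Inf K, K)) ` q"
  have Inf_in: "Inf K \<in> K" if "K \<in> q" for K
    using division_member_Icc[OF assms(1) that] by (metis atLeastAtMost_iff cInf_atLeastAtMost order_refl)
  have "?p tagged_division_of {c..e}"
    unfolding tagged_division_of
  proof (intro conjI allI impI)
    show "finite ?p" using q(1) by blast
    show "\<Union> {K. \<exists>x. (x, K) \<in> ?p} = {c..e}"
      using q(6) by (force simp: image_iff)
    show "interior K1 \<inter> interior K2 = {}"
      if "(x1, K1) \<in> ?p \<and> (x2, K2) \<in> ?p \<and> (x1, K1) \<noteq> (x2, K2)" for x1 K1 x2 K2
      using that by (intro q(5)) auto
  qed (use q Inf_in in auto)
  then have "sum (\<lambda>(x,K). f(Sup K) - f(Inf K)) ?p = f e - f c"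
    by (rule additive_tagged_division_1[OF assms(2)])
  then show ?thesis
    by (subst (asm) sum.reindex) (auto simp: inj_on_def increment_def)
qed

lemma sum_increment_id_eq_measure:
  assumes "D division_of S"
  shows "(\<Sum>K\<in>D. increment (\<lambda>x. x) K) = measure lebesgue S"
proof -
  have "increment (\<lambda>x. x) K = measure lborel K" if "K \<in> D" for K
    using division_member_Icc[OF assms that] by (metis content_real increment_Icc)
  moreover have "measure lborel K = measure lebesgue K" if "K \<in> D" for K
    using division_member_Icc[OF assms that] by (metis lborelD borel_closed closed_atLeastAtMost measure_completion sets_lborel)
  ultimately have "increment (\<lambda>x. x) K = measure lebesgue K" if "K \<in> D" for K
    using that by simp
  then show ?thesis
    using content_division[OF assms] by simp
qed

lemma abs_continuousE:
  assumes "abs_continuous_interval a b f" "\<epsilon> > 0"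
  obtains \<delta> where "\<delta> > 0"
    "\<And>D. D division_of \<Union>D \<Longrightarrow> \<Union>D \<subseteq> {a..b} \<Longrightarrow> (\<Sum>K\<in>D. increment (\<lambda>x. x) K) < \<delta>
       \<Longrightarrow> (\<Sum>K\<in>D. \<bar>increment f K\<bar>) < \<epsilon>"
proof -
  obtain \<delta> where "\<delta> > 0" and \<delta>: "\<forall>D. D division_of \<Union>D \<and> \<Union>D \<subseteq> {a..b} \<and> (\<Sum>K\<in>D. Sup K - Inf K) < \<delta> \<longrightarrow>
        (\<Sum>K\<in>D. \<bar>f (Sup K) - f (Inf K)\<bar>) < \<epsilon>"
    using assms unfolding abs_continuous_interval_def by blast
  show ?thesis
    by (rule that[OF \<open>\<delta> > 0\<close>]) (use \<delta> in \<open>simp add: increment_def\<close>)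
qed

text \<open>Vitali's theorem provides countably many disjoint intervals; since their total length is bounded by the
  measure of \<open>U\<close>, finitely many of them cover all but a set of small measure. As \<open>E\<close> may fail to be
  measurable, what is left over is enclosed in a measurable set \<open>A\<close>.\<close>

lemma Vitali_finite_intervals:
  fixes E U :: "real set"
  assumes U: "open U" "bounded U" and "E \<subseteq> U" and "\<eta> > 0"
    and V: "\<And>x d. x \<in> E \<Longrightarrow> 0 < d \<Longrightarrow> \<exists>c e. c < e \<and> e - c < d \<and> c \<le> x \<and> x \<le> e \<and> P c e"
  obtains D A where "D division_of \<Union>D" "pairwise disjnt D" "\<Union>D \<subseteq> U"
    "\<And>K. K \<in> D \<Longrightarrow> \<exists>c e. c < e \<and> K = {c..e} \<and> P c e"
    "A \<in> lmeasurable" "E - \<Union>D \<subseteq> A" "measure lebesgue A < \<eta>"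
proof -
  define I where "I = {(c,e). c < e \<and> P c e \<and> {c..e} \<subseteq> U}"
  define m r where "m = (\<lambda>(c,e::real). (c+e)/2)" and "r = (\<lambda>(c,e::real). (e-c)/2)"
  have cb: "cball (m i) (r i) = {fst i..snd i}" for i
    by (cases i) (auto simp: cball_eq_atLeastAtMost m_def r_def field_simps)
  have V1: "\<exists>i. i \<in> I \<and> x \<in> cball (m i) (r i) \<and> r i < d" if x: "x \<in> E" and d: "0 < d" for x d
  proof -
    obtain \<rho> where \<rho>: "\<rho> > 0" "ball x \<rho> \<subseteq> U"
      using U(1) \<open>E \<subseteq> U\<close> x by (meson open_contains_ball subsetD)
    obtain c e where ce: "c < e" "e - c < min d \<rho>" "c \<le> x" "x \<le> e" "P c e"
      using V[OF x, of "min d \<rho>"] d \<rho> by auto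
    have "{c..e} \<subseteq> ball x \<rho>" using ce by (auto simp: dist_real_def)
    then have "(c,e) \<in> I" using ce \<rho> by (auto simp: I_def)
    moreover have "x \<in> cball (m (c,e)) (r (c,e))" unfolding cb using ce by simp
    moreover have "r (c,e) < d" using ce d by (simp add: r_def)
    ultimately show ?thesis by blast
  qed
  have V2: "0 < r i" if "i \<in> I" for i using that by (auto simp: I_def r_def)
  obtain C where C: "countable C" "C \<subseteq> I"
     "pairwise (\<lambda>i j. disjnt (cball (m i) (r i)) (cball (m j) (r j))) C"
     "negligible (E - (\<Union>i \<in> C. cball (m i) (r i)))"
    by (rule Vitali_covering_theorem_cballs[of I r E m, OF V2 V1])
  define \<D> where "\<D> = (\<lambda>i. cball (m i) (r i)) ` C"
  have D_I: "\<exists>c e. c < e \<and> K = {c..e} \<and> P c e \<and> {c..e} \<subseteq> U" if "K \<in> \<D>" for K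
  proof -
    obtain i where i: "i \<in> C" "K = {fst i..snd i}" using \<open>K \<in> \<D>\<close> unfolding \<D>_def cb by blast
    then have "(fst i, snd i) \<in> I" using C(2) by auto
    then show ?thesis unfolding I_def i(2) by blast
  qed
  have disj: "pairwise disjnt \<D>"
    using C(3) unfolding \<D>_def pairwise_image by (rule pairwise_mono) auto
  have lm: "d \<in> lmeasurable" if "d \<in> \<D>" for d
    using that unfolding \<D>_def by auto
  have Ulm: "U \<in> lmeasurable" using U by (simp add: lmeasurable_open)
  have DU: "\<Union>\<D> \<subseteq> U" using D_I by blast
  have cnt: "countable \<D>" unfolding \<D>_def using C(1) by simp
  have "\<Union>\<D> \<in> sets lebesgue"
    using cnt lm by (intro sets.countable_Union) (auto simp: fmeasurableD)
  then have Dlm: "\<Union>\<D> \<in> lmeasurable"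
    using fmeasurableI2[OF Ulm DU] by blast
  obtain D where D: "D \<subseteq> \<D>" "finite D" "measure lebesgue (\<Union>\<D>) - \<eta> < measure lebesgue (\<Union>D)"
  proof (rule measure_countable_Union_approachable[OF cnt \<open>\<eta> > 0\<close> lm])
    show "measure lebesgue (\<Union>D') \<le> measure lebesgue U" if "D' \<subseteq> \<D>" "finite D'" for D'
      by (rule measure_mono_fmeasurable) (use that DU Ulm lm in \<open>auto intro!: sets.finite_Union simp: fmeasurableD subset_iff\<close>)
  qed auto
  have Dfm: "\<Union>D \<in> lmeasurable"
    using fmeasurable.finite_Union[OF D(2)] D(1) lm by blast
  define A where "A = (E - \<Union>\<D>) \<union> (\<Union>\<D> - \<Union>D)"
  have neg: "negligible (E - \<Union>\<D>)" using C(4) unfolding \<D>_def by simp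
  have "measure lebesgue (\<Union>\<D> - \<Union>D) = measure lebesgue (\<Union>\<D>) - measure lebesgue (\<Union>D)"
    by (rule measurable_measure_Diff) (use Dlm Dfm D in auto)
  then have m2: "measure lebesgue (\<Union>\<D> - \<Union>D) < \<eta>" using D(3) by simp
  have A: "A \<in> lmeasurable" unfolding A_def
    by (rule fmeasurable.Un[OF negligible_imp_measurable[OF neg] fmeasurable.Diff[OF Dlm Dfm]])
  have "measure lebesgue A \<le> measure lebesgue (E - \<Union>\<D>) + measure lebesgue (\<Union>\<D> - \<Union>D)"
    unfolding A_def by (rule measure_Un_le) (use neg Dlm Dfm in \<open>auto simp: negligible_imp_measurable fmeasurableD\<close>)
  with m2 neg have mA: "measure lebesgue A < \<eta>" by (simp add: negligible_imp_measure0)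
  have "D division_of \<Union>D" unfolding division_of_def
  proof (intro conjI ballI impI)
    show "interior K1 \<inter> interior K2 = {}" if "K1 \<in> D" "K2 \<in> D" "K1 \<noteq> K2" for K1 K2
      using that disj D(1) unfolding pairwise_def disjnt_def
      by (metis disjoint_iff interior_subset subsetD)
    show "\<exists>a b. K = cbox a b" "K \<noteq> {}" if "K \<in> D" for K
    proof -
      obtain c e where "c < e" "K = {c..e}" using D_I[of K] \<open>K \<in> D\<close> D(1) by blast
      then show "\<exists>a b. K = cbox a b" "K \<noteq> {}" by (auto intro!: exI[of _ c] exI[of _ e])
    qed
  qed (use D in auto)
  then show ?thesis
  proof (rule that[of D A])
    show "pairwise disjnt D" using disj D(1) by (rule pairwise_subset)
    show "\<Union>D \<subseteq> U" using D(1) DU by blast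
    show "\<exists>c e. c < e \<and> K = {c..e} \<and> P c e" if "K \<in> D" for K
      using D_I D(1) that by blast
    show "E - \<Union>D \<subseteq> A" unfolding A_def by blast
  qed (use A mA in auto)
qed

text \<open>Two Vitali covers of \<open>E\<close>, one by intervals of slope above \<open>q\<close> and one, inside the first, by
  intervals of slope below \<open>p\<close>, differ only by intervals of small total length; absolute
  continuity makes the increments over these negligible, so \<open>q\<close> times and \<open>p\<close> times the measure
  of \<open>E\<close> nearly agree.\<close>

lemma negligible_upper_lower_slope:
  fixes f :: "real \<Rightarrow> real"
  assumes f: "abs_continuous_interval a b f" and "p < q" and E: "E \<subseteq> {a<..<b}"
    and up: "\<And>x d. x \<in> E \<Longrightarrow> 0 < d \<Longrightarrow> \<exists>c e. c < e \<and> e - c < d \<and> c \<le> x \<and> x \<le> e \<and> q * (e - c) < f e - f c"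
    and down: "\<And>x d. x \<in> E \<Longrightarrow> 0 < d \<Longrightarrow> \<exists>c e. c < e \<and> e - c < d \<and> c \<le> x \<and> x \<le> e \<and> f e - f c < p * (e - c)"
  shows "negligible E"
proof -
  \<comment> \<open>the outer measure of \<open>E\<close>\<close>
  define m where "m = Inf {measure lebesgue A | A. A \<in> lmeasurable \<and> E \<subseteq> A}"
  have bdd: "bdd_below {measure lebesgue A | A. A \<in> lmeasurable \<and> E \<subseteq> A}"
    by (rule bdd_belowI[of _ 0]) auto
  have ne: "{measure lebesgue A | A. A \<in> lmeasurable \<and> E \<subseteq> A} \<noteq> {}"
    using E by (auto intro!: exI[of _ "{a<..<b}"] lmeasurable_open)
  have m_le: "m \<le> measure lebesgue A" if "A \<in> lmeasurable" "E \<subseteq> A" for A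
    unfolding m_def by (rule cInf_lower[OF _ bdd]) (use that in blast)
  have key: "(q - p) * (m - \<eta>) \<le> \<epsilon> + 4 * \<bar>p\<bar> * \<eta>" 
    if "0 < \<epsilon>" "0 < \<eta>" and \<delta>: "4 * \<eta> < \<delta>" 
      "\<And>D. D division_of \<Union>D \<Longrightarrow> \<Union>D \<subseteq> {a..b} \<Longrightarrow> (\<Sum>K\<in>D. increment (\<lambda>x. x) K) < \<delta>
       \<Longrightarrow> (\<Sum>K\<in>D. \<bar>increment f K\<bar>) < \<epsilon>" for \<epsilon> \<eta> \<delta>
  proof -
    obtain A where A: "A \<in> lmeasurable" "E \<subseteq> A" "measure lebesgue A < m + \<eta>"
      using cInf_lessD[OF ne, of "m + \<eta>"] \<open>0 < \<eta>\<close> unfolding m_def by auto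
    obtain U0 where U0: "open U0" "A \<subseteq> U0" "U0 - A \<in> lmeasurable" "emeasure lebesgue (U0 - A) < ennreal \<eta>"
      using sets_lebesgue_outer_open[OF fmeasurableD[OF A(1)] \<open>0 < \<eta>\<close>] .
    define U where "U = U0 \<inter> {a<..<b}"
    have U: "open U" "bounded U" "E \<subseteq> U" "U \<subseteq> {a<..<b}"
      using U0 E A(2) unfolding U_def by (auto intro: bounded_subset[OF bounded_box[of a b]])
    have Ulm: "U \<in> lmeasurable" using U by (simp add: lmeasurable_open)
    have "measure lebesgue U \<le> measure lebesgue (A \<union> (U0 - A))"
      by (rule measure_mono_fmeasurable[OF _ fmeasurableD[OF Ulm] fmeasurable.Un[OF A(1) U0(3)]])
        (auto simp: U_def)
    also have "\<dots> \<le> measure lebesgue A + measure lebesgue (U0 - A)"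
      by (rule measure_Un_le) (use A U0 in \<open>auto simp: fmeasurableD\<close>)
    also have "measure lebesgue (U0 - A) < \<eta>"
      using U0(3,4) \<open>0 < \<eta>\<close> by (simp add: emeasure_eq_measure2 ennreal_less_iff)
    finally have mU: "measure lebesgue U < m + 2 * \<eta>" using A(3) by simp
    obtain I A1 where I: "I division_of \<Union>I" "pairwise disjnt I" "\<Union>I \<subseteq> U"
      "\<And>K. K \<in> I \<Longrightarrow> \<exists>c e. c < e \<and> K = {c..e} \<and> q * (e - c) < f e - f c"
      and A1: "A1 \<in> lmeasurable" "E - \<Union>I \<subseteq> A1" "measure lebesgue A1 < \<eta>"
      using Vitali_finite_intervals[OF U(1,2,3) \<open>0 < \<eta>\<close>, of "\<lambda>c e. q * (e - c) < f e - f c"] up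
      by metis
    have Ilm: "\<Union>I \<in> lmeasurable" by (meson I(1) lmeasurable_division)
    \<comment> \<open>Only interior points of \<open>I\<close> have small neighbourhoods inside one interval; the endpoints form a null set.\<close>
    define V where "V = (\<Union>K\<in>I. interior K)"
    have V: "open V" "bounded V" unfolding V_def
      using I(3) U(2) interior_subset by (auto intro!: bounded_subset[OF U(2)])
    obtain J A2 where J: "J division_of \<Union>J" "pairwise disjnt J" "\<Union>J \<subseteq> V"
      "\<And>L. L \<in> J \<Longrightarrow> \<exists>c e. c < e \<and> L = {c..e} \<and> f e - f c < p * (e - c) \<and> (\<exists>K\<in>I. {c..e} \<subseteq> K)"
      and A2: "A2 \<in> lmeasurable" "E \<inter> V - \<Union>J \<subseteq> A2" "measure lebesgue A2 < \<eta>"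
    proof (rule Vitali_finite_intervals[OF V(1,2) Int_lower2 \<open>0 < \<eta>\<close>, of E "\<lambda>c e. f e - f c < p * (e - c) \<and> (\<exists>K\<in>I. {c..e} \<subseteq> K)"])
      fix x d :: real assume x: "x \<in> E \<inter> V" and "0 < d"
      then obtain K \<rho> where K: "K \<in> I" "\<rho> > 0" "ball x \<rho> \<subseteq> K"
        unfolding V_def by (auto simp: mem_interior)
      obtain c e where ce: "c < e" "e - c < min d \<rho>" "c \<le> x" "x \<le> e" "f e - f c < p * (e - c)"
        using down[of x "min d \<rho>"] x K \<open>0 < d\<close> by auto
      have "{c..e} \<subseteq> ball x \<rho>" using ce by (auto simp: dist_real_def)
      then show "\<exists>c e. c < e \<and> e - c < d \<and> c \<le> x \<and> x \<le> e \<and> f e - f c < p * (e - c) \<and> (\<exists>K\<in>I. {c..e} \<subseteq> K)"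
        using K(1) order_trans[OF _ K(3)] ce(1,3,4,5) ce(2)[unfolded min_less_iff_conj] by blast
    qed (use that in blast)
    have finI: "finite I" and finJ: "finite J" using I(1) J(1) by auto
    have Jlm: "\<Union>J \<in> lmeasurable" by (meson J(1) lmeasurable_division)
    have bd: "negligible (\<Union>I - V)"
    proof -
      have "negligible (K - interior K)" if "K \<in> I" for K
        using I(4)[OF that] by (auto intro!: negligible_finite intro: finite_subset[of _ "{x,y}" for x y])
      then have "negligible (\<Union>K\<in>I. K - interior K)" using finI by (auto intro: negligible_Union)
      then show ?thesis by (rule negligible_subset) (auto simp: V_def)
    qed
    have bdl: "\<Union>I - V \<in> lmeasurable" by (rule negligible_imp_measurable[OF bd])
    note L2 = fmeasurable.Un[OF A2(1) bdl]
    note L1 = fmeasurable.Un[OF A1(1) L2]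
    have "E \<subseteq> \<Union>J \<union> (A1 \<union> (A2 \<union> (\<Union>I - V)))"
      using A1(2) A2(2) by blast
    then have "m \<le> measure lebesgue (\<Union>J \<union> (A1 \<union> (A2 \<union> (\<Union>I - V))))"
      by (rule m_le[OF fmeasurable.Un[OF Jlm L1]])
    also have "\<dots> \<le> measure lebesgue (\<Union>J) + measure lebesgue (A1 \<union> (A2 \<union> (\<Union>I - V)))"
      by (rule measure_Un_le[OF fmeasurableD[OF Jlm] fmeasurableD[OF L1]])
    also have "measure lebesgue (A1 \<union> (A2 \<union> (\<Union>I - V))) \<le> measure lebesgue A1 + measure lebesgue (A2 \<union> (\<Union>I - V))"
      by (rule measure_Un_le[OF fmeasurableD[OF A1(1)] fmeasurableD[OF L2]])
    also have "measure lebesgue (A2 \<union> (\<Union>I - V)) \<le> measure lebesgue A2 + measure lebesgue (\<Union>I - V)"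
      by (rule measure_Un_le[OF fmeasurableD[OF A2(1)] fmeasurableD[OF bdl]])
    finally have mJ: "m \<le> measure lebesgue (\<Union>J) + 2 * \<eta>"
      using A1(3) A2(3) bd by (simp add: negligible_imp_measure0)
    have mI: "measure lebesgue (\<Union>I) < m + 2 * \<eta>"
      using measure_mono_fmeasurable[OF I(3) fmeasurableD[OF Ilm] Ulm] mU by simp
    \<comment> \<open>Each interval of \<open>I\<close> consists of the intervals of \<open>J\<close> in it and finitely many gaps, collected in \<open>G\<close>.\<close>
    have "\<exists>Q. {L \<in> J. L \<subseteq> K} \<subseteq> Q \<and> Q division_of K" if K: "K \<in> I" for K
    proof -
      obtain c e where ce: "K = {c..e}" using I(4)[OF K] by blast
      have d: "{L \<in> J. L \<subseteq> K} division_of \<Union>{L \<in> J. L \<subseteq> K}"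
        using J(1) by (rule division_of_subset) auto
      show ?thesis
        by (rule partial_division_extend_interval[OF d, of c e]) (auto simp: ce)
    qed
    then obtain Q where Q: "\<And>K. K \<in> I \<Longrightarrow> {L \<in> J. L \<subseteq> K} \<subseteq> Q K" "\<And>K. K \<in> I \<Longrightarrow> Q K division_of K"
      by metis
    define G where "G = (\<Union>K\<in>I. Q K - {L \<in> J. L \<subseteq> K})"
    have QQ: "Q K \<inter> Q K' = {}" if "K \<in> I" "K' \<in> I" "K \<noteq> K'" for K K'
    proof (rule ccontr)
      assume "Q K \<inter> Q K' \<noteq> {}"
      then obtain L where "L \<in> Q K" "L \<in> Q K'" by blast
      then have "L \<subseteq> K" "L \<subseteq> K'" "L \<noteq> {}"
        using division_ofD(2,3)[OF Q(2)[OF that(1)]] division_ofD(2)[OF Q(2)[OF that(2)]] by auto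
      then show False using I(2) that unfolding pairwise_def disjnt_def by blast
    qed
    have finQ: "finite (Q K)" if "K \<in> I" for K using Q(2)[OF that] by auto
    have J_eq: "J = (\<Union>K\<in>I. {L \<in> J. L \<subseteq> K})" using J(4) by blast
    have split: "(\<Sum>K\<in>I. increment g K) = (\<Sum>K\<in>J. increment g K) + (\<Sum>K\<in>G. increment g K)" for g
    proof -
      have "(\<Sum>K\<in>J. increment g K) = (\<Sum>K\<in>I. \<Sum>L\<in>{L \<in> J. L \<subseteq> K}. increment g L)"
      proof -
        have "(\<Sum>K\<in>(\<Union>K\<in>I. {L \<in> J. L \<subseteq> K}). increment g K) = (\<Sum>K\<in>I. \<Sum>L\<in>{L \<in> J. L \<subseteq> K}. increment g L)"
        proof (rule sum.UNION_disjoint)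
          show "\<forall>K\<in>I. \<forall>K'\<in>I. K \<noteq> K' \<longrightarrow> {L \<in> J. L \<subseteq> K} \<inter> {L \<in> J. L \<subseteq> K'} = {}"
            using QQ Q(1) by (meson disjoint_iff subsetD)
        qed (use finI finJ in auto)
        then show ?thesis unfolding J_eq[symmetric] .
      qed
      moreover have "(\<Sum>K\<in>G. increment g K) = (\<Sum>K\<in>I. \<Sum>L\<in>Q K - {L \<in> J. L \<subseteq> K}. increment g L)"
        unfolding G_def
      proof (rule sum.UNION_disjoint)
        show "\<forall>K\<in>I. \<forall>K'\<in>I. K \<noteq> K' \<longrightarrow> (Q K - {L \<in> J. L \<subseteq> K}) \<inter> (Q K' - {L \<in> J. L \<subseteq> K'}) = {}"
          using QQ by (meson Diff_iff disjoint_iff)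
      qed (use finI finQ in auto)
      moreover have "increment g K = (\<Sum>L\<in>{L \<in> J. L \<subseteq> K}. increment g L) + (\<Sum>L\<in>Q K - {L \<in> J. L \<subseteq> K}. increment g L)"
        if K: "K \<in> I" for K
      proof -
        obtain c e where ce: "K = {c..e}" "c < e" using I(4)[OF K] by blast
        have "increment g K = (\<Sum>L\<in>Q K. increment g L)"
          using sum_increment_division[of "Q K" c e g] Q(2)[OF K] ce by simp
        then show ?thesis using sum.subset_diff[OF Q(1)[OF K] finQ[OF K]] by (simp add: add.commute)
      qed
      ultimately show ?thesis by (simp add: sum.distrib)
    qed
    have Gdiv: "G division_of \<Union>G"
      unfolding division_of_def
    proof (intro conjI ballI impI)
      show "finite G" unfolding G_def using finI finQ by auto
      show "\<exists>a b. L = cbox a b" "L \<noteq> {}" if "L \<in> G" for L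
      proof -
        obtain K where K: "K \<in> I" "L \<in> Q K" using \<open>L \<in> G\<close> unfolding G_def by blast
        show "\<exists>a b. L = cbox a b" "L \<noteq> {}" using division_ofD(3,4)[OF Q(2)[OF K(1)] K(2)] by auto
      qed
      show "interior K1 \<inter> interior K2 = {}" if "K1 \<in> G" "K2 \<in> G" "K1 \<noteq> K2" for K1 K2
      proof -
        obtain L1 L2 where L: "L1 \<in> I" "K1 \<in> Q L1" "L2 \<in> I" "K2 \<in> Q L2"
          using \<open>K1 \<in> G\<close> \<open>K2 \<in> G\<close> unfolding G_def by blast
        show ?thesis
        proof (cases "L1 = L2")
          case True then show ?thesis using L that division_ofD(5)[OF Q(2)] by metis
        next
          case False
          then have "L1 \<inter> L2 = {}" using I(2) L unfolding pairwise_def disjnt_def by blast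
          moreover have "K1 \<subseteq> L1" "K2 \<subseteq> L2"
            using division_ofD(2)[OF Q(2)[OF L(1)] L(2)] division_ofD(2)[OF Q(2)[OF L(3)] L(4)] by auto
          ultimately show ?thesis using interior_subset by blast
        qed
      qed
    qed auto
    have Gsub: "\<Union>G \<subseteq> {a..b}"
    proof
      fix x assume "x \<in> \<Union>G"
      then obtain K where "K \<in> I" "x \<in> K" using division_ofD(2)[OF Q(2)] unfolding G_def by blast
      then show "x \<in> {a..b}" using I(3) U(4) by force
    qed
    have lenI: "(\<Sum>K\<in>I. increment (\<lambda>x. x) K) = measure lebesgue (\<Union>I)" 
      and lenJ: "(\<Sum>K\<in>J. increment (\<lambda>x. x) K) = measure lebesgue (\<Union>J)" 
      using sum_increment_id_eq_measure[OF I(1)] sum_increment_id_eq_measure[OF J(1)] by auto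
    have lenG: "(\<Sum>K\<in>G. increment (\<lambda>x. x) K) = measure lebesgue (\<Union>I) - measure lebesgue (\<Union>J)" 
      using split[of "\<lambda>x. x"] lenI lenJ by simp
    have "(\<Sum>K\<in>G. \<bar>increment f K\<bar>) < \<epsilon>"
      by (rule \<delta>(2)[OF Gdiv Gsub]) (use lenG mI mJ \<delta>(1) in linarith)
    moreover have "(\<Sum>K\<in>G. increment f K) \<le> (\<Sum>K\<in>G. \<bar>increment f K\<bar>)"
      by (rule sum_mono) simp
    ultimately have incG: "(\<Sum>K\<in>G. increment f K) < \<epsilon>" by linarith
    have lenIf: "q * measure lebesgue (\<Union>I) \<le> (\<Sum>K\<in>I. increment f K)"
      unfolding lenI[symmetric] sum_distrib_left using I(4) by (intro sum_mono) force
    have lenJf: "(\<Sum>K\<in>J. increment f K) \<le> p * measure lebesgue (\<Union>J)"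
      unfolding lenJ[symmetric] sum_distrib_left using J(4) by (intro sum_mono) force
    have "q * measure lebesgue (\<Union>I) \<le> p * measure lebesgue (\<Union>J) + \<epsilon>"
      using lenIf lenJf incG split[of f] by linarith
    moreover have "p * measure lebesgue (\<Union>J) \<le> p * measure lebesgue (\<Union>I) + 4 * \<bar>p\<bar> * \<eta>"
    proof -
      have "0 \<le> measure lebesgue (\<Union>I) - measure lebesgue (\<Union>J)"
      proof -
        have "\<Union>J \<subseteq> \<Union>I" using J(3) interior_subset unfolding V_def by blast
        then show ?thesis using measure_mono_fmeasurable[OF _ fmeasurableD[OF Jlm] Ilm] by simp
      qed
      then have "\<bar>p * (measure lebesgue (\<Union>J) - measure lebesgue (\<Union>I))\<bar> \<le> \<bar>p\<bar> * (4 * \<eta>)"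
        unfolding abs_mult using mI mJ by (intro mult_left_mono) auto
      then show ?thesis by (simp add: algebra_simps)
    qed
    ultimately have "(q - p) * measure lebesgue (\<Union>I) \<le> \<epsilon> + 4 * \<bar>p\<bar> * \<eta>"
      by (simp add: algebra_simps)
    moreover have "m \<le> measure lebesgue (\<Union>I) + \<eta>"
    proof -
      have "E \<subseteq> \<Union>I \<union> A1" using A1(2) by blast
      then have "m \<le> measure lebesgue (\<Union>I \<union> A1)" by (intro m_le) (use Ilm A1 in auto)
      also have "\<dots> \<le> measure lebesgue (\<Union>I) + measure lebesgue A1"
        by (rule measure_Un_le) (use Ilm A1 in \<open>auto simp: fmeasurableD\<close>)
      finally show ?thesis using A1(3) by simp
    qed
    then have "(q - p) * (m - \<eta>) \<le> (q - p) * measure lebesgue (\<Union>I)"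
      using \<open>p < q\<close> by (intro mult_left_mono) auto
    ultimately show ?thesis by linarith
  qed
  have m0: "m \<le> 0"
  proof (rule ccontr)
    assume "\<not> m \<le> 0"
    define \<epsilon> where "\<epsilon> = (q - p) * m / 4"
    have \<epsilon>: "\<epsilon> > 0" using \<open>\<not> m \<le> 0\<close> \<open>p < q\<close> by (simp add: \<epsilon>_def)
    obtain \<delta> where \<delta>: "\<delta> > 0" "\<And>D. D division_of \<Union>D \<Longrightarrow> \<Union>D \<subseteq> {a..b} \<Longrightarrow> (\<Sum>K\<in>D. increment (\<lambda>x. x) K) < \<delta>
       \<Longrightarrow> (\<Sum>K\<in>D. \<bar>increment f K\<bar>) < \<epsilon>"
      using abs_continuousE[OF f \<epsilon>] by metis
    define \<eta> where "\<eta> = min (\<delta>/8) (min (m/4) (\<epsilon> / (4 * \<bar>p\<bar> + 1)))"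
    have \<eta>: "\<eta> > 0" "4 * \<eta> < \<delta>" "\<eta> \<le> m/4" "\<eta> \<le> \<epsilon> / (4 * \<bar>p\<bar> + 1)"
    proof -
      show "\<eta> > 0" using \<epsilon> \<delta>(1) \<open>\<not> m \<le> 0\<close> by (simp add: \<eta>_def)
      have "\<eta> \<le> \<delta>/8" unfolding \<eta>_def by (rule min.cobounded1)
      then show "4 * \<eta> < \<delta>" using \<delta>(1) by simp
      show "\<eta> \<le> m/4" "\<eta> \<le> \<epsilon> / (4 * \<bar>p\<bar> + 1)" 
        unfolding \<eta>_def by (rule min.coboundedI2, rule min.cobounded1, rule min.coboundedI2, rule min.cobounded2)
    qed
    have "(4 * \<bar>p\<bar> + 1) * \<eta> \<le> \<epsilon>" using \<eta>(4) by (simp add: field_simps)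
    then have "4 * \<bar>p\<bar> * \<eta> \<le> \<epsilon>" using \<eta>(1) by (simp add: algebra_simps)
    with key[OF \<epsilon> \<eta>(1,2) \<delta>(2)] have "(q - p) * (m - \<eta>) \<le> 2 * \<epsilon>" by simp
    moreover have "(q - p) * (3 * m / 4) \<le> (q - p) * (m - \<eta>)"
      using \<open>p < q\<close> \<eta>(3) by (intro mult_left_mono) auto
    ultimately have "(q - p) * (3 * m / 4) \<le> 2 * \<epsilon>" by linarith
    also have "\<dots> = (q - p) * (m / 2)" by (simp add: \<epsilon>_def)
    finally show False using \<open>p < q\<close> \<open>\<not> m \<le> 0\<close> by (simp add: mult_le_cancel_left)
  qed
  show ?thesis
    unfolding negligible_outer
  proof (intro allI impI)
    fix e :: real assume "0 < e"
    then show "\<exists>T. E \<subseteq> T \<and> T \<in> lmeasurable \<and> measure lebesgue T < e"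
      using cInf_lessD[OF ne, of e] m0 unfolding m_def by auto
  qed
qed

text \<open>A short interval carries increments of total size less than one, so it cannot be filled up to a
  null set by intervals of arbitrarily large slope.\<close>

lemma negligible_unbounded_slope:
  fixes f :: "real \<Rightarrow> real"
  assumes f: "abs_continuous_interval a b f" and E: "E \<subseteq> {a<..<b}"
    and up: "\<And>q x d. x \<in> E \<Longrightarrow> 0 < d \<Longrightarrow> \<exists>c e. c < e \<and> e - c < d \<and> c \<le> x \<and> x \<le> e \<and> q * (e - c) < \<bar>f e - f c\<bar>"
  shows "negligible E"
proof -
  obtain \<delta> where \<delta>: "\<delta> > 0" "\<And>D. D division_of \<Union>D \<Longrightarrow> \<Union>D \<subseteq> {a..b} \<Longrightarrow> (\<Sum>K\<in>D. increment (\<lambda>x. x) K) < \<delta>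
       \<Longrightarrow> (\<Sum>K\<in>D. \<bar>increment f K\<bar>) < 1"
    using abs_continuousE[OF f zero_less_one] by metis
  have local: "negligible (E \<inter> {u<..<v})" if uv: "v - u < \<delta>" for u v
    unfolding negligible_outer
  proof (intro allI impI)
    fix \<epsilon> :: real assume "0 < \<epsilon>"
    define U where "U = {a<..<b} \<inter> {u<..<v}"
    have U: "open U" "bounded U" "E \<inter> {u<..<v} \<subseteq> U"
      using E unfolding U_def by (auto intro: bounded_subset[OF bounded_box[of a b]])
    obtain D A where D: "D division_of \<Union>D" "pairwise disjnt D" "\<Union>D \<subseteq> U"
      "\<And>K. K \<in> D \<Longrightarrow> \<exists>c e. c < e \<and> K = {c..e} \<and> (2/\<epsilon>) * (e - c) < \<bar>f e - f c\<bar>"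
      and A: "A \<in> lmeasurable" "E \<inter> {u<..<v} - \<Union>D \<subseteq> A" "measure lebesgue A < \<epsilon>/2"
    proof (rule Vitali_finite_intervals[OF U, of "\<epsilon>/2" "\<lambda>c e. (2/\<epsilon>) * (e - c) < \<bar>f e - f c\<bar>"])
      show "\<exists>c e. c < e \<and> e - c < d \<and> c \<le> x \<and> x \<le> e \<and> 2 / \<epsilon> * (e - c) < \<bar>f e - f c\<bar>"
        if "x \<in> E \<inter> {u<..<v}" "0 < d" for x d
        using that up by blast
    qed (use \<open>0 < \<epsilon>\<close> that in auto)
    have Dlm: "\<Union>D \<in> lmeasurable" by (meson D(1) lmeasurable_division)
    have len: "(\<Sum>K\<in>D. increment (\<lambda>x. x) K) = measure lebesgue (\<Union>D)"
      by (rule sum_increment_id_eq_measure[OF D(1)])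
    have len\<delta>: "measure lebesgue (\<Union>D) < \<delta>"
    proof (cases "u \<le> v")
      case True
      have "\<Union>D \<subseteq> {u..v}" using D(3) unfolding U_def by force
      then have "measure lebesgue (\<Union>D) \<le> measure lebesgue {u..v}"
        by (rule measure_mono_fmeasurable[OF _ fmeasurableD[OF Dlm]]) simp
      then show ?thesis using True uv by simp
    next
      case False
      then have "\<Union>D = {}" using D(3) unfolding U_def by force
      then show ?thesis using \<delta>(1) by (simp only: measure_empty)
    qed
    have "(\<Sum>K\<in>D. \<bar>increment f K\<bar>) < 1"
      by (rule \<delta>(2)[OF D(1)]) (use D(3) len len\<delta> in \<open>auto simp: U_def\<close>)
    moreover have "(2/\<epsilon>) * (\<Sum>K\<in>D. increment (\<lambda>x. x) K) \<le> (\<Sum>K\<in>D. \<bar>increment f K\<bar>)"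
      unfolding sum_distrib_left using D(4) by (intro sum_mono) force
    ultimately have "(2/\<epsilon>) * measure lebesgue (\<Union>D) < 1" unfolding len by linarith
    then have "measure lebesgue (\<Union>D) < \<epsilon>/2"
      using \<open>0 < \<epsilon>\<close> by (simp add: field_simps)
    moreover have "measure lebesgue (\<Union>D \<union> A) \<le> measure lebesgue (\<Union>D) + measure lebesgue A"
      by (rule measure_Un_le[OF fmeasurableD[OF Dlm] fmeasurableD[OF A(1)]])
    ultimately show "\<exists>T. E \<inter> {u<..<v} \<subseteq> T \<and> T \<in> lmeasurable \<and> measure lebesgue T < \<epsilon>"
      using A fmeasurable.Un[OF Dlm A(1)] by (intro exI[of _ "\<Union>D \<union> A"]) auto
  qed
  let ?\<C> = "{E \<inter> {u<..<v} |u v. u \<in> \<rat> \<and> v \<in> \<rat> \<and> v - u < \<delta>}"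
  have "?\<C> \<subseteq> (\<lambda>(u,v). E \<inter> {u<..<v}) ` (\<rat> \<times> \<rat>)" by auto
  then have "countable ?\<C>" 
    by (rule countable_subset) (auto intro: countable_rat)
  then have "negligible (\<Union>?\<C>)" using local by (intro negligible_countable_Union) auto
  moreover have "E \<subseteq> \<Union>?\<C>"
  proof
    fix x assume "x \<in> E"
    obtain u where "u \<in> \<rat>" "x - \<delta>/2 < u" "u < x" using Rats_dense_in_real[of "x - \<delta>/2" x] \<delta>(1) by auto
    moreover obtain v where "v \<in> \<rat>" "x < v" "v < x + \<delta>/2" using Rats_dense_in_real[of x "x + \<delta>/2"] \<delta>(1) by auto
    ultimately have "v - u < \<delta>" "x \<in> E \<inter> {u<..<v}" "u \<in> \<rat>" "v \<in> \<rat>" using \<open>x \<in> E\<close> by auto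
    then show "x \<in> \<Union>?\<C>" by blast
  qed
  ultimately show ?thesis by (rule negligible_subset)
qed

text \<open>Where \<open>f\<close> is not differentiable, either the difference quotients are unbounded, or two rational numbers
  separate their lower from their upper limit.\<close>

lemma abs_continuous_differentiable_AE:
  assumes f: "abs_continuous_interval a b f"
  obtains N where "negligible N" "\<And>x. a < x \<Longrightarrow> x < b \<Longrightarrow> x \<notin> N \<Longrightarrow> f differentiable (at x)"
proof -
  define steep where "steep = (\<lambda>R x. \<forall>d>0. \<exists>c e::real. c < e \<and> e - c < d \<and> c \<le> x \<and> x \<le> e \<and> R (e - c) (f e - f c))"
  define Epq where "Epq = (\<lambda>p q. {x \<in> {a<..<b}. steep (\<lambda>l y. q * l < y) x \<and> steep (\<lambda>l y. y < p * l) x})"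
  define Einf where "Einf = {x \<in> {a<..<b}. \<forall>q. steep (\<lambda>l y. q * l < \<bar>y\<bar>) x}"
  define N where "N = Einf \<union> \<Union>{Epq p q |p q. p \<in> \<rat> \<and> q \<in> \<rat> \<and> p < q}"
  have Epq_neg: "negligible (Epq p q)" if "p < q" for p q
    by (rule negligible_upper_lower_slope[OF f that]) (auto simp: Epq_def steep_def)
  have "countable {Epq p q |p q. p \<in> \<rat> \<and> q \<in> \<rat> \<and> p < q}"
  proof (rule countable_subset)
    show "{Epq p q |p q. p \<in> \<rat> \<and> q \<in> \<rat> \<and> p < q} \<subseteq> (\<lambda>(p,q). Epq p q) ` (\<rat> \<times> \<rat>)" by auto
  qed (auto intro: countable_rat)
  then have "negligible (\<Union>{Epq p q |p q. p \<in> \<rat> \<and> q \<in> \<rat> \<and> p < q})"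
    by (rule negligible_countable_Union) (use Epq_neg in fastforce)
  moreover have "negligible Einf"
    by (rule negligible_unbounded_slope[OF f]) (auto simp: Einf_def steep_def)
  ultimately have "negligible N" unfolding N_def by (intro negligible_Un)
  moreover have "f differentiable (at x)" if x: "a < x" "x < b" "x \<notin> N" for x
  proof -
    define Q where "Q = (\<lambda>y. (f y - f x) / (y - x))"
    have freq: "eventually (\<lambda>y. \<not> R (\<bar>y - x\<bar>) (Q y * \<bar>y - x\<bar>)) (at x)" if steep: "\<not> steep R x" for R
    proof -
      obtain d where d: "d > 0" "\<And>c e. c < e \<Longrightarrow> e - c < d \<Longrightarrow> c \<le> x \<Longrightarrow> x \<le> e \<Longrightarrow> \<not> R (e - c) (f e - f c)"
        using steep unfolding steep_def by blast
      have "\<not> R (\<bar>y - x\<bar>) (Q y * \<bar>y - x\<bar>)" if "y \<noteq> x" "dist y x < d" for y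
      proof (cases "y < x")
        case True
        then have "Q y * \<bar>y - x\<bar> = f x - f y" by (simp add: Q_def field_simps)
        then show ?thesis using d(2)[of y x] True that by (simp add: dist_real_def)
      next
        case False
        then have "Q y * \<bar>y - x\<bar> = f y - f x" using that by (simp add: Q_def field_simps)
        then show ?thesis using d(2)[of x y] False that by (simp add: dist_real_def)
      qed
      then show ?thesis unfolding eventually_at using d(1) by blast
    qed
    have neq: "eventually (\<lambda>y. y \<noteq> x) (at x)" by (simp add: eventually_at_filter)
    have up: "eventually (\<lambda>y. Q y \<le> q) (at x)" if "\<not> steep (\<lambda>l y. q * l < y) x" for q
      using freq[OF that] neq by eventually_elim (auto simp: not_less mult_le_cancel_right)
    have dn: "eventually (\<lambda>y. p \<le> Q y) (at x)" if "\<not> steep (\<lambda>l y. y < p * l) x" for p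
      using freq[OF that] neq by eventually_elim (auto simp: not_less mult_le_cancel_right)
    have "x \<notin> Einf" using x unfolding N_def by blast
    then obtain M where M: "\<not> steep (\<lambda>l y. M * l < \<bar>y\<bar>) x" using x unfolding Einf_def by auto
    have bnd: "eventually (\<lambda>y. \<bar>Q y\<bar> \<le> M) (at x)"
      using freq[OF M] neq by eventually_elim (auto simp: not_less abs_mult mult_le_cancel_right)
    \<comment> \<open>the eventual upper bounds of the difference quotients; their infimum will be the derivative\<close>
    define S where "S = {q. \<not> steep (\<lambda>l y. q * l < y) x}"
    have mono: "steep (\<lambda>l y. M * l < \<bar>y\<bar>) x" if "steep (\<lambda>l y. M * l < y) x"
      using that unfolding steep_def by (meson abs_ge_self less_le_trans)
    have "M \<in> S" using mono M unfolding S_def by blast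
    have S_lower: "-M \<le> q" if "q \<in> S" for q
    proof -
      have "eventually (\<lambda>y. Q y \<le> q \<and> \<bar>Q y\<bar> \<le> M) (at x)"
        using up[of q] that bnd unfolding S_def by (auto intro: eventually_conj)
      then have "\<exists>y. Q y \<le> q \<and> \<bar>Q y\<bar> \<le> M" by (rule eventually_happens'[OF at_neq_bot])
      then show ?thesis by fastforce
    qed
    have bddS: "bdd_below S" using S_lower by (rule bdd_belowI)
    define L where "L = Inf S"
    have "(Q \<longlongrightarrow> L) (at x)"
    proof (rule tendstoI)
      fix \<epsilon> :: real assume "0 < \<epsilon>"
      obtain q where q: "q \<in> S" "q < L + \<epsilon>"
        using cInf_lessD[of S "L + \<epsilon>"] \<open>M \<in> S\<close> \<open>0 < \<epsilon>\<close> unfolding L_def by auto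
      obtain p where p: "p \<in> \<rat>" "L - \<epsilon> < p" "p < L"
        using Rats_dense_in_real[of "L - \<epsilon>" L] \<open>0 < \<epsilon>\<close> by auto
      obtain p' where p': "p' \<in> \<rat>" "p < p'" "p' < L"
        using Rats_dense_in_real[OF p(3)] by auto
      have "p' \<notin> S" using cInf_lower[OF _ bddS, of p'] p'(3) unfolding L_def by auto
      moreover have "x \<notin> Epq p p'" using x p p' unfolding N_def by blast
      ultimately have "\<not> steep (\<lambda>l y. y < p * l) x"
        using x unfolding Epq_def S_def by auto
      then have "eventually (\<lambda>y. p \<le> Q y) (at x)" by (rule dn)
      moreover have "eventually (\<lambda>y. Q y \<le> q) (at x)" using up q(1) unfolding S_def by blast
      ultimately show "eventually (\<lambda>y. dist (Q y) L < \<epsilon>) (at x)"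
        by eventually_elim (use p q in \<open>auto simp: dist_real_def abs_less_iff\<close>)
    qed
    then have "(f has_real_derivative L) (at x)"
      unfolding Q_def has_field_derivative_iff by simp
    then show ?thesis using real_differentiable_def by blast
  qed
  ultimately show ?thesis using that by blast
qed

text \<open>Tags in the exceptional null set are controlled by absolute continuity, since the gauge can confine
  their intervals to an open set of small measure; the other tags by the derivative.\<close>

lemma abs_continuous_has_integral_derivative:
  fixes f :: "real \<Rightarrow> real"
  assumes f: "abs_continuous_interval a b f" and "a \<le> b" and N: "negligible N"
    and der: "\<And>x. a < x \<Longrightarrow> x < b \<Longrightarrow> x \<notin> N \<Longrightarrow> (f has_real_derivative f' x) (at x)"
  shows "(f' has_integral (f b - f a)) {a..b}"
proof -
  define M where "M = N \<union> {a,b}"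
  have M: "negligible M" using N unfolding M_def by (simp add: negligible_Un negligible_insert)
  define h where "h = (\<lambda>x. if x \<in> M then 0 else f' x)"
  have "(h has_integral (f b - f a)) {a..b}"
    unfolding has_integral_real
  proof (intro allI impI)
    fix e :: real assume "e > 0"
    define e' where "e' = e / (2 * (b - a + 1))"
    have e': "e' > 0" "e' * (b - a) < e/2"
      using \<open>e > 0\<close> \<open>a \<le> b\<close> by (auto simp: e'_def field_simps)
    obtain \<delta> where \<delta>: "\<delta> > 0" "\<And>D. D division_of \<Union>D \<Longrightarrow> \<Union>D \<subseteq> {a..b} \<Longrightarrow> (\<Sum>K\<in>D. increment (\<lambda>x. x) K) < \<delta>
       \<Longrightarrow> (\<Sum>K\<in>D. \<bar>increment f K\<bar>) < e/2"
      by (rule abs_continuousE[OF f half_gt_zero[OF \<open>e > 0\<close>]]) blast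
    obtain T where T: "M \<subseteq> T" "T \<in> lmeasurable" "measure lebesgue T < \<delta>/2"
      using M \<delta>(1) unfolding negligible_outer by (meson half_gt_zero)
    obtain U where U: "open U" "T \<subseteq> U" "U - T \<in> lmeasurable" "emeasure lebesgue (U - T) < ennreal (\<delta>/2)"
      using sets_lebesgue_outer_open[OF fmeasurableD[OF T(2)], of "\<delta>/2"] \<delta>(1) by auto
    have U_eq: "U = T \<union> (U - T)" using U(2) by blast
    have Ulm: "U \<in> lmeasurable" using fmeasurable.Un[OF T(2) U(3)] U_eq by simp
    have "measure lebesgue U \<le> measure lebesgue T + measure lebesgue (U - T)"
      using measure_Un_le[OF fmeasurableD[OF T(2)] fmeasurableD[OF U(3)]] U_eq by simp
    moreover have "measure lebesgue (U - T) < \<delta>/2"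
      using U(3,4) \<delta>(1) by (simp add: emeasure_eq_measure2 ennreal_less_iff)
    ultimately have mU: "measure lebesgue U < \<delta>" using T(3) by simp
    have "\<exists>d>0. \<forall>y. \<bar>y - x\<bar> < d \<longrightarrow> \<bar>f y - f x - f' x * (y - x)\<bar> \<le> e' * \<bar>y - x\<bar>"
      if "x \<in> {a..b} - M" for x
    proof -
      have "(f has_derivative (\<lambda>h. f' x * h)) (at x)"
        using der[of x] that unfolding M_def by (auto simp: has_field_derivative_def)
      then show ?thesis
        using e'(1) unfolding has_derivative_at_alt by (auto simp: mult.commute)
    qed
    then obtain d where d: "\<And>x. x \<in> {a..b} - M \<Longrightarrow> d x > 0"
      "\<And>x y. x \<in> {a..b} - M \<Longrightarrow> \<bar>y - x\<bar> < d x \<Longrightarrow> \<bar>f y - f x - f' x * (y - x)\<bar> \<le> e' * \<bar>y - x\<bar>"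
      by metis
    \<comment> \<open>The endpoints, where \<open>f\<close> need not be differentiable, are treated like the exceptional set.\<close>
    define \<gamma> where "\<gamma> = (\<lambda>x. if x \<in> M then U else if x \<in> {a..b} then ball x (d x) else UNIV)"
    have "gauge \<gamma>" using T(1) U(1,2) d(1) unfolding gauge_def \<gamma>_def by auto
    moreover have "norm ((\<Sum>(x,K)\<in>\<D>. measure lborel K *\<^sub>R h x) - (f b - f a)) < e"
      if \<D>: "\<D> tagged_division_of {a..b}" "\<gamma> fine \<D>" for \<D>
    proof -
      note tD = tagged_division_ofD[OF \<D>(1)]
      have mem: "\<exists>c e. c \<le> x \<and> x \<le> e \<and> a \<le> c \<and> e \<le> b \<and> K = {c..e} \<and> K \<subseteq> \<gamma> x" if xK: "(x,K) \<in> \<D>" for x K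
      proof -
        obtain c e where "K = cbox c e" using tD(4)[OF xK] by blast
        moreover have "x \<in> K" "K \<subseteq> {a..b}" "K \<subseteq> \<gamma> x" using tD(2,3)[OF xK] \<D>(2) xK by (auto dest: fineD)
        ultimately show ?thesis by (rule_tac x=c in exI, rule_tac x=e in exI) auto
      qed
      define \<D>1 where "\<D>1 = {(x,K) \<in> \<D>. x \<in> M}"
      define g where "g = (\<lambda>(x,K). measure lborel K *\<^sub>R h x - increment f K)"
      have tot: "(\<Sum>(x,K)\<in>\<D>. measure lborel K *\<^sub>R h x) - (f b - f a) = (\<Sum>z\<in>\<D>. g z)"
        using additive_tagged_division_1[OF \<open>a \<le> b\<close> \<D>(1), of f]
        unfolding g_def increment_def by (simp add: sum_subtractf case_prod_unfold)
      have sub: "\<D>1 \<subseteq> \<D>" unfolding \<D>1_def by auto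
      have "\<bar>\<Sum>z\<in>\<D> - \<D>1. g z\<bar> \<le> e' * (b - a)"
      proof -
        have "\<bar>g z\<bar> \<le> e' * increment (\<lambda>x. x) (snd z)" if "z \<in> \<D> - \<D>1" for z
        proof -
          obtain x K where z: "z = (x,K)" by force
          obtain c e where ce: "c \<le> x" "x \<le> e" "a \<le> c" "e \<le> b" "K = {c..e}" "K \<subseteq> \<gamma> x"
            using mem[of x K] \<open>z \<in> \<D> - \<D>1\<close> z by blast
          have x: "x \<in> {a..b} - M" using \<open>z \<in> \<D> - \<D>1\<close> z ce unfolding \<D>1_def by auto
          have "{c..e} \<subseteq> ball x (d x)" using ce(5,6) x unfolding \<gamma>_def by simp
          moreover have "c \<in> {c..e}" "e \<in> {c..e}" using ce(1,2) by auto
          ultimately have "c \<in> ball x (d x)" "e \<in> ball x (d x)" by blast+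
          then have "\<bar>f c - f x - f' x * (c - x)\<bar> \<le> e' * \<bar>c - x\<bar>" "\<bar>f e - f x - f' x * (e - x)\<bar> \<le> e' * \<bar>e - x\<bar>"
            using d(2)[OF x] by (auto simp: dist_real_def abs_minus_commute)
          moreover have "g z = (f c - f x - f' x * (c - x)) - (f e - f x - f' x * (e - x))"
            using ce x by (simp add: g_def z h_def algebra_simps)
          moreover have "e' * increment (\<lambda>x. x) (snd z) = e' * \<bar>c - x\<bar> + e' * \<bar>e - x\<bar>"
            using ce by (simp add: z algebra_simps)
          ultimately show ?thesis by linarith
        qed
        then have "\<bar>\<Sum>z\<in>\<D> - \<D>1. g z\<bar> \<le> (\<Sum>z\<in>\<D> - \<D>1. e' * increment (\<lambda>x. x) (snd z))"
          by (intro order_trans[OF sum_abs] sum_mono)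
        also have "\<dots> \<le> (\<Sum>z\<in>\<D>. e' * increment (\<lambda>x. x) (snd z))"
        proof (rule sum_mono2)
          show "0 \<le> e' * increment (\<lambda>x. x) (snd z)" if "z \<in> \<D> - (\<D> - \<D>1)" for z
          proof -
            obtain x K where z: "z = (x,K)" by force
            obtain c e where "c \<le> x" "x \<le> e" "K = {c..e}"
              using mem[of x K] \<open>z \<in> \<D> - (\<D> - \<D>1)\<close> z by blast
            then show ?thesis using e'(1) z by simp
          qed
        qed (use tD(1) in auto)
        also have "\<dots> = e' * (b - a)"
          using additive_tagged_division_1[OF \<open>a \<le> b\<close> \<D>(1), of "\<lambda>x. x"]
          by (simp add: sum_distrib_left[symmetric] increment_def case_prod_unfold)
        finally show ?thesis .
      qed
      moreover have "\<bar>\<Sum>z\<in>\<D>1. g z\<bar> < e/2"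
      proof -
        \<comment> \<open>A degenerate interval may carry several tags; discarding these intervals makes tags unique.\<close>
        define \<D>2 where "\<D>2 = {z \<in> \<D>1. increment f (snd z) \<noteq> 0}"
        have sub2: "\<D>2 \<subseteq> \<D>" using sub unfolding \<D>2_def by auto
        have "\<bar>\<Sum>z\<in>\<D>1. g z\<bar> \<le> (\<Sum>z\<in>\<D>1. \<bar>increment f (snd z)\<bar>)"
          by (intro order_trans[OF sum_abs] sum_mono) (auto simp: g_def \<D>1_def h_def)
        also have "\<dots> = (\<Sum>z\<in>\<D>2. \<bar>increment f (snd z)\<bar>)"
          by (rule sum.mono_neutral_right) (use tD(1) sub in \<open>auto simp: \<D>2_def intro: finite_subset\<close>)
        also have "\<dots> = (\<Sum>K\<in>snd ` \<D>2. \<bar>increment f K\<bar>)"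
        proof -
          have "inj_on snd \<D>2"
          proof (rule inj_onI)
            fix y z assume yz: "y \<in> \<D>2" "z \<in> \<D>2" "snd y = snd z"
            obtain x K where y: "y = (x,K)" by force
            obtain c e where ce: "c \<le> e" "K = {c..e}"
              using mem[of x K] yz sub2 y by fastforce
            have "c \<noteq> e" using yz y ce unfolding \<D>2_def by auto
            then have "interior K \<noteq> {}" using ce by simp
            then show "y = z"
              using tD(5)[of x K "fst z" "snd z"] yz sub2 y by (cases z) auto
          qed
          then show ?thesis by (simp add: sum.reindex)
        qed
        also have "\<dots> < e/2"
        proof (rule \<delta>(2))
          show div: "snd ` \<D>2 division_of \<Union>(snd ` \<D>2)"
            by (rule partial_division_of_tagged_division[of _ "{a..b}"])
               (rule tagged_partial_division_subset[OF _ sub2], use \<D>(1) in \<open>auto simp: tagged_division_of_def\<close>)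
          show "\<Union> (snd ` \<D>2) \<subseteq> {a..b}" using tD(3) sub2 by (force simp: subset_iff)
          have "\<Union> (snd ` \<D>2) \<subseteq> U"
          proof safe
            fix y x K assume "y \<in> snd (x, K)" and xK: "(x, K) \<in> \<D>2"
            moreover have "x \<in> M" using xK unfolding \<D>2_def \<D>1_def by auto
            moreover have "K \<subseteq> \<gamma> x" using mem[of x K] xK sub2 by blast
            ultimately show "y \<in> U" unfolding \<gamma>_def by auto
          qed
          then have "measure lebesgue (\<Union> (snd ` \<D>2)) \<le> measure lebesgue U"
            by (rule measure_mono_fmeasurable[OF _ fmeasurableD[OF lmeasurable_division[OF div]] Ulm])
          then show "(\<Sum>K\<in>snd ` \<D>2. increment (\<lambda>x. x) K) < \<delta>"
            using sum_increment_id_eq_measure[OF div] mU by simp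
        qed
        finally show ?thesis .
      qed
      moreover have "(\<Sum>z\<in>\<D>. g z) = (\<Sum>z\<in>\<D> - \<D>1. g z) + (\<Sum>z\<in>\<D>1. g z)"
        by (rule sum.subset_diff[OF sub tD(1)])
      ultimately show ?thesis unfolding tot real_norm_def using e'(2) by linarith
    qed
    ultimately show "\<exists>\<gamma>. gauge \<gamma> \<and> (\<forall>\<D>. \<D> tagged_division_of {a..b} \<and> \<gamma> fine \<D> \<longrightarrow>
        norm ((\<Sum>(x,K)\<in>\<D>. measure lborel K *\<^sub>R h x) - (f b - f a)) < e)"
      by (intro exI[of _ \<gamma>]) blast
  qed
  then show ?thesis
    by (rule has_integral_spike[OF M, rotated]) (auto simp: h_def)
qed

lemma abs_continuous_mult_lipschitz:
  fixes f g :: "real \<Rightarrow> real"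
  assumes f: "abs_continuous_interval a b f" and M: "\<And>x. x \<in> {a..b} \<Longrightarrow> \<bar>f x\<bar> \<le> M"
    and L: "\<And>x y. x \<in> {a..b} \<Longrightarrow> y \<in> {a..b} \<Longrightarrow> \<bar>g x - g y\<bar> \<le> L * \<bar>x - y\<bar>"
    and B: "\<And>x. x \<in> {a..b} \<Longrightarrow> \<bar>g x\<bar> \<le> B" and "0 \<le> M" "0 \<le> L" "0 \<le> B"
  shows "abs_continuous_interval a b (\<lambda>x. f x * g x)"
  unfolding abs_continuous_interval_def
proof (intro allI impI)
  fix \<epsilon> :: real assume "\<epsilon> > 0"
  define \<epsilon>1 where "\<epsilon>1 = \<epsilon> / (2 * (B + 1))"
  have \<epsilon>1: "\<epsilon>1 > 0" "B * \<epsilon>1 < \<epsilon> / 2"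
    using \<open>\<epsilon> > 0\<close> \<open>0 \<le> B\<close> by (auto simp: \<epsilon>1_def field_simps)
  define \<delta>2 where "\<delta>2 = \<epsilon> / (2 * (M * L + 1))"
  have ml: "0 \<le> M * L" using assms by simp
  have \<delta>2: "\<delta>2 > 0" "M * L * \<delta>2 < \<epsilon> / 2"
    using \<open>\<epsilon> > 0\<close> ml by (auto simp: \<delta>2_def field_simps add_nonneg_pos)
  obtain \<delta>1 where \<delta>1: "\<delta>1 > 0" "\<And>D. D division_of \<Union>D \<Longrightarrow> \<Union>D \<subseteq> {a..b} \<Longrightarrow> (\<Sum>K\<in>D. increment (\<lambda>x. x) K) < \<delta>1
       \<Longrightarrow> (\<Sum>K\<in>D. \<bar>increment f K\<bar>) < \<epsilon>1"
    by (rule abs_continuousE[OF f \<epsilon>1(1)]) blast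
  show "\<exists>\<delta>>0. \<forall>D. D division_of \<Union>D \<and> \<Union>D \<subseteq> {a..b} \<and> (\<Sum>K\<in>D. Sup K - Inf K) < \<delta> \<longrightarrow>
        (\<Sum>K\<in>D. \<bar>f (Sup K) * g (Sup K) - f (Inf K) * g (Inf K)\<bar>) < \<epsilon>"
  proof (rule exI[of _ "min \<delta>1 \<delta>2"], intro conjI allI impI)
    fix D assume D: "D division_of \<Union>D \<and> \<Union>D \<subseteq> {a..b} \<and> (\<Sum>K\<in>D. Sup K - Inf K) < min \<delta>1 \<delta>2"
    have one: "\<bar>f (Sup K) * g (Sup K) - f (Inf K) * g (Inf K)\<bar> \<le> B * \<bar>increment f K\<bar> + M * L * increment (\<lambda>x. x) K"
      if K: "K \<in> D" for K
    proof -
      obtain c e where ce: "c \<le> e" "K = {c..e}" using division_member_Icc[OF conjunct1[OF D] K] .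
      then have in_ab: "c \<in> {a..b}" "e \<in> {a..b}" using D K by fastforce+
      have "f e * g e - f c * g c = (f e - f c) * g e + f c * (g e - g c)" by (simp add: algebra_simps)
      also have "\<bar>\<dots>\<bar> \<le> \<bar>f e - f c\<bar> * \<bar>g e\<bar> + \<bar>f c\<bar> * \<bar>g e - g c\<bar>"
        by (metis abs_mult abs_triangle_ineq)
      also have "\<bar>f e - f c\<bar> * \<bar>g e\<bar> \<le> \<bar>f e - f c\<bar> * B" using B[OF in_ab(2)] by (intro mult_left_mono) auto
      also have "\<bar>f c\<bar> * \<bar>g e - g c\<bar> \<le> M * (L * \<bar>e - c\<bar>)"
        using M[OF in_ab(1)] L[OF in_ab(2,1)] \<open>0 \<le> M\<close> by (intro mult_mono) auto
      finally show ?thesis using ce by (simp add: algebra_simps)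
    qed
    have "(\<Sum>K\<in>D. increment (\<lambda>x. x) K) < min \<delta>1 \<delta>2" using D by (simp add: increment_def)
    then have len: "(\<Sum>K\<in>D. increment (\<lambda>x. x) K) < \<delta>1" "(\<Sum>K\<in>D. increment (\<lambda>x. x) K) < \<delta>2" by simp_all
    have "(\<Sum>K\<in>D. \<bar>f (Sup K) * g (Sup K) - f (Inf K) * g (Inf K)\<bar>)
      \<le> (\<Sum>K\<in>D. B * \<bar>increment f K\<bar> + M * L * increment (\<lambda>x. x) K)"
      by (rule sum_mono[OF one])
    also have "\<dots> = B * (\<Sum>K\<in>D. \<bar>increment f K\<bar>) + M * L * (\<Sum>K\<in>D. increment (\<lambda>x. x) K)"
      by (simp add: sum.distrib sum_distrib_left)
    also have "\<dots> \<le> B * \<epsilon>1 + M * L * \<delta>2"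
      using \<delta>1(2)[OF _ _ len(1)] D len(2) \<open>0 \<le> B\<close> ml by (intro add_mono mult_left_mono) auto
    also have "\<dots> < \<epsilon>" using \<epsilon>1 \<delta>2 by linarith
    finally show "(\<Sum>K\<in>D. \<bar>f (Sup K) * g (Sup K) - f (Inf K) * g (Inf K)\<bar>) < \<epsilon>" .
  qed (use \<delta>1 \<delta>2 in auto)
qed

text \<open>The derivative \<open>deriv f\<close> has unspecified values on a null set, which do not affect the integral.\<close>

lemma abs_continuous_by_parts:
  fixes f g g' :: "real \<Rightarrow> real"
  assumes f: "abs_continuous_interval a b f" and fc: "continuous_on {a..b} f" and "a \<le> b"
    and g: "\<And>x. (g has_real_derivative g' x) (at x)" and g': "continuous_on UNIV g'"
  shows "((\<lambda>x. deriv f x * g x + f x * g' x) has_integral (f b * g b - f a * g a)) {a..b}"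
proof -
  obtain N where N: "negligible N" "\<And>x. a < x \<Longrightarrow> x < b \<Longrightarrow> x \<notin> N \<Longrightarrow> f differentiable (at x)"
    by (rule abs_continuous_differentiable_AE[OF f]) blast
  have bounded: "\<exists>M\<ge>0. \<forall>x\<in>{a..b}. \<bar>h x\<bar> \<le> M" if "continuous_on {a..b} h" for h :: "real \<Rightarrow> real"
  proof -
    have "bounded (h ` {a..b})" by (intro compact_imp_bounded compact_continuous_image that compact_Icc)
    then obtain M where "\<forall>y\<in>h ` {a..b}. norm y \<le> M" unfolding bounded_iff by blast
    then show ?thesis by (intro exI[of _ "max M 0"]) auto
  qed
  have gc: "continuous_on {a..b} g"
    using g by (meson DERIV_continuous continuous_at_imp_continuous_on)
  obtain M where M: "M \<ge> 0" "\<forall>x\<in>{a..b}. \<bar>f x\<bar> \<le> M" using bounded[OF fc] by blast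
  obtain B where B: "B \<ge> 0" "\<forall>x\<in>{a..b}. \<bar>g x\<bar> \<le> B" using bounded[OF gc] by blast
  obtain L where L: "L \<ge> 0" "\<forall>x\<in>{a..b}. \<bar>g' x\<bar> \<le> L"
    using bounded[OF continuous_on_subset[OF g' subset_UNIV]] by blast
  have "norm (g x - g y) \<le> L * norm (x - y)" if "x \<in> {a..b}" "y \<in> {a..b}" for x y
    by (rule field_differentiable_bound[of "{a..b}" g g'])
       (use that L g in \<open>auto intro: DERIV_subset\<close>)
  then have "abs_continuous_interval a b (\<lambda>x. f x * g x)"
    using M B L by (intro abs_continuous_mult_lipschitz[OF f, of M g L B]) auto
  then show ?thesis
  proof (rule abs_continuous_has_integral_derivative[OF _ \<open>a \<le> b\<close> N(1)])
    fix x assume "a < x" "x < b" "x \<notin> N"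
    then have "(f has_real_derivative deriv f x) (at x)"
      using N(2) by (simp add: DERIV_deriv_iff_real_differentiable)
    from DERIV_mult[OF this g] show "((\<lambda>x. f x * g x) has_real_derivative deriv f x * g x + f x * g' x) (at x)"
      by (simp add: mult.commute)
  qed
qed

section \<open>Measurability of partial derivatives\<close>

text \<open>The derivative along a line exists where the difference quotients with rational increments satisfy
  Cauchy's criterion; continuity of \<open>u\<close> extends this to real increments. On the Borel set of these points
  the derivative is a limit of difference quotients, and off it \<open>deriv\<close> returns one and the same value.\<close>

lemma borel_measurable_partial_deriv:
  fixes u :: "'a::euclidean_space \<Rightarrow> real"
  assumes u: "continuous_on UNIV u"
  shows "partial_deriv i u \<in> borel_measurable borel"
proof -
  have um[measurable]: "u \<in> borel_measurable borel"
    using u by (rule borel_measurable_continuous_onI)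
  define q where "q = (\<lambda>h x. (u (x + h *\<^sub>R i) - u x) / h)"
  have qm[measurable]: "q h \<in> borel_measurable borel" for h
    unfolding q_def by measurable
  define close where "close = (\<lambda>k m x. \<forall>h h'::rat. 0 < \<bar>h\<bar> \<and> \<bar>of_rat h\<bar> < 1 / real (Suc k) \<and> 0 < \<bar>h'\<bar> \<and> \<bar>of_rat h'\<bar> < 1 / real (Suc k)
      \<longrightarrow> \<bar>q (of_rat h) x - q (of_rat h') x\<bar> \<le> 1 / real (Suc m))"
  define D where "D = {x. \<forall>m. \<exists>k. close k m x}"
  have Dm[measurable]: "D \<in> sets borel"
    unfolding D_def close_def by measurable
  define c where "c = (SOME l::real. False)"
  have inv_rat: "1 / real (Suc n) = of_rat (1 / of_nat (Suc n))" for n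
    by (simp only: of_rat_divide of_rat_1 of_rat_of_nat_eq)
  have deriv_iff: "((\<lambda>t. u (x + t *\<^sub>R i)) has_real_derivative l) (at 0) \<longleftrightarrow> ((\<lambda>h. q h x) \<longlongrightarrow> l) (at 0)" for x l
    unfolding has_field_derivative_iff q_def by simp
  have qcont: "isCont (\<lambda>h. q h x) h" if "h \<noteq> 0" for h x
    unfolding q_def using that u
    by (intro continuous_intros) (auto intro!: continuous_at_compose[unfolded o_def, of _ "\<lambda>h. x + h *\<^sub>R i" u] continuous_intros simp: continuous_on_eq_continuous_at)
  have D_imp: "((\<lambda>n. q (1 / real (Suc n)) x) \<longlonglongrightarrow> l) \<and> ((\<lambda>h. q h x) \<longlongrightarrow> l) (at 0)"
    if x: "x \<in> D" and l: "l = lim (\<lambda>n. q (1 / real (Suc n)) x)" for x l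
  proof -
    have cl: "\<exists>k. close k m x" for m using x unfolding D_def by blast
    let ?a = "\<lambda>n. q (1 / real (Suc n)) x"
    have seq_close: "\<bar>q (of_rat h) x - ?a n\<bar> \<le> 1 / real (Suc m)"
      if "close k m x" "0 < \<bar>h\<bar>" "\<bar>of_rat h\<bar> < 1 / real (Suc k)" "k < n" for k m n h
    proof -
      note inv_rat
      moreover have "1 / real (Suc n) < 1 / real (Suc k)" using \<open>k < n\<close> by (simp add: frac_less2)
      ultimately show ?thesis
        using that(1)[unfolded close_def, rule_format, of h "1 / of_nat (Suc n)"] that(2,3) by simp
    qed
    have "Cauchy ?a"
    proof (rule metric_CauchyI)
      fix e :: real assume "0 < e"
      then obtain m where m: "1 / real (Suc m) < e" using nat_approx_posE by metis
      obtain k where k: "close k m x" using cl by blast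
      have "dist (?a n) (?a n') < e" if "n \<ge> Suc k" "n' \<ge> Suc k" for n n'
      proof -
        note inv_rat
        moreover have "\<bar>of_rat (1 / of_nat (Suc n))\<bar> < 1 / real (Suc k)"
          unfolding inv_rat[symmetric] using that(1) by (simp add: frac_less2)
        ultimately have "\<bar>?a n - ?a n'\<bar> \<le> 1 / real (Suc m)"
          using seq_close[OF k, of "1 / of_nat (Suc n)" n'] that(2) by simp
        then show ?thesis using m by (simp add: dist_real_def)
      qed
      then show "\<exists>M. \<forall>m\<ge>M. \<forall>n\<ge>M. dist (?a m) (?a n) < e" by blast
    qed
    then have "?a \<longlonglongrightarrow> l" unfolding l
      using Cauchy_convergent_iff convergent_LIMSEQ_iff by blast
    moreover have "((\<lambda>h. q h x) \<longlongrightarrow> l) (at 0)"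
    proof (rule LIM_I)
      fix e :: real assume "0 < e"
      then obtain m where m: "1 / real (Suc m) < e" using nat_approx_posE by metis
      obtain k where k: "close k m x" using cl by blast
      have rat: "\<bar>q (of_rat h) x - l\<bar> \<le> 1 / real (Suc m)"
        if "0 < \<bar>h\<bar>" "\<bar>of_rat h\<bar> < 1 / real (Suc k)" for h
      proof (rule LIMSEQ_le_const2)
        show "(\<lambda>n. \<bar>q (of_rat h) x - ?a n\<bar>) \<longlonglongrightarrow> \<bar>q (of_rat h) x - l\<bar>"
          by (intro tendsto_intros \<open>?a \<longlonglongrightarrow> l\<close>)
        show "\<exists>N. \<forall>n\<ge>N. \<bar>q (of_rat h) x - ?a n\<bar> \<le> 1 / real (Suc m)"
          using seq_close[OF k that] by (intro exI[of _ "Suc k"]) auto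
      qed
      have "norm (q h x - l) < e" if h: "h \<noteq> 0 \<and> norm (h - 0) < 1 / real (Suc k)" for h
      proof (rule ccontr)
        assume "\<not> norm (q h x - l) < e"
        then have "1 / real (Suc m) < \<bar>q h x - l\<bar>" using m by simp
        moreover have "((\<lambda>h. \<bar>q h x - l\<bar>) \<longlongrightarrow> \<bar>q h x - l\<bar>) (at h)"
          using qcont[of h x] h by (intro tendsto_intros) (auto simp: isCont_def)
        ultimately have "eventually (\<lambda>h. 1 / real (Suc m) < \<bar>q h x - l\<bar>) (at h)"
          by (rule order_tendstoD(1)[rotated])
        then obtain d where d: "d > 0" "\<And>h'. h' \<noteq> h \<Longrightarrow> dist h' h < d \<Longrightarrow> 1 / real (Suc m) < \<bar>q h' x - l\<bar>"
          unfolding eventually_at by auto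
        define d' where "d' = min d (min \<bar>h\<bar> (1 / real (Suc k) - \<bar>h\<bar>))"
        have d': "d' > 0" using d(1) h unfolding d'_def by simp
        obtain r where r: "r \<in> \<rat>" "h < r" "r < h + d'" using Rats_dense_in_real[of h "h + d'"] d' by auto
        then obtain s where s: "r = of_rat s" by (auto elim: Rats_cases)
        have "\<bar>r - h\<bar> < d" "\<bar>r - h\<bar> < \<bar>h\<bar>" "\<bar>r - h\<bar> < 1 / real (Suc k) - \<bar>h\<bar>" using r unfolding d'_def by auto
        then have "r \<noteq> 0" "\<bar>r\<bar> < 1 / real (Suc k)" "1 / real (Suc m) < \<bar>q r x - l\<bar>"
          using d(2)[of r] r(2) by (auto simp: dist_real_def)
        with rat[of s] show False unfolding s by auto
      qed
      then show "\<exists>s>0. \<forall>h. h \<noteq> 0 \<and> norm (h - 0) < s \<longrightarrow> norm (q h x - l) < e"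
        by (intro exI[of _ "1 / real (Suc k)"]) auto
    qed
    ultimately show ?thesis by blast
  qed
  have D_conv: "x \<in> D" if "((\<lambda>h. q h x) \<longlongrightarrow> l) (at 0)" for x l
    unfolding D_def
  proof (intro CollectI allI)
    fix m
    have "1 / (2 * real (Suc m)) > 0" by simp
    from LIM_D[OF that this] obtain s where s: "s > 0"
      "\<And>h. h \<noteq> 0 \<Longrightarrow> \<bar>h\<bar> < s \<Longrightarrow> \<bar>q h x - l\<bar> < 1 / (2 * real (Suc m))" by auto
    obtain k where k: "1 / real (Suc k) < s" using nat_approx_posE[OF s(1)] by metis
    have "close k m x" unfolding close_def
    proof (intro allI impI)
      fix h h' :: rat
      assume h: "0 < \<bar>h\<bar> \<and> \<bar>of_rat h\<bar> < 1 / real (Suc k) \<and> 0 < \<bar>h'\<bar> \<and> \<bar>of_rat h'\<bar> < 1 / real (Suc k)"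
      define e where "e = 1 / (2 * real (Suc m))"
      have "\<bar>q (of_rat h) x - l\<bar> < e" "\<bar>q (of_rat h') x - l\<bar> < e"
        using s(2)[of "of_rat h"] s(2)[of "of_rat h'"] h k unfolding e_def by auto
      then have "\<bar>q (of_rat h) x - q (of_rat h') x\<bar> \<le> e + e" by linarith
      also have "e + e = 1 / real (Suc m)" by (simp add: e_def field_simps)
      finally show "\<bar>q (of_rat h) x - q (of_rat h') x\<bar> \<le> 1 / real (Suc m)" .
    qed
    then show "\<exists>k. close k m x" by blast
  qed
  have "partial_deriv i u = (\<lambda>x. if x \<in> D then lim (\<lambda>n. q (1 / real (Suc n)) x) else c)"
  proof
    fix x
    show "partial_deriv i u x = (if x \<in> D then lim (\<lambda>n. q (1 / real (Suc n)) x) else c)"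
    proof (cases "x \<in> D")
      case True
      have "((\<lambda>t. u (x + t *\<^sub>R i)) has_real_derivative lim (\<lambda>n. q (1 / real (Suc n)) x)) (at 0)"
        unfolding deriv_iff using D_imp[OF True refl] by blast
      then show ?thesis using True unfolding partial_deriv_def by (simp add: DERIV_imp_deriv)
    next
      case False
      then have "\<not> ((\<lambda>t. u (x + t *\<^sub>R i)) has_real_derivative l) (at 0)" for l
        using D_conv unfolding deriv_iff by blast
      then show ?thesis using False unfolding partial_deriv_def deriv_def c_def by simp
    qed
  qed
  moreover have "(\<lambda>x. if x \<in> D then lim (\<lambda>n. q (1 / real (Suc n)) x) else c) \<in> borel_measurable borel"
    by (intro measurable_If borel_measurable_lim_metric) measurable
  ultimately show ?thesis by simp
qed

section \<open>A mollifier, and integration over parallel lines\<close>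

text \<open>A \<open>C\<^sup>1\<close> function supported in the ball of radius \<open>r\<close>; divided by its integral it serves as mollifier.\<close>

definition bump :: "real \<Rightarrow> 'a::euclidean_space \<Rightarrow> real" where
  "bump r x = (max 0 (1 - (norm x)\<^sup>2 / r\<^sup>2))\<^sup>2"

definition grad_bump :: "real \<Rightarrow> 'a::euclidean_space \<Rightarrow> 'a" where
  "grad_bump r x = (- 4 / r\<^sup>2 * max 0 (1 - (norm x)\<^sup>2 / r\<^sup>2)) *\<^sub>R x"

lemma max_0_squared_has_derivative:
  "((\<lambda>t::real. (max 0 t)\<^sup>2) has_real_derivative 2 * max 0 t) (at t)"
proof (cases "t = 0")
  case False
  show ?thesis
  proof (cases "t > 0")
    case True
    have "((\<lambda>t::real. t\<^sup>2) has_real_derivative 2 * max 0 t) (at t)"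
      using True by (auto intro!: derivative_eq_intros)
    then show ?thesis
      by (rule has_field_derivative_transform_within_open[of _ _ _ "{0<..}"]) (use True in auto)
  next
    case neg: False
    have "((\<lambda>t::real. 0) has_real_derivative 2 * max 0 t) (at t)"
      using neg False by auto
    then show ?thesis
      by (rule has_field_derivative_transform_within_open[of _ _ _ "{..<0}"]) (use neg False in auto)
  qed
next
  case True
  have "((\<lambda>h::real. (max 0 h)\<^sup>2 / h) \<longlongrightarrow> 0) (at 0)"
  proof (rule Lim_null_comparison[of _ "\<lambda>h. \<bar>h\<bar>"])
    show "\<forall>\<^sub>F h in at 0. norm ((max 0 h)\<^sup>2 / h) \<le> \<bar>h::real\<bar>"
      by (intro always_eventually allI) (auto simp: max_def power2_eq_square)
    show "((\<lambda>h::real. \<bar>h\<bar>) \<longlongrightarrow> 0) (at 0)" by (rule tendsto_eq_intros refl | simp)+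
  qed
  then show ?thesis using True unfolding has_field_derivative_iff by simp
qed

lemma bump_has_derivative:
  "(bump r has_derivative (\<lambda>h. grad_bump r x \<bullet> h)) (at x)"
proof -
  define c where "c = inverse (r\<^sup>2)"
  have eq: "bump r = (\<lambda>t::real. (max 0 t)\<^sup>2) \<circ> (\<lambda>x. 1 - c * (x \<bullet> x))"
    by (auto simp: bump_def fun_eq_iff power2_norm_eq_inner c_def divide_inverse mult.commute)
  have "((\<lambda>x. 1 - c * (x \<bullet> x)) has_derivative (\<lambda>h. - (c * (2 * (x \<bullet> h))))) (at x)"
    by (auto intro!: derivative_eq_intros simp: inner_commute algebra_simps)
  from diff_chain_at[OF this max_0_squared_has_derivative[unfolded has_field_derivative_def]]
  show ?thesis unfolding eq
    by (rule has_derivative_eq_rhs) (simp add: grad_bump_def fun_eq_iff power2_norm_eq_inner o_def c_def divide_inverse mult_ac)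
qed

lemma continuous_on_grad_bump: "continuous_on S (grad_bump r)"
  unfolding grad_bump_def divide_inverse by (intro continuous_intros)

lemma continuous_on_bump: "continuous_on S (bump r)"
  using bump_has_derivative by (meson continuous_at_imp_continuous_on has_derivative_continuous)

lemma bump_nonneg: "0 \<le> bump r x"
  by (simp add: bump_def)

lemma bump_eq_0: "0 < r \<Longrightarrow> r \<le> norm x \<Longrightarrow> bump r x = 0"
  by (simp add: bump_def max_def field_simps power_mono)

lemma grad_bump_eq_0: "0 < r \<Longrightarrow> r \<le> norm x \<Longrightarrow> grad_bump r x = 0"
  by (simp add: grad_bump_def max_def field_simps power_mono)

lemma integrable_bump:
  fixes r :: real assumes "0 < r"
  shows "integrable lborel (bump r :: 'a::euclidean_space \<Rightarrow> real)"
proof -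
  have "integrable lborel (\<lambda>x::'a. indicator (cball 0 r) x *\<^sub>R bump r x)"
    by (rule borel_integrable_compact) (auto intro: continuous_on_bump)
  also have "(\<lambda>x::'a. indicator (cball 0 r) x *\<^sub>R bump r x) = bump r"
    using bump_eq_0[OF assms] by (force simp: fun_eq_iff indicator_def)
  finally show ?thesis .
qed

lemma integral_bump_pos:
  fixes r :: real assumes "0 < r"
  shows "0 < integral\<^sup>L lborel (bump r :: 'a::euclidean_space \<Rightarrow> real)"
proof -
  have "(9/16::real) * indicator (ball 0 (r/2)) x \<le> bump r x" for x :: 'a
  proof (cases "norm x < r/2")
    case True
    then have "(norm x)\<^sup>2 \<le> (r/2)\<^sup>2" by (intro power_mono) auto
    then have quarter: "3/4 \<le> max 0 (1 - (norm x)\<^sup>2 / r\<^sup>2)" using assms by (simp add: field_simps le_max_iff_disj)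
    have "(3/4)\<^sup>2 \<le> (max 0 (1 - (norm x)\<^sup>2 / r\<^sup>2))\<^sup>2" by (rule power_mono[OF quarter]) simp
    then show ?thesis using True by (simp add: bump_def power2_eq_square)
  qed (simp add: bump_nonneg)
  then have "integral\<^sup>L lborel (\<lambda>x::'a. (9/16::real) * indicator (ball 0 (r/2)) x) \<le> integral\<^sup>L lborel (bump r :: 'a \<Rightarrow> real)"
    by (intro integral_mono integrable_bump[OF assms] integrable_mult_right integrable_real_indicator)
       (use emeasure_lborel_ball_finite[of "0::'a" "r/2"] in auto)
  then have "(9/16::real) * measure lborel (ball (0::'a) (r/2)) \<le> integral\<^sup>L lborel (bump r :: 'a \<Rightarrow> real)"
    by simp
  moreover have "0 < measure lborel (ball (0::'a) (r/2))"
    using assms content_ball_pos[of "r/2" "0::'a"] by simp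
  ultimately show ?thesis by linarith
qed

text \<open>Lebesgue measure is the image of a product measure indexed by the basis; Fubini's theorem splits off one
  factor.\<close>

lemma integral_over_parallel_lines:
  fixes F :: "'a::euclidean_space \<Rightarrow> real"
  assumes F: "integrable lborel F" and i: "i \<in> Basis"
  shows "integral\<^sup>L lborel F = (\<integral>y. (\<integral>t. F (line_point i y t) \<partial>lborel) \<partial>(\<Pi>\<^sub>M j\<in>Basis - {i}. lborel))"
proof -
  interpret product_sigma_finite "\<lambda>_::'a. lborel :: real measure" ..
  let ?P = "\<lambda>f. \<Sum>b\<in>Basis. f b *\<^sub>R b :: 'a"
  have lb: "lborel = distr (\<Pi>\<^sub>M b\<in>Basis. lborel) borel ?P"
    unfolding lborel_eq_real using lborel_def[where 'a='a] by simp
  have Pm: "?P \<in> measurable (\<Pi>\<^sub>M b\<in>Basis. lborel) borel" by measurable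
  have Fm: "F \<in> borel_measurable borel" using F by simp
  have FP: "integrable (\<Pi>\<^sub>M b\<in>Basis. lborel) (\<lambda>f. F (?P f))"
    using F unfolding lb by (subst (asm) integrable_distr_eq[OF Pm Fm])
  have ins: "Basis = insert i (Basis - {i})" using i by blast
  have "integral\<^sup>L lborel F = (\<integral>f. F (?P f) \<partial>(\<Pi>\<^sub>M b\<in>Basis. lborel))"
    unfolding lb by (rule integral_distr[OF Pm Fm])
  also have "\<dots> = (\<integral>f. F (?P f) \<partial>(\<Pi>\<^sub>M b\<in>insert i (Basis - {i}). lborel))"
    using ins by simp
  also have "\<dots> = (\<integral>y. (\<integral>t. F (?P (y(i := t))) \<partial>lborel) \<partial>(\<Pi>\<^sub>M j\<in>Basis - {i}. lborel))"
    by (rule product_integral_insert) (use FP ins in auto)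
  also have "\<dots> = (\<integral>y. (\<integral>t. F (line_point i y t) \<partial>lborel) \<partial>(\<Pi>\<^sub>M j\<in>Basis - {i}. lborel))"
  proof -
    have "?P (y(i := t)) = line_point i y t" for y t
      unfolding line_point_def by (subst sum.remove[OF finite_Basis i]) (auto intro!: sum.cong)
    then show ?thesis by simp
  qed
  finally show ?thesis .
qed

section \<open>Smooth approximation of ACL functions\<close>

lemma line_point_inner_same: "i \<in> Basis \<Longrightarrow> line_point i y t \<bullet> i = t"
  unfolding line_point_def by (auto simp: inner_add_left inner_sum_left inner_Basis intro!: sum.neutral)

lemma line_point_inner_other: "i \<in> Basis \<Longrightarrow> j \<in> Basis - {i} \<Longrightarrow> line_point i y t \<bullet> j = y j"
  unfolding line_point_def
  by (auto simp: inner_add_left inner_sum_left inner_Basis if_distrib cong: if_cong)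

lemma line_point_add: "line_point i y t + s *\<^sub>R i = line_point i y (t + s)"
  unfolding line_point_def by (simp add: algebra_simps)

lemma partial_deriv_line_point:
  "partial_deriv i u (line_point i y t) = deriv (\<lambda>t. u (line_point i y t)) t"
proof -
  have "((\<lambda>s. u (line_point i y (t + s))) has_real_derivative D) (at 0) \<longleftrightarrow>
        ((\<lambda>s. u (line_point i y s)) has_real_derivative D) (at t)" for D
    using DERIV_shift[of "\<lambda>s. u (line_point i y s)" D 0 t] by (simp add: add.commute)
  then show ?thesis
    unfolding partial_deriv_def line_point_add deriv_def by simp
qed

lemma line_point_has_derivative: "(line_point i y has_derivative (\<lambda>h. h *\<^sub>R i)) (at t)"
  unfolding line_point_def by (auto intro!: derivative_eq_intros)

lemma lborel_integral_eq_integral_cbox: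
  fixes F :: "'a::euclidean_space \<Rightarrow> 'b::euclidean_space"
  assumes "integrable lborel F" "\<And>x. x \<notin> cbox a b \<Longrightarrow> F x = 0"
  shows "F integrable_on cbox a b" "integral\<^sup>L lborel F = integral (cbox a b) F"
proof -
  have "(F has_integral integral\<^sup>L lborel F) UNIV" by (rule has_integral_integral_lborel[OF assms(1)])
  then have "((\<lambda>x. if x \<in> cbox a b then F x else 0) has_integral integral\<^sup>L lborel F) UNIV"
    by (rule has_integral_eq[rotated]) (use assms(2) in auto)
  then have "(F has_integral integral\<^sup>L lborel F) (cbox a b)" by (simp add: has_integral_restrict_UNIV)
  then show "F integrable_on cbox a b" "integral\<^sup>L lborel F = integral (cbox a b) F"
    by (auto simp: has_integral_iff)
qed

lemma integrable_continuous_compact_support: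
  fixes F :: "'a::euclidean_space \<Rightarrow> 'b::euclidean_space"
  assumes "continuous_on UNIV F" "compact K" "\<And>x. x \<notin> K \<Longrightarrow> F x = 0"
  shows "integrable lborel F"
proof -
  have "integrable lborel (\<lambda>x. indicator K x *\<^sub>R F x)"
    by (rule borel_integrable_compact[OF assms(2) continuous_on_subset[OF assms(1)]]) auto
  also have "(\<lambda>x. indicator K x *\<^sub>R F x) = F" using assms(3) by (auto simp: indicator_def fun_eq_iff)
  finally show ?thesis .
qed

lemma integral_lborel_shift:
  fixes f :: "'a::euclidean_space \<Rightarrow> real"
  assumes "f \<in> borel_measurable borel"
  shows "(\<integral>y. f (y - x) \<partial>lborel) = integral\<^sup>L lborel f"
proof -
  have "integral\<^sup>L lborel f = integral\<^sup>L (distr lborel borel ((+) (-x))) f" by (simp add: lborel_distr_plus)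
  also have "\<dots> = (\<integral>y. f (- x + y) \<partial>lborel)" by (rule integral_distr) (use assms in auto)
  finally show ?thesis by simp
qed

text \<open>The value of \<open>deriv\<close> matters here: outside the support the derivative exists, so it is not the unspecified one.\<close>

lemma partial_deriv_eq_0:
  assumes "x \<notin> closure {x. u x \<noteq> 0}"
  shows "partial_deriv i u x = 0"
proof -
  define S where "S = (\<lambda>t::real. x + t *\<^sub>R i) -` (- closure {x. u x \<noteq> 0})"
  have S: "open S" "0 \<in> S"
    using assms unfolding S_def by (auto intro!: open_vimage continuous_intros simp del: vimage_Compl)
  have u0: "u (x + t *\<^sub>R i) = 0" if "t \<in> S" for t
    using that closure_subset[of "{x. u x \<noteq> 0}"] unfolding S_def by auto
  have "((\<lambda>_::real. 0::real) has_real_derivative 0) (at 0)" by simp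
  from has_field_derivative_transform_within_open[OF this S] u0
  have "((\<lambda>t. u (x + t *\<^sub>R i)) has_real_derivative 0) (at 0)" by simp
  then show ?thesis unfolding partial_deriv_def by (rule DERIV_imp_deriv)
qed

lemma ACLp_integrable_partial_deriv:
  fixes v :: "'a::euclidean_space \<Rightarrow> real"
  assumes v: "ACLp_on p UNIV v" and "1 \<le> p" and K: "compact (closure {x. v x \<noteq> 0})" and i: "i \<in> Basis"
  shows "integrable lborel (partial_deriv i v)"
proof -
  let ?K = "closure {x. v x \<noteq> 0}"
  have vc: "continuous_on UNIV v" using v unfolding ACLp_on_def ACL_on_def by blast
  have m[measurable]: "partial_deriv i v \<in> borel_measurable borel" by (rule borel_measurable_partial_deriv[OF vc])
  have "set_integrable lebesgue ?K (\<lambda>x. \<bar>partial_deriv i v x\<bar> ^ p)"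
    using v K i unfolding ACLp_on_def by blast
  then have "integrable lborel (\<lambda>x. indicator ?K x *\<^sub>R \<bar>partial_deriv i v x\<bar> ^ p)"
    unfolding set_integrable_def by (subst (asm) integrable_completion) auto
  moreover have "integrable lborel (\<lambda>x. indicator ?K x *\<^sub>R (1::real))"
    by (rule borel_integrable_compact[OF K]) auto
  ultimately have dom: "integrable lborel (\<lambda>x. indicator ?K x *\<^sub>R (1::real) + indicator ?K x *\<^sub>R \<bar>partial_deriv i v x\<bar> ^ p)"
    by (intro Bochner_Integration.integrable_add)
  have pw: "y \<le> 1 + y ^ p" if "0 \<le> y" for y :: real
  proof (cases "y \<le> 1")
    case True then show ?thesis using that by (simp add: add_increasing2)
  next
    case False
    then have "y ^ 1 \<le> y ^ p" using \<open>1 \<le> p\<close> by (intro power_increasing) auto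
    then show ?thesis by simp
  qed
  show ?thesis
  proof (rule Bochner_Integration.integrable_bound[OF dom])
    show "AE x in lborel. norm (partial_deriv i v x) \<le> norm (indicator ?K x *\<^sub>R (1::real) + indicator ?K x *\<^sub>R \<bar>partial_deriv i v x\<bar> ^ p)"
    proof (rule AE_I2)
      fix x
      show "norm (partial_deriv i v x) \<le> norm (indicator ?K x *\<^sub>R (1::real) + indicator ?K x *\<^sub>R \<bar>partial_deriv i v x\<bar> ^ p)"
        using pw[of "\<bar>partial_deriv i v x\<bar>"] partial_deriv_eq_0[of x v i] by (cases "x \<in> ?K") auto
    qed
  qed measurable
qed

text \<open>On almost every line the integrand is the derivative of an absolutely continuous function that
  vanishes at both ends.\<close>

lemma ACL_integration_by_parts:
  fixes v g :: "'a::euclidean_space \<Rightarrow> real"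
  assumes v: "ACL_on UNIV v" and K: "compact (closure {x. v x \<noteq> 0})" and i: "i \<in> Basis"
    and int: "integrable lborel (partial_deriv i v)"
    and g: "\<And>x. (g has_derivative (\<lambda>h. g' x \<bullet> h)) (at x)" and g': "continuous_on UNIV g'"
  shows "integrable lborel (\<lambda>x. partial_deriv i v x * g x)"
    and "(\<integral>x. partial_deriv i v x * g x \<partial>lborel) = - (\<integral>x. v x * (g' x \<bullet> i) \<partial>lborel)"
proof -
  let ?K = "closure {x. v x \<noteq> 0}"
  have vc: "continuous_on UNIV v" using v unfolding ACL_on_def by blast
  have gc: "continuous_on UNIV g" using g by (meson continuous_at_imp_continuous_on has_derivative_continuous)
  have v0: "v x = 0" if "x \<notin> ?K" for x using that closure_subset[of "{x. v x \<noteq> 0}"] by auto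
  have pd0: "partial_deriv i v x = 0" if "x \<notin> ?K" for x using that by (rule partial_deriv_eq_0)
  obtain B where B: "\<And>x. x \<in> ?K \<Longrightarrow> \<bar>g x\<bar> \<le> B"
  proof -
    have "bounded (g ` ?K)" by (intro compact_imp_bounded compact_continuous_image continuous_on_subset[OF gc] K) auto
    then show ?thesis using that unfolding bounded_iff by auto
  qed
  show I1: "integrable lborel (\<lambda>x. partial_deriv i v x * g x)"
  proof (rule Bochner_Integration.integrable_bound[OF integrable_mult_right[of "\<bar>B\<bar>", OF integrable_norm[OF int]]])
    show "(\<lambda>x. partial_deriv i v x * g x) \<in> borel_measurable lborel"
      using int borel_measurable_continuous_onI[OF gc] by auto
    show "AE x in lborel. norm (partial_deriv i v x * g x) \<le> norm (\<bar>B\<bar> * norm (partial_deriv i v x))"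
    proof (rule AE_I2)
      fix x
      show "norm (partial_deriv i v x * g x) \<le> norm (\<bar>B\<bar> * norm (partial_deriv i v x))"
      proof (cases "x \<in> ?K")
        case True
        then have "\<bar>g x\<bar> \<le> \<bar>B\<bar>" using B by fastforce
        then show ?thesis by (simp add: abs_mult mult.commute mult_right_mono)
      qed (use pd0 in simp)
    qed
  qed
  have I2: "integrable lborel (\<lambda>x. v x * (g' x \<bullet> i))"
  proof (rule integrable_continuous_compact_support[OF _ K])
    show "continuous_on UNIV (\<lambda>x. v x * (g' x \<bullet> i))"
      by (intro continuous_on_mult continuous_on_inner vc g' continuous_on_const)
    show "v x * (g' x \<bullet> i) = 0" if "x \<notin> ?K" for x using v0[OF that] by simp
  qed
  define F where "F = (\<lambda>x. partial_deriv i v x * g x + v x * (g' x \<bullet> i))"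
  have F: "integrable lborel F" unfolding F_def using I1 I2 by simp
  obtain b where b: "?K \<subseteq> box (-b) b" using bounded_subset_box_symmetric[OF compact_imp_bounded[OF K]] .
  have F0: "F x = 0" if "x \<notin> box (-b) b" for x
    using that b v0 pd0 unfolding F_def by (metis add_0 mult_zero_left subsetD)
  have "AE y in (\<Pi>\<^sub>M j\<in>Basis - {i}. lborel). (\<integral>t. F (line_point i y t) \<partial>lborel) = 0"
  proof -
    have "AE y in (\<Pi>\<^sub>M j\<in>Basis - {i}. lborel).
          (\<forall>j\<in>Basis - {i}. (-b) \<bullet> j \<le> y j \<and> y j \<le> b \<bullet> j) \<longrightarrow>
          abs_continuous_interval ((-b) \<bullet> i) (b \<bullet> i) (\<lambda>t. v (line_point i y t))"
      using v i unfolding ACL_on_def by blast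
    then show ?thesis
    proof (rule AE_mp, intro AE_I2 impI)
      fix y assume y: "(\<forall>j\<in>Basis - {i}. (-b) \<bullet> j \<le> y j \<and> y j \<le> b \<bullet> j) \<longrightarrow>
          abs_continuous_interval ((-b) \<bullet> i) (b \<bullet> i) (\<lambda>t. v (line_point i y t))"
      show "(\<integral>t. F (line_point i y t) \<partial>lborel) = 0"
      proof (cases "(\<forall>j\<in>Basis - {i}. (-b) \<bullet> j \<le> y j \<and> y j \<le> b \<bullet> j) \<and> (-b) \<bullet> i \<le> b \<bullet> i \<and> integrable lborel (\<lambda>t. F (line_point i y t))")
        case True
        let ?f = "\<lambda>t. v (line_point i y t)" and ?h = "\<lambda>t. g (line_point i y t)" and ?h' = "\<lambda>t. g' (line_point i y t) \<bullet> i"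
        have lc: "continuous_on UNIV (line_point i y)"
          using line_point_has_derivative by (meson continuous_at_imp_continuous_on has_derivative_continuous)
        have "((\<lambda>t. deriv ?f t * ?h t + ?f t * ?h' t) has_integral
            (?f (b \<bullet> i) * ?h (b \<bullet> i) - ?f ((-b) \<bullet> i) * ?h ((-b) \<bullet> i))) {(-b) \<bullet> i..b \<bullet> i}"
        proof (rule abs_continuous_by_parts)
          show "(?h has_real_derivative ?h' t) (at t)" for t
            using diff_chain_at[OF line_point_has_derivative g, of i y t]
            by (simp add: o_def has_field_derivative_def mult_commute_abs)
          show "continuous_on {(-b) \<bullet> i..b \<bullet> i} ?f"
            using continuous_on_compose2[OF vc lc] continuous_on_subset by blast
          show "continuous_on UNIV ?h'"
            using continuous_on_compose2[OF g' lc] by (auto intro!: continuous_intros)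
        qed (use True y in auto)
        moreover have "?f (b \<bullet> i) = 0"
          using b v0[of "line_point i y (b \<bullet> i)"] i line_point_inner_same[OF i, of y "b \<bullet> i"] by (force simp: mem_box)
        moreover have "?f ((-b) \<bullet> i) = 0"
          using b v0[of "line_point i y ((-b) \<bullet> i)"] i line_point_inner_same[OF i, of y "(-b) \<bullet> i"] by (force simp: mem_box)
        ultimately have "((\<lambda>t. F (line_point i y t)) has_integral 0) {(-b) \<bullet> i..b \<bullet> i}"
          unfolding F_def partial_deriv_line_point by simp
        moreover have "F (line_point i y t) = 0" if "t \<notin> cbox ((-b) \<bullet> i) (b \<bullet> i)" for t
          using that F0[of "line_point i y t"] i line_point_inner_same[OF i, of y t] by (force simp: mem_box)
        then have "(\<integral>t. F (line_point i y t) \<partial>lborel) = integral (cbox ((-b) \<bullet> i) (b \<bullet> i)) (\<lambda>t. F (line_point i y t))"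
          using True by (intro lborel_integral_eq_integral_cbox(2)) auto
        ultimately show ?thesis by (simp add: integral_unique)
      next
        case False
        \<comment> \<open>The Bochner integral of a function that is not integrable is \<open>0\<close>, so such lines need no separate argument.\<close>
        then consider "\<not> integrable lborel (\<lambda>t. F (line_point i y t))" | "\<not> ((\<forall>j\<in>Basis - {i}. (-b) \<bullet> j \<le> y j \<and> y j \<le> b \<bullet> j) \<and> (-b) \<bullet> i \<le> b \<bullet> i)"
          by blast
        then show ?thesis
        proof cases
          case 1 then show ?thesis by (rule not_integrable_integral_eq)
        next
          case 2
          have "line_point i y t \<notin> box (-b) b" for t
          proof
            assume "line_point i y t \<in> box (-b) b"
            then have in_box: "(-b) \<bullet> j < line_point i y t \<bullet> j \<and> line_point i y t \<bullet> j < b \<bullet> j" if "j \<in> Basis" for j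
              using that unfolding mem_box by blast
            have "(-b) \<bullet> i \<le> b \<bullet> i" using in_box[OF i] by linarith
            moreover have "(-b) \<bullet> j \<le> y j \<and> y j \<le> b \<bullet> j" if "j \<in> Basis - {i}" for j
              using in_box[of j] that unfolding line_point_inner_other[OF i that] by auto
            ultimately show False using 2 by blast
          qed
          then show ?thesis using F0 by simp
        qed
      qed
    qed
  qed
  then have "integral\<^sup>L lborel F = 0"
    unfolding integral_over_parallel_lines[OF F i] by (rule integral_eq_zero_AE)
  then show "(\<integral>x. partial_deriv i v x * g x \<partial>lborel) = - (\<integral>x. v x * (g' x \<bullet> i) \<partial>lborel)"
    unfolding F_def using I1 I2 by simp
qed

lemma grad_inner_Basis: "i \<in> Basis \<Longrightarrow> grad u x \<bullet> i = partial_deriv i u x"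
  unfolding grad_def by (simp add: inner_sum_left_Basis)

lemma borel_measurable_grad:
  assumes "continuous_on UNIV (u :: 'a::euclidean_space \<Rightarrow> real)"
  shows "grad u \<in> borel_measurable borel"
  unfolding grad_def[abs_def] using borel_measurable_partial_deriv[OF assms]
  by (intro borel_measurable_sum borel_measurable_scaleR borel_measurable_const) auto

text \<open>Bernoulli's inequality for \<open>x / A\<close>, cleared of denominators.\<close>

lemma power_ge_tangent:
  fixes x A :: real
  assumes "0 \<le> x" "0 \<le> A"
  shows "A ^ n + real n * A ^ (n - 1) * (x - A) \<le> x ^ n"
proof (cases n)
  case (Suc m)
  show ?thesis
  proof (cases "A = 0")
    case True
    then show ?thesis using assms Suc by (cases m) auto
  next
    case False
    then have A: "A > 0" using assms by simp
    have "1 + real n * (x / A - 1) \<le> (1 + (x / A - 1)) ^ n"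
      by (rule Bernoulli_inequality) (use A assms in auto)
    then have "A ^ n * (1 + real n * (x / A - 1)) \<le> A ^ n * (x / A) ^ n"
      using A by (intro mult_left_mono) auto
    also have "\<dots> = x ^ n" using A by (simp add: power_divide)
    also have "A ^ n * (1 + real n * (x / A - 1)) = A ^ n + real n * A ^ (n - 1) * (x - A)"
      using A Suc by (simp add: field_simps)
    finally show ?thesis .
  qed
qed simp

text \<open>Jensen's inequality for the probability density \<open>\<eta>\<close>: integrate the tangent inequality at the mean of the norms.\<close>

lemma norm_weighted_integral_power_le:
  fixes g :: "'a::euclidean_space \<Rightarrow> 'b::euclidean_space" and \<eta> :: "'a \<Rightarrow> real"
  assumes g: "integrable lborel g" and \<eta>: "integrable lborel \<eta>" "\<And>y. 0 \<le> \<eta> y" "(\<integral>y. \<eta> y \<partial>lborel) = 1"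
    and \<eta>g: "integrable lborel (\<lambda>y. \<eta> y *\<^sub>R g y)"
  shows "ennreal (norm (\<integral>y. \<eta> y *\<^sub>R g y \<partial>lborel) ^ n) \<le> (\<integral>\<^sup>+y. ennreal (\<eta> y * norm (g y) ^ n) \<partial>lborel)"
proof (cases "integrable lborel (\<lambda>y. \<eta> y * norm (g y) ^ n)")
  case True
  define A where "A = (\<integral>y. \<eta> y * norm (g y) \<partial>lborel)"
  have A_int: "integrable lborel (\<lambda>y. \<eta> y * norm (g y))"
    using integrable_norm[OF \<eta>g] \<eta>(2) by simp
  have A0: "0 \<le> A" unfolding A_def using \<eta>(2) by (intro Bochner_Integration.integral_nonneg) auto
  have "norm (\<integral>y. \<eta> y *\<^sub>R g y \<partial>lborel) \<le> A"
    unfolding A_def using integral_norm_bound[of lborel "\<lambda>y. \<eta> y *\<^sub>R g y"] \<eta>(2) by simp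
  then have "norm (\<integral>y. \<eta> y *\<^sub>R g y \<partial>lborel) ^ n \<le> A ^ n" by (intro power_mono) auto
  also have "A ^ n = (\<integral>y. \<eta> y * A ^ n + real n * A ^ (n - 1) * (\<eta> y * norm (g y) - \<eta> y * A) \<partial>lborel)"
    using A_int \<eta>(1,3) by (simp add: A_def[symmetric])
  also have "\<dots> \<le> (\<integral>y. \<eta> y * norm (g y) ^ n \<partial>lborel)"
  proof (rule integral_mono[OF _ True])
    show "integrable lborel (\<lambda>y. \<eta> y * A ^ n + real n * A ^ (n - 1) * (\<eta> y * norm (g y) - \<eta> y * A))"
      using A_int \<eta>(1) by simp
    show "\<eta> y * A ^ n + real n * A ^ (n - 1) * (\<eta> y * norm (g y) - \<eta> y * A) \<le> \<eta> y * norm (g y) ^ n" for y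
      using mult_left_mono[OF power_ge_tangent[OF norm_ge_zero A0, of n "g y"] \<eta>(2)[of y]]
      by (simp add: algebra_simps)
  qed
  finally have "ennreal (norm (\<integral>y. \<eta> y *\<^sub>R g y \<partial>lborel) ^ n) \<le> ennreal (\<integral>y. \<eta> y * norm (g y) ^ n \<partial>lborel)"
    by (rule ennreal_leI)
  also have "\<dots> = (\<integral>\<^sup>+y. ennreal (\<eta> y * norm (g y) ^ n) \<partial>lborel)"
    using True \<eta>(2) by (intro nn_integral_eq_integral[symmetric]) auto
  finally show ?thesis .
next
  case False
  have "(\<lambda>y. \<eta> y * norm (g y) ^ n) \<in> borel_measurable lborel"
    using g \<eta>(1) by (intro borel_measurable_times borel_measurable_power borel_measurable_norm) auto
  then have "\<not> (\<integral>\<^sup>+y. ennreal (norm (\<eta> y * norm (g y) ^ n)) \<partial>lborel) < \<infinity>"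
    using False unfolding integrable_iff_bounded by blast
  moreover have "norm (\<eta> y * norm (g y) ^ n) = \<eta> y * norm (g y) ^ n" for y using \<eta>(2) by simp
  ultimately have "(\<integral>\<^sup>+y. ennreal (\<eta> y * norm (g y) ^ n) \<partial>lborel) = \<infinity>"
    by (simp flip: less_top)
  then show ?thesis by simp
qed

text \<open>The convolution of \<open>v\<close> with the normalised bump. Differentiating the bump shows that it is \<open>C\<^sup>1\<close>; integrating by
  parts turns its gradient into the average of the gradient of \<open>v\<close>, and then Jensen and Tonelli bound the energy.\<close>

lemma smooth_approximation:
  fixes v :: "'a::euclidean_space \<Rightarrow> real"
  assumes v: "ACLp_on DIM('a) UNIV v" and K: "compact (closure {x. v x \<noteq> 0})"
    and v0: "\<And>x. 0 \<le> v x" and r: "0 < r" and osc: "\<And>x y. dist x y < r \<Longrightarrow> \<bar>v x - v y\<bar> \<le> \<epsilon>"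
  obtains w W where "\<And>x. (w has_derivative (\<lambda>h. W x \<bullet> h)) (at x)" "continuous_on UNIV W"
    "\<And>x. 0 \<le> w x" "\<And>x. \<bar>w x - v x\<bar> \<le> \<epsilon>" "\<And>x. w x \<noteq> 0 \<Longrightarrow> \<exists>y. v y \<noteq> 0 \<and> dist x y < r"
    "(\<integral>\<^sup>+x. ennreal (norm (W x) ^ DIM('a)) \<partial>lborel) \<le> (\<integral>\<^sup>+x. ennreal (norm (grad v x) ^ DIM('a)) \<partial>lborel)"
proof -
  let ?K = "closure {x. v x \<noteq> 0}"
  have acl: "ACL_on UNIV v" and vc: "continuous_on UNIV v" using v unfolding ACLp_on_def ACL_on_def by blast+
  have vK: "v x = 0" if "x \<notin> ?K" for x using that closure_subset[of "{x. v x \<noteq> 0}"] by auto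
  have pd_int: "integrable lborel (partial_deriv i v)" if "i \<in> Basis" for i
    by (rule ACLp_integrable_partial_deriv[OF v _ K that]) simp
  define c where "c = integral\<^sup>L lborel (bump r :: 'a \<Rightarrow> real)"
  have c: "c > 0" unfolding c_def by (rule integral_bump_pos[OF r])
  define \<eta> where "\<eta> = (\<lambda>x y::'a. bump r (y - x) / c)"
  have bump_m[measurable]: "bump r \<in> borel_measurable (borel :: 'a measure)"
    by (rule borel_measurable_continuous_onI[OF continuous_on_bump])
  have \<eta>_nonneg: "0 \<le> \<eta> x y" for x y unfolding \<eta>_def using c by (intro divide_nonneg_nonneg bump_nonneg) simp
  have \<eta>_sym: "\<eta> x y = \<eta> y x" for x y unfolding \<eta>_def bump_def by (simp add: norm_minus_commute)
  have \<eta>_0: "\<eta> x y = 0" if "r \<le> dist x y" for x y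
    using bump_eq_0[OF r, of "y - x"] that unfolding \<eta>_def by (simp add: dist_norm norm_minus_commute)
  have \<eta>_der: "(\<eta> x has_derivative (\<lambda>h. (grad_bump r (y - x) /\<^sub>R c) \<bullet> h)) (at y)" for x y
  proof -
    have "((\<lambda>y. y - x) has_derivative (\<lambda>h. h)) (at y)" by (auto intro!: derivative_eq_intros)
    from diff_chain_at[OF this bump_has_derivative]
    have "((\<lambda>y. bump r (y - x)) has_derivative (\<lambda>h. grad_bump r (y - x) \<bullet> h)) (at y)" by (simp add: o_def)
    from has_derivative_mult_right[OF this, of "inverse c"]
    show ?thesis unfolding \<eta>_def by (simp add: divide_inverse mult.commute)
  qed
  have \<eta>'_cont: "continuous_on UNIV (\<lambda>y. grad_bump r (y - x) /\<^sub>R c)" for x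
    by (intro continuous_intros continuous_on_compose2[OF continuous_on_grad_bump[of UNIV]]) auto
  have \<eta>_cont: "continuous_on UNIV (\<eta> x)" for x
    using \<eta>_der by (meson continuous_at_imp_continuous_on has_derivative_continuous)
  have \<eta>_int: "integrable lborel (\<eta> x)" for x
    by (rule integrable_continuous_compact_support[OF \<eta>_cont compact_cball[of x r]]) (use \<eta>_0 in auto)
  have \<eta>_1: "(\<integral>y. \<eta> x y \<partial>lborel) = 1" for x
    unfolding \<eta>_def using integral_lborel_shift[of "bump r" x] c by (simp add: c_def)
  have v\<eta>_int: "integrable lborel (\<lambda>y. v y * \<eta> x y)" for x
  proof (rule integrable_continuous_compact_support[OF _ K])
    show "continuous_on UNIV (\<lambda>y. v y * \<eta> x y)" by (intro continuous_on_mult vc \<eta>_cont)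
    show "v y * \<eta> x y = 0" if "y \<notin> ?K" for y using vK[OF that] by simp
  qed
  define w where "w = (\<lambda>x. \<integral>y. v y * \<eta> x y \<partial>lborel)"
  define W where "W = (\<lambda>x. \<integral>y. \<eta> x y *\<^sub>R grad v y \<partial>lborel)"
  define f where "f = (\<lambda>x y. v y *\<^sub>R (grad_bump r (x - y) /\<^sub>R c))"
  have f_cont: "continuous_on UNIV (\<lambda>z. f (fst z) (snd z))"
    unfolding f_def
    by (intro continuous_intros continuous_on_compose2[OF vc] continuous_on_compose2[OF continuous_on_grad_bump[of UNIV]]) auto
  have f_cont1: "continuous_on UNIV (f x)" for x
    using continuous_on_compose2[OF f_cont continuous_on_Pair[OF continuous_on_const continuous_on_id, of UNIV x]] by simp
  have f_int: "integrable lborel (f x)" for x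
  proof (rule integrable_continuous_compact_support[OF f_cont1 K])
    show "f x y = 0" if "y \<notin> ?K" for y using vK[OF that] by (simp add: f_def)
  qed
  have grad_int: "integrable lborel (grad v)"
    unfolding grad_def[abs_def] using pd_int by (intro Bochner_Integration.integrable_sum integrable_scaleR_left) auto
  have parts: "integrable lborel (\<lambda>y. partial_deriv i v y * \<eta> x y)"
    "(\<integral>y. partial_deriv i v y * \<eta> x y \<partial>lborel) = - (\<integral>y. v y * ((grad_bump r (y - x) /\<^sub>R c) \<bullet> i) \<partial>lborel)"
    if "i \<in> Basis" for i x
    using ACL_integration_by_parts[OF acl K that pd_int[OF that] \<eta>_der \<eta>'_cont] by blast+
  have \<eta>grad: "\<eta> x y *\<^sub>R grad v y = (\<Sum>i\<in>Basis. (partial_deriv i v y * \<eta> x y) *\<^sub>R i)" for x y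
    unfolding grad_def by (simp add: scaleR_sum_right mult.commute)
  have \<eta>grad_int: "integrable lborel (\<lambda>y. \<eta> x y *\<^sub>R grad v y)" for x
    unfolding \<eta>grad using parts(1) by (intro Bochner_Integration.integrable_sum integrable_scaleR_left) auto
  have W_f: "W x = (\<integral>y. f x y \<partial>lborel)" for x
  proof (rule euclidean_eqI)
    fix i :: 'a assume i: "i \<in> Basis"
    have "W x \<bullet> i = (\<integral>y. (\<eta> x y *\<^sub>R grad v y) \<bullet> i \<partial>lborel)"
      unfolding W_def by (rule integral_inner_left[symmetric]) (use \<eta>grad_int in simp)
    also have "\<dots> = (\<integral>y. partial_deriv i v y * \<eta> x y \<partial>lborel)"
      by (simp add: grad_inner_Basis[OF i] mult.commute)
    also have "\<dots> = - (\<integral>y. v y * ((grad_bump r (y - x) /\<^sub>R c) \<bullet> i) \<partial>lborel)" by (rule parts(2)[OF i])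
    also have "\<dots> = (\<integral>y. f x y \<bullet> i \<partial>lborel)"
    proof -
      have "f x y \<bullet> i = - (v y * ((grad_bump r (y - x) /\<^sub>R c) \<bullet> i))" for y
        unfolding f_def grad_bump_def by (simp add: norm_minus_commute inner_diff_left algebra_simps)
      then show ?thesis by simp
    qed
    also have "\<dots> = (\<integral>y. f x y \<partial>lborel) \<bullet> i"
      by (rule integral_inner_left) (use f_int in simp)
    finally show "W x \<bullet> i = (\<integral>y. f x y \<partial>lborel) \<bullet> i" .
  qed
  obtain b where b: "?K \<subseteq> cbox (-b) b" using bounded_subset_cbox_symmetric[OF compact_imp_bounded[OF K]] .
  have vb: "v x = 0" if "x \<notin> cbox (-b) b" for x using that b vK by blast
  have w_box: "w x = integral (cbox (-b) b) (\<lambda>y. v y * \<eta> x y)" for x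
    unfolding w_def by (rule lborel_integral_eq_integral_cbox(2)[OF v\<eta>_int]) (simp add: vb)
  have W_box: "W x = integral (cbox (-b) b) (f x)" for x
    unfolding W_f by (rule lborel_integral_eq_integral_cbox(2)[OF f_int]) (simp add: vb f_def)
  have W_cont: "continuous_on UNIV W"
    unfolding W_box[abs_def]
    by (rule integral_continuous_on_param) (use continuous_on_subset[OF f_cont] in \<open>auto simp: case_prod_unfold\<close>)
  have w_der: "(w has_derivative (\<lambda>h. W x \<bullet> h)) (at x)" for x
  proof -
    have fd: "((\<lambda>x. v y * \<eta> x y) has_derivative blinfun_apply (blinfun_inner_left (f x y))) (at x within UNIV)" for x y
    proof -
      have "((\<lambda>x. v y * \<eta> y x) has_derivative (\<lambda>h. v y * ((grad_bump r (x - y) /\<^sub>R c) \<bullet> h))) (at x)"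
        by (rule has_derivative_mult_right[OF \<eta>_der])
      then show ?thesis unfolding f_def by (simp add: \<eta>_sym[of _ y] inner_commute mult.assoc)
    qed
    have "((\<lambda>x. integral (cbox (-b) b) (\<lambda>y. v y * \<eta> x y)) has_derivative
      blinfun_apply (integral (cbox (-b) b) (\<lambda>y. blinfun_inner_left (f x y)))) (at x within UNIV)"
    proof (rule leibniz_rule[OF fd])
      show "continuous_on (UNIV \<times> cbox (-b) b) (\<lambda>(x, y). blinfun_inner_left (f x y))"
        unfolding case_prod_unfold
        by (rule bounded_linear.continuous_on[OF bounded_linear_blinfun_inner_left])
           (rule continuous_on_subset[OF f_cont], simp)
      show "(\<lambda>y. v y * \<eta> x y) integrable_on cbox (-b) b" for x
        by (intro integrable_continuous continuous_on_mult continuous_on_subset[OF vc] continuous_on_subset[OF \<eta>_cont]) auto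
    qed auto
    moreover have "blinfun_apply (integral (cbox (-b) b) (\<lambda>y. blinfun_inner_left (f x y))) = (\<lambda>h. W x \<bullet> h)"
    proof
      fix h
      have fi: "f x integrable_on cbox (-b) b" by (rule integrable_continuous[OF continuous_on_subset[OF f_cont1]]) simp
      have "integral (cbox (-b) b) (blinfun_inner_left \<circ> f x) = blinfun_inner_left (integral (cbox (-b) b) (f x))"
        by (rule integral_linear[OF fi bounded_linear_blinfun_inner_left])
      then show "blinfun_apply (integral (cbox (-b) b) (\<lambda>y. blinfun_inner_left (f x y))) h = W x \<bullet> h"
        by (simp add: o_def W_box inner_commute)
    qed
    ultimately show ?thesis unfolding w_box[abs_def] by simp
  qed
  have w_nonneg: "0 \<le> w x" for x
    unfolding w_def using v0 \<eta>_nonneg by (intro Bochner_Integration.integral_nonneg) auto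
  have w_close: "\<bar>w x - v x\<bar> \<le> \<epsilon>" for x
  proof -
    have "w x - v x = (\<integral>y. v y * \<eta> x y - v x * \<eta> x y \<partial>lborel)"
      unfolding w_def using v\<eta>_int \<eta>_int \<eta>_1 by simp
    also have "\<bar>\<dots>\<bar> \<le> (\<integral>y. \<bar>v y * \<eta> x y - v x * \<eta> x y\<bar> \<partial>lborel)" by (rule integral_abs_bound)
    also have "\<dots> \<le> (\<integral>y. \<epsilon> * \<eta> x y \<partial>lborel)"
    proof (rule integral_mono)
      show "\<bar>v y * \<eta> x y - v x * \<eta> x y\<bar> \<le> \<epsilon> * \<eta> x y" for y
      proof (cases "dist x y < r")
        case True
        have "\<bar>v y * \<eta> x y - v x * \<eta> x y\<bar> = \<bar>v x - v y\<bar> * \<eta> x y"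
          using \<eta>_nonneg[of x y] by (simp add: abs_mult left_diff_distrib[symmetric] abs_minus_commute)
        then show ?thesis using osc[OF True] \<eta>_nonneg[of x y] by (simp add: mult_right_mono)
      qed (use \<eta>_0[of x y] in simp)
    qed (use v\<eta>_int \<eta>_int in auto)
    also have "\<dots> = \<epsilon>" using \<eta>_1 by simp
    finally show ?thesis .
  qed
  have w_supp: "\<exists>y. v y \<noteq> 0 \<and> dist x y < r" if "w x \<noteq> 0" for x
  proof (rule ccontr)
    assume "\<nexists>y. v y \<noteq> 0 \<and> dist x y < r"
    then have "v y * \<eta> x y = 0" for y using \<eta>_0[of x y] by (cases "v y = 0") auto
    then have "(\<lambda>y. v y * \<eta> x y) = (\<lambda>_. 0)" by blast
    then show False using that unfolding w_def by simp
  qed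
  have gm[measurable]: "grad v \<in> borel_measurable borel" by (rule borel_measurable_grad[OF vc])
  have "(\<integral>\<^sup>+x. ennreal (norm (W x) ^ DIM('a)) \<partial>lborel) \<le>
      (\<integral>\<^sup>+x. (\<integral>\<^sup>+y. ennreal (\<eta> x y * norm (grad v y) ^ DIM('a)) \<partial>lborel) \<partial>lborel)"
    unfolding W_def
    by (intro nn_integral_mono norm_weighted_integral_power_le grad_int \<eta>_int \<eta>_nonneg \<eta>_1 \<eta>grad_int)
  also have "\<dots> = (\<integral>\<^sup>+y. (\<integral>\<^sup>+x. ennreal (\<eta> x y * norm (grad v y) ^ DIM('a)) \<partial>lborel) \<partial>lborel)"
    by (rule lborel_pair.Fubini') (simp add: \<eta>_def case_prod_unfold)
  also have "\<dots> = (\<integral>\<^sup>+y. ennreal (norm (grad v y) ^ DIM('a)) \<partial>lborel)"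
  proof (rule nn_integral_cong)
    fix y
    have "(\<integral>\<^sup>+x. ennreal (\<eta> x y * norm (grad v y) ^ DIM('a)) \<partial>lborel) =
       (\<integral>\<^sup>+x. ennreal (\<eta> y x) * ennreal (norm (grad v y) ^ DIM('a)) \<partial>lborel)"
      by (simp add: \<eta>_sym[of _ y] ennreal_mult \<eta>_nonneg)
    also have "\<dots> = (\<integral>\<^sup>+x. ennreal (\<eta> y x) \<partial>lborel) * ennreal (norm (grad v y) ^ DIM('a))"
      by (rule nn_integral_multc) (use \<eta>_int in simp)
    also have "(\<integral>\<^sup>+x. ennreal (\<eta> y x) \<partial>lborel) = 1"
      using nn_integral_eq_integral[OF \<eta>_int, of y] \<eta>_nonneg \<eta>_1 by simp
    finally show "(\<integral>\<^sup>+x. ennreal (\<eta> x y * norm (grad v y) ^ DIM('a)) \<partial>lborel) = ennreal (norm (grad v y) ^ DIM('a))"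
      by simp
  qed
  finally show ?thesis
    using that[OF w_der W_cont w_nonneg w_close w_supp] by blast
qed

section \<open>Test functions of condensers\<close>

lemma continuous_compact_support_uniform:
  fixes v :: "'a::euclidean_space \<Rightarrow> real"
  assumes vc: "continuous_on UNIV v" and K: "compact K" and v0: "\<And>x. x \<notin> K \<Longrightarrow> v x = 0" and \<epsilon>: "0 < \<epsilon>"
  obtains r where "0 < r" "\<And>x y. dist x y < r \<Longrightarrow> \<bar>v x - v y\<bar> < \<epsilon>"
proof -
  obtain M where "\<forall>x\<in>K. norm x \<le> M" using compact_imp_bounded[OF K] unfolding bounded_iff by blast
  then have M: "K \<subseteq> cball 0 M" by auto
  have "uniformly_continuous_on (cball 0 (M + 1)) v"
    by (rule compact_uniformly_continuous[OF continuous_on_subset[OF vc]]) auto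
  then obtain d where d: "d > 0" "\<And>x y. x \<in> cball 0 (M + 1) \<Longrightarrow> y \<in> cball 0 (M + 1) \<Longrightarrow> dist y x < d \<Longrightarrow> dist (v y) (v x) < \<epsilon>"
    using \<epsilon> unfolding uniformly_continuous_on_def by metis
  have "\<bar>v x - v y\<bar> < \<epsilon>" if xy: "dist x y < min d 1" for x y
  proof (cases "x \<in> cball 0 M \<or> y \<in> cball 0 M")
    case True
    have "norm y \<le> norm x + dist x y" "norm x \<le> norm y + dist x y"
      using norm_triangle_ineq2[of y x] norm_triangle_ineq2[of x y] by (auto simp: dist_norm norm_minus_commute)
    then have "x \<in> cball 0 (M + 1)" "y \<in> cball 0 (M + 1)" using True xy by auto
    then show ?thesis using d(2)[of y x] xy by (simp add: dist_real_def)
  next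
    case False
    then have "v x = 0" "v y = 0" using v0[of x] v0[of y] M by blast+
    then show ?thesis using \<epsilon> by simp
  qed
  then show ?thesis using that[of "min d 1"] d(1) by simp
qed

text \<open>A smooth approximation may fall slightly below \<open>1\<close> on \<open>F\<close>; dividing by \<open>1 - \<epsilon>\<close> repairs this and increases the
  energy by a factor that is absorbed by the strict inequality.\<close>

lemma condenser_smooth_test_function:
  fixes A F :: "'a::euclidean_space set"
  assumes A: "open A" and cap: "condenser_cap A F < c"
  obtains w W where "\<And>x. (w has_derivative (\<lambda>h. W x \<bullet> h)) (at x)" "continuous_on UNIV W"
    "\<And>x. 0 \<le> w x" "\<And>x. x \<in> F \<Longrightarrow> 1 \<le> w x" "compact (closure {x. w x \<noteq> 0})" "closure {x. w x \<noteq> 0} \<subseteq> A"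
    "(\<integral>\<^sup>+x. ennreal (norm (W x) ^ DIM('a)) \<partial>lborel) < c"
proof -
  let ?n = "DIM('a)"
  obtain v where v: "v \<in> condenser_admissible A F" and vcap: "(\<integral>\<^sup>+x. ennreal (norm (grad v x) ^ ?n) \<partial>lebesgue) < c"
    using cap unfolding condenser_cap_def INF_less_iff by blast
  let ?K = "closure {x. v x \<noteq> 0}"
  have acl: "ACLp_on ?n UNIV v" and v0: "\<And>x. 0 \<le> v x" and vF: "\<And>x. x \<in> F \<Longrightarrow> 1 \<le> v x"
    and K: "compact ?K" and KA: "?K \<subseteq> A"
    using v unfolding condenser_admissible_def by auto
  have vc: "continuous_on UNIV v" using acl unfolding ACLp_on_def ACL_on_def by blast
  have vK: "v x = 0" if "x \<notin> ?K" for x using that closure_subset[of "{x. v x \<noteq> 0}"] by auto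
  have gm[measurable]: "grad v \<in> borel_measurable borel" by (rule borel_measurable_grad[OF vc])
  define E where "E = (\<integral>\<^sup>+x. ennreal (norm (grad v x) ^ ?n) \<partial>lborel)"
  have "E = (\<integral>\<^sup>+x. ennreal (norm (grad v x) ^ ?n) \<partial>lebesgue)"
    unfolding E_def by (simp add: nn_integral_completion)
  then have "E < c" using vcap by simp
  then obtain e' where e': "E < e'" "e' < c" using dense by blast
  have fin: "E < \<infinity>" "e' < \<infinity>" using e' by (auto simp: less_top[symmetric])
  obtain e1 where e1: "E = ennreal e1" "0 \<le> e1" using fin(1) by (cases E) auto
  obtain e2 where e2: "e' = ennreal e2" "0 \<le> e2" using fin(2) by (cases e') auto
  have "e1 < e2" using e'(1) e1 e2 by (simp add: ennreal_less_iff)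
  moreover have "((\<lambda>\<epsilon>. (1 - \<epsilon>) ^ ?n * e2) \<longlongrightarrow> (1 - 0) ^ ?n * e2) (at_right (0::real))"
    by (intro tendsto_intros)
  ultimately have "eventually (\<lambda>\<epsilon>. e1 < (1 - \<epsilon>) ^ ?n * e2) (at_right (0::real))"
    by (intro order_tendstoD) auto
  moreover have "eventually (\<lambda>\<epsilon>. 0 < \<epsilon> \<and> \<epsilon> < 1) (at_right (0::real))"
    unfolding eventually_at_right_field by (intro exI[of _ 1]) auto
  ultimately have "eventually (\<lambda>\<epsilon>. e1 < (1 - \<epsilon>) ^ ?n * e2 \<and> 0 < \<epsilon> \<and> \<epsilon> < 1) (at_right (0::real))"
    by eventually_elim auto
  then obtain \<epsilon> where \<epsilon>: "e1 < (1 - \<epsilon>) ^ ?n * e2" "0 < \<epsilon>" "\<epsilon> < 1"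
    using eventually_happens'[OF trivial_limit_at_right_real] by blast
  obtain r1 where r1: "0 < r1" "\<And>x y. dist x y < r1 \<Longrightarrow> \<bar>v x - v y\<bar> < \<epsilon>"
    using continuous_compact_support_uniform[OF vc K vK \<epsilon>(2)] by metis
  obtain r2 where r2: "0 < r2" "(\<Union>x\<in>?K. ball x r2) \<subseteq> A"
    by (rule compact_subset_open_imp_ball_epsilon_subset[OF K A KA])
  \<comment> \<open>\<open>r1\<close> controls the oscillation of \<open>v\<close>, \<open>r2\<close> keeps the support inside \<open>A\<close>\<close>
  define r where "r = min r1 (r2/2)"
  have r: "0 < r" "r \<le> r1" "r < r2" using r1 r2 by (auto simp: r_def)
  have osc: "\<bar>v x - v y\<bar> \<le> \<epsilon>" if "dist x y < r" for x y using r1(2)[of x y] that r by simp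
  obtain w W where w: "\<And>x. (w has_derivative (\<lambda>h. W x \<bullet> h)) (at x)" "continuous_on UNIV W"
    "\<And>x. 0 \<le> w x" "\<And>x. \<bar>w x - v x\<bar> \<le> \<epsilon>" "\<And>x. w x \<noteq> 0 \<Longrightarrow> \<exists>y. v y \<noteq> 0 \<and> dist x y < r"
    "(\<integral>\<^sup>+x. ennreal (norm (W x) ^ ?n) \<partial>lborel) \<le> E"
    using smooth_approximation[OF acl K v0 r(1) osc] unfolding E_def by blast
  define S where "S = {a + b | a b. a \<in> ?K \<and> b \<in> cball 0 r}"
  have S: "compact S" unfolding S_def by (rule compact_sums[OF K]) simp
  have SA: "S \<subseteq> A"
  proof
    fix x assume "x \<in> S"
    then obtain a b where "x = a + b" "a \<in> ?K" "norm b \<le> r" unfolding S_def by auto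
    then have "x \<in> ball a r2" "a \<in> ?K" using r(3) by (auto simp: dist_norm)
    then show "x \<in> A" using r2(2) by blast
  qed
  have "{x. w x \<noteq> 0} \<subseteq> S"
  proof
    fix x assume "x \<in> {x. w x \<noteq> 0}"
    then obtain y where y: "v y \<noteq> 0" "dist x y < r" using w(5) by blast
    have "x = y + (x - y)" "y \<in> ?K" "x - y \<in> cball 0 r"
      using y closure_subset[of "{x. v x \<noteq> 0}"] by (auto simp: dist_norm norm_minus_commute)
    then show "x \<in> S" unfolding S_def by blast
  qed
  then have cS: "closure {x. w x \<noteq> 0} \<subseteq> S" using S by (simp add: closure_minimal compact_imp_closed)
  have wsupp: "{x. w x / (1 - \<epsilon>) \<noteq> 0} = {x. w x \<noteq> 0}" using \<epsilon> by auto
  show ?thesis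
  proof (rule that[of "\<lambda>x. w x / (1 - \<epsilon>)" "\<lambda>x. inverse (1 - \<epsilon>) *\<^sub>R W x"])
    show "((\<lambda>x. w x / (1 - \<epsilon>)) has_derivative (\<lambda>h. (inverse (1 - \<epsilon>) *\<^sub>R W x) \<bullet> h)) (at x)" for x
      using has_derivative_mult_right[OF w(1), of "inverse (1 - \<epsilon>)" x] by (simp add: divide_inverse mult.commute)
    show "continuous_on UNIV (\<lambda>x. inverse (1 - \<epsilon>) *\<^sub>R W x)" by (intro continuous_intros w(2))
    show "0 \<le> w x / (1 - \<epsilon>)" for x using w(3) \<epsilon> by simp
    show "1 \<le> w x / (1 - \<epsilon>)" if "x \<in> F" for x using w(4)[of x] vF[OF that] \<epsilon> by (simp add: field_simps)
    show "compact (closure {x. w x / (1 - \<epsilon>) \<noteq> 0})"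
      unfolding wsupp using closed_Int_compact[OF closed_closure S, of "{x. w x \<noteq> 0}"] cS by (simp add: Int_absorb2)
    show "closure {x. w x / (1 - \<epsilon>) \<noteq> 0} \<subseteq> A" unfolding wsupp using cS SA by blast
    have Wm[measurable]: "W \<in> borel_measurable borel" by (rule borel_measurable_continuous_onI[OF w(2)])
    have "(\<integral>\<^sup>+x. ennreal (norm (inverse (1 - \<epsilon>) *\<^sub>R W x) ^ ?n) \<partial>lborel) =
      (\<integral>\<^sup>+x. ennreal (inverse (1 - \<epsilon>) ^ ?n) * ennreal (norm (W x) ^ ?n) \<partial>lborel)"
      using \<epsilon> by (simp add: power_mult_distrib ennreal_mult)
    also have "\<dots> = ennreal (inverse (1 - \<epsilon>) ^ ?n) * (\<integral>\<^sup>+x. ennreal (norm (W x) ^ ?n) \<partial>lborel)"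
      by (rule nn_integral_cmult) simp
    also have "\<dots> \<le> ennreal (inverse (1 - \<epsilon>) ^ ?n) * E" by (intro mult_left_mono w(6)) simp
    also have "\<dots> = ennreal (inverse (1 - \<epsilon>) ^ ?n * e1)" using \<epsilon> e1 by (simp add: ennreal_mult)
    also have "\<dots> \<le> ennreal e2" using \<epsilon> by (intro ennreal_leI) (simp add: field_simps power_inverse)
    also have "\<dots> < c" using e' e2 by simp
    finally show "(\<integral>\<^sup>+x. ennreal (norm (inverse (1 - \<epsilon>) *\<^sub>R W x) ^ ?n) \<partial>lborel) < c" .
  qed
qed

lemma abs_continuous_lipschitz:
  assumes L: "\<And>c e. a \<le> c \<Longrightarrow> c \<le> e \<Longrightarrow> e \<le> b \<Longrightarrow> \<bar>f e - f c\<bar> \<le> L * (e - c)" and "0 \<le> L"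
  shows "abs_continuous_interval a b f"
  unfolding abs_continuous_interval_def
proof (intro allI impI)
  fix \<epsilon> :: real assume "0 < \<epsilon>"
  show "\<exists>\<delta>>0. \<forall>D. D division_of \<Union> D \<and> \<Union> D \<subseteq> {a..b} \<and> (\<Sum>K\<in>D. Sup K - Inf K) < \<delta> \<longrightarrow>
        (\<Sum>K\<in>D. \<bar>f (Sup K) - f (Inf K)\<bar>) < \<epsilon>"
  proof (rule exI[of _ "\<epsilon> / (L + 1)"], intro conjI allI impI)
    fix D assume D: "D division_of \<Union> D \<and> \<Union> D \<subseteq> {a..b} \<and> (\<Sum>K\<in>D. Sup K - Inf K) < \<epsilon> / (L + 1)"
    have le: "\<bar>f (Sup K) - f (Inf K)\<bar> \<le> L * (Sup K - Inf K)" "0 \<le> Sup K - Inf K" if K: "K \<in> D" for K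
    proof -
      obtain c e where ce: "c \<le> e" "K = {c..e}" using division_member_Icc[OF conjunct1[OF D] K] .
      then have "a \<le> c" "e \<le> b" using D K by fastforce+
      then show "\<bar>f (Sup K) - f (Inf K)\<bar> \<le> L * (Sup K - Inf K)" "0 \<le> Sup K - Inf K" using L ce by auto
    qed
    have "(\<Sum>K\<in>D. \<bar>f (Sup K) - f (Inf K)\<bar>) \<le> L * (\<Sum>K\<in>D. Sup K - Inf K)"
      unfolding sum_distrib_left by (intro sum_mono le)
    also have "\<dots> \<le> (L + 1) * (\<Sum>K\<in>D. Sup K - Inf K)"
      using sum_nonneg[of D "\<lambda>K. Sup K - Inf K"] le(2) by (intro mult_right_mono) auto
    also have "\<dots> < (L + 1) * (\<epsilon> / (L + 1))"
      using D \<open>0 \<le> L\<close> by (intro mult_strict_left_mono) auto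
    also have "\<dots> = \<epsilon>" using \<open>0 \<le> L\<close> by simp
    finally show "(\<Sum>K\<in>D. \<bar>f (Sup K) - f (Inf K)\<bar>) < \<epsilon>" .
  qed (use \<open>0 < \<epsilon>\<close> \<open>0 \<le> L\<close> in auto)
qed

lemma lipschitz_of_bounded_derivative_except_finite:
  fixes f f' :: "real \<Rightarrow> real"
  assumes "finite S" and fc: "continuous_on UNIV f"
    and f': "\<And>t. t \<notin> S \<Longrightarrow> (f has_real_derivative f' t) (at t)" and B: "\<And>t. t \<notin> S \<Longrightarrow> \<bar>f' t\<bar> \<le> B" and "c \<le> e" "0 \<le> B"
  shows "\<bar>f e - f c\<bar> \<le> B * (e - c)"
proof -
  define f0 where "f0 = (\<lambda>t. if t \<in> S then 0 else f' t)"
  have "(f0 has_integral (f e - f c)) {c..e}"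
  proof (rule fundamental_theorem_of_calculus_interior_strong[OF \<open>finite S\<close> \<open>c \<le> e\<close>])
    show "(f has_vector_derivative f0 t) (at t)" if "t \<in> {c<..<e} - S" for t
      using f'[of t] that by (simp add: f0_def has_real_derivative_iff_has_vector_derivative)
    show "continuous_on {c..e} f" using fc continuous_on_subset by blast
  qed
  then have "norm (f e - f c) \<le> B * measure lborel {c..e}"
    by (rule has_integral_bound_real[OF \<open>0 \<le> B\<close>, rotated]) (use B \<open>0 \<le> B\<close> in \<open>auto simp: f0_def\<close>)
  then show ?thesis using \<open>c \<le> e\<close> by simp
qed

text \<open>Along each line parallel to an axis the function is Lipschitz, hence absolutely continuous, because its
  derivative is bounded and exists at all but finitely many points.\<close>

lemma piecewise_C1_admissible:
  fixes u :: "'a::euclidean_space \<Rightarrow> real"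
  assumes uc: "continuous_on UNIV u" and N: "closed N" "negligible N"
    and lines: "\<And>i y. i \<in> Basis \<Longrightarrow> finite {t. line_point i y t \<in> N}"
    and der: "\<And>x. x \<notin> N \<Longrightarrow> (u has_derivative (\<lambda>h. U x \<bullet> h)) (at x)"
    and B: "\<And>x. x \<notin> N \<Longrightarrow> norm (U x) \<le> B"
    and K: "compact (closure {x. u x \<noteq> 0})" "closure {x. u x \<noteq> 0} \<subseteq> A"
    and u0: "\<And>x. 0 \<le> u x" and uF: "\<And>x. x \<in> F \<Longrightarrow> 1 \<le> u x"
  shows "u \<in> condenser_admissible A F"
    and "condenser_cap A F \<le> (\<integral>\<^sup>+x\<in>-N. ennreal (norm (U x) ^ DIM('a)) \<partial>lebesgue)"
proof -
  let ?n = "DIM('a)"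
  have B0: "0 \<le> B"
  proof -
    have "N \<noteq> UNIV" using N(2) non_negligible_UNIV by auto
    then obtain x where "x \<notin> N" by auto
    then show ?thesis using B norm_ge_zero order_trans by blast
  qed
  have pd: "partial_deriv i u x = U x \<bullet> i" if "x \<notin> N" for i x
  proof -
    have "((\<lambda>t. x + t *\<^sub>R i) has_derivative (\<lambda>t. t *\<^sub>R i)) (at (0::real))" by (auto intro!: derivative_eq_intros)
    from diff_chain_at[OF this, of u "\<lambda>h. U x \<bullet> h"] der[OF that]
    have "((\<lambda>t. u (x + t *\<^sub>R i)) has_real_derivative U x \<bullet> i) (at 0)"
      by (simp add: o_def has_field_derivative_def mult_commute_abs)
    then show ?thesis unfolding partial_deriv_def by (rule DERIV_imp_deriv)
  qed
  have AEN: "AE x in lebesgue. x \<notin> N"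
    using N(2) by (intro AE_not_in) (simp add: negligible_iff_null_sets)
  have line_AC: "abs_continuous_interval a b (\<lambda>t. u (line_point i y t))" if i: "i \<in> Basis" for a b i y
  proof (rule abs_continuous_lipschitz[OF _ B0])
    fix c e :: real assume "c \<le> e"
    show "\<bar>u (line_point i y e) - u (line_point i y c)\<bar> \<le> B * (e - c)"
    proof (rule lipschitz_of_bounded_derivative_except_finite[OF lines[OF i, of y] _ _ _ \<open>c \<le> e\<close> B0])
      have "continuous_on UNIV (line_point i y)"
        using line_point_has_derivative by (meson continuous_at_imp_continuous_on has_derivative_continuous)
      then show "continuous_on UNIV (\<lambda>t. u (line_point i y t))" by (rule continuous_on_compose2[OF uc]) simp
      fix t assume t: "t \<notin> {t. line_point i y t \<in> N}"
      show "((\<lambda>t. u (line_point i y t)) has_real_derivative U (line_point i y t) \<bullet> i) (at t)"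
        using diff_chain_at[OF line_point_has_derivative der, of i y t] t
        by (simp add: o_def has_field_derivative_def mult_commute_abs)
      have "\<bar>U (line_point i y t) \<bullet> i\<bar> \<le> norm (U (line_point i y t))" using i by (rule Basis_le_norm)
      then show "\<bar>U (line_point i y t) \<bullet> i\<bar> \<le> B" using B[of "line_point i y t"] t by simp
    qed
  qed
  have pdm[measurable]: "partial_deriv i u \<in> borel_measurable borel" for i by (rule borel_measurable_partial_deriv[OF uc])
  have "set_integrable lebesgue C (\<lambda>x. \<bar>partial_deriv i u x\<bar> ^ ?n)" if C: "compact C" and i: "i \<in> Basis" for C i
    unfolding set_integrable_def
  proof (rule Bochner_Integration.integrable_bound)
    have Cm: "C \<in> sets borel" using C by (simp add: compact_imp_closed borel_closed)
    have I: "integrable lborel (\<lambda>x. indicator C x *\<^sub>R B ^ ?n)" by (rule borel_integrable_compact[OF C]) auto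
    then show "integrable lebesgue (\<lambda>x. indicator C x *\<^sub>R B ^ ?n)"
      unfolding integrable_completion[OF borel_measurable_integrable[OF I]] .
    have "(\<lambda>x. indicator C x *\<^sub>R \<bar>partial_deriv i u x\<bar> ^ ?n) \<in> borel_measurable lborel"
      using Cm by measurable
    then show "(\<lambda>x. indicator C x *\<^sub>R \<bar>partial_deriv i u x\<bar> ^ ?n) \<in> borel_measurable lebesgue"
      by (rule measurable_completion)
    show "AE x in lebesgue. norm (indicator C x *\<^sub>R \<bar>partial_deriv i u x\<bar> ^ ?n) \<le> norm (indicator C x *\<^sub>R B ^ ?n)"
      using AEN
    proof eventually_elim
      case (elim x)
      have "\<bar>partial_deriv i u x\<bar> \<le> B" using pd[OF elim, of i] B[OF elim] Basis_le_norm[OF i, of "U x"] by simp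
      then have "\<bar>partial_deriv i u x\<bar> ^ ?n \<le> B ^ ?n" by (intro power_mono) auto
      then show ?case using B0 by (auto simp: indicator_def)
    qed
  qed
  then have "ACLp_on ?n UNIV u"
    unfolding ACLp_on_def ACL_on_def using uc line_AC by (auto intro!: AE_I2)
  then show adm: "u \<in> condenser_admissible A F"
    unfolding condenser_admissible_def using K u0 uF by auto
  have grad_eq: "grad u x = U x" if "x \<notin> N" for x
    by (rule euclidean_eqI) (simp add: grad_inner_Basis pd[OF that])
  have "condenser_cap A F \<le> (\<integral>\<^sup>+x. ennreal (norm (grad u x) ^ ?n) \<partial>lebesgue)"
    unfolding condenser_cap_def using adm by (rule INF_lower)
  also have "\<dots> = (\<integral>\<^sup>+x\<in>-N. ennreal (norm (U x) ^ ?n) \<partial>lebesgue)"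
    by (rule nn_integral_cong_AE) (use AEN in \<open>eventually_elim, simp add: grad_eq\<close>)
  finally show "condenser_cap A F \<le> (\<integral>\<^sup>+x\<in>-N. ennreal (norm (U x) ^ ?n) \<partial>lebesgue)" .
qed

section \<open>Change of variables in Euclidean spaces\<close>

text \<open>Jacobian determinants are defined for maps of \<open>real ^ 'n\<close>. An index type whose elements are the basis
  vectors identifies an arbitrary Euclidean space isometrically with such a space.\<close>

typedef (overloaded) 'a basis_index = "Basis :: 'a::euclidean_space set"
  by (metis nonempty_Basis ex_in_conv)

instance basis_index :: (euclidean_space) finite
proof
  have "(UNIV :: 'a basis_index set) = Abs_basis_index ` Basis"
    using Abs_basis_index_cases by auto
  then show "finite (UNIV :: 'a basis_index set)" by (metis finite_Basis finite_imageI)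
qed

instantiation basis_index :: (euclidean_space) wellorder
begin

definition basis_index_rank :: "'a basis_index \<Rightarrow> nat" where
  "basis_index_rank = (SOME f. inj f)"

definition less_eq_basis_index :: "'a basis_index \<Rightarrow> 'a basis_index \<Rightarrow> bool" where
  "less_eq_basis_index x y \<longleftrightarrow> basis_index_rank x \<le> basis_index_rank y"

definition less_basis_index :: "'a basis_index \<Rightarrow> 'a basis_index \<Rightarrow> bool" where
  "less_basis_index x y \<longleftrightarrow> basis_index_rank x < basis_index_rank y"

instance
proof
  have "\<exists>f :: 'a basis_index \<Rightarrow> nat. inj f"
    using finite_imp_inj_to_nat_seg[of "UNIV :: 'a basis_index set"] by auto
  then have inj: "inj (basis_index_rank :: 'a basis_index \<Rightarrow> nat)"
    unfolding basis_index_rank_def by (rule someI_ex)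
  fix x y z :: "'a basis_index" and P
  show "x < y \<longleftrightarrow> x \<le> y \<and> \<not> y \<le> x" "x \<le> x" "x \<le> y \<Longrightarrow> y \<le> z \<Longrightarrow> x \<le> z" "x \<le> y \<or> y \<le> x"
    by (auto simp: less_basis_index_def less_eq_basis_index_def)
  show "x \<le> y \<Longrightarrow> y \<le> x \<Longrightarrow> x = y"
    using inj by (auto simp: less_eq_basis_index_def dest: injD)
  show "P x" if "\<And>x. (\<And>y. y < x \<Longrightarrow> P y) \<Longrightarrow> P x"
    using that unfolding less_basis_index_def by (rule measure_induct_rule[where f = basis_index_rank]) blast
qed

end

definition to_cart :: "'a::euclidean_space \<Rightarrow> real ^ 'a basis_index" where
  "to_cart x = (\<chi> k. x \<bullet> Rep_basis_index k)"

definition of_cart :: "real ^ 'a basis_index \<Rightarrow> 'a::euclidean_space" where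
  "of_cart v = (\<Sum>b\<in>Basis. (v $ Abs_basis_index b) *\<^sub>R b)"

lemma bij_Abs_basis_index: "bij_betw Abs_basis_index (Basis :: 'a::euclidean_space set) UNIV"
  by (rule bij_betw_byWitness[of _ Rep_basis_index])
     (auto simp: Abs_basis_index_inverse Rep_basis_index_inverse Rep_basis_index)

lemma of_cart_inner: "b \<in> Basis \<Longrightarrow> of_cart v \<bullet> b = v $ Abs_basis_index b"
  unfolding of_cart_def by (simp add: inner_sum_left_Basis)

lemma of_cart_to_cart [simp]: "of_cart (to_cart x) = x"
  by (rule euclidean_eqI) (simp add: of_cart_inner to_cart_def Abs_basis_index_inverse)

lemma to_cart_of_cart [simp]: "to_cart (of_cart v) = v"
  by (simp add: vec_eq_iff to_cart_def of_cart_inner Rep_basis_index Rep_basis_index_inverse)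

lemma inner_to_cart [simp]: "to_cart x \<bullet> to_cart y = x \<bullet> y"
proof -
  have "to_cart x \<bullet> to_cart y = (\<Sum>k\<in>UNIV. (x \<bullet> Rep_basis_index k) * (y \<bullet> Rep_basis_index k))"
    by (simp add: inner_vec_def to_cart_def)
  also have "\<dots> = (\<Sum>b\<in>Basis. (x \<bullet> b) * (y \<bullet> b))"
    by (subst sum.reindex_bij_betw[OF bij_Abs_basis_index, symmetric])
       (auto intro!: sum.cong simp: Abs_basis_index_inverse)
  also have "\<dots> = x \<bullet> y" by (rule euclidean_inner[symmetric])
  finally show ?thesis .
qed

lemma linear_to_cart: "linear to_cart"
  by (auto intro!: linearI simp: to_cart_def vec_eq_iff inner_add_left)

lemma linear_of_cart: "linear of_cart"
  by (auto intro!: linearI simp: of_cart_def scaleR_left_distrib sum.distrib scaleR_sum_right)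

lemma card_basis_index: "CARD('a::euclidean_space basis_index) = DIM('a)"
  by (rule bij_betw_same_card[OF bij_Abs_basis_index, symmetric])

lemma bounded_linear_to_cart: "bounded_linear to_cart"
  using linear_to_cart by (simp add: linear_conv_bounded_linear)

lemma bounded_linear_of_cart: "bounded_linear of_cart"
  using linear_of_cart by (simp add: linear_conv_bounded_linear)

lemma continuous_to_cart: "continuous_on S to_cart"
  by (rule linear_continuous_on[OF bounded_linear_to_cart])

lemma continuous_of_cart: "continuous_on S of_cart"
  by (rule linear_continuous_on[OF bounded_linear_of_cart])

lemma distr_lborel_to_cart: "distr lborel borel to_cart = (lborel :: (real ^ 'a::euclidean_space basis_index) measure)"
proof (rule lborel_eqI[symmetric])
  have m: "to_cart \<in> borel_measurable (borel :: 'a measure)"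
    by (rule borel_measurable_continuous_onI[OF continuous_to_cart])
  fix l u :: "real ^ 'a basis_index"
  assume lu: "\<And>b. b \<in> Basis \<Longrightarrow> l \<bullet> b \<le> u \<bullet> b"
  have comp: "l $ k \<le> u $ k" for k using lu[of "axis k 1"] by (simp add: inner_axis)
  have vim: "to_cart -` box l u = box (of_cart l) (of_cart u :: 'a)"
  proof -
    have "to_cart x \<in> box l u \<longleftrightarrow> x \<in> box (of_cart l) (of_cart u)" for x :: 'a
    proof -
      have "x \<in> box (of_cart l) (of_cart u) \<longleftrightarrow> (\<forall>b\<in>Basis. l $ Abs_basis_index b < x \<bullet> b \<and> x \<bullet> b < u $ Abs_basis_index b)"
        by (simp add: mem_box of_cart_inner)
      also have "\<dots> \<longleftrightarrow> (\<forall>k. l $ k < x \<bullet> Rep_basis_index k \<and> x \<bullet> Rep_basis_index k < u $ k)"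
        by (metis Abs_basis_index_inverse Rep_basis_index Rep_basis_index_inverse)
      finally show ?thesis by (simp add: mem_box_cart to_cart_def)
    qed
    then show ?thesis by blast
  qed
  have "emeasure (distr lborel borel to_cart) (box l u) = emeasure lborel (box (of_cart l) (of_cart u :: 'a))"
    by (subst emeasure_distr) (use m vim in auto)
  also have "\<dots> = ennreal (\<Prod>b\<in>Basis. (of_cart u - of_cart l :: 'a) \<bullet> b)"
    by (rule emeasure_lborel_box) (simp add: of_cart_inner comp)
  also have "(\<Prod>b\<in>Basis. (of_cart u - of_cart l :: 'a) \<bullet> b) = (\<Prod>b\<in>Basis. (u - l) $ Abs_basis_index (b::'a))"
    by (intro prod.cong) (auto simp: inner_diff_left of_cart_inner)
  also have "\<dots> = (\<Prod>k\<in>UNIV. (u - l) $ k)"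
    by (rule prod.reindex_bij_betw[OF bij_Abs_basis_index])
  also have "\<dots> = (\<Prod>b\<in>Basis. (u - l) \<bullet> b)"
  proof -
    have "bij_betw (\<lambda>k. axis k (1::real)) UNIV (Basis :: (real ^ 'a basis_index) set)"
      unfolding bij_betw_def by (auto simp: inj_on_def axis_eq_axis Basis_vec_def)
    from prod.reindex_bij_betw[OF this, of "\<lambda>b. (u - l) \<bullet> b"] show ?thesis by (simp add: inner_axis)
  qed
  finally show "emeasure (distr lborel borel to_cart) (box l u) = (\<Prod>b\<in>Basis. (u - l) \<bullet> b)" .
qed simp

lemma to_cart_lebesgue:
  shows "to_cart \<in> measurable (lebesgue :: 'a::euclidean_space measure) lebesgue"
    and "distr lebesgue lebesgue to_cart = (lebesgue :: (real ^ 'a basis_index) measure)"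
proof -
  have m: "to_cart \<in> measurable (lborel :: 'a measure) lborel"
    using borel_measurable_continuous_onI[OF continuous_to_cart[of UNIV]] by simp
  have "distr lborel lborel to_cart = (lborel :: (real ^ 'a basis_index) measure)"
    using distr_lborel_to_cart by (metis distr_cong sets_lborel)
  then have d: "distr lebesgue lborel to_cart = (lborel :: (real ^ 'a basis_index) measure)"
    by (simp add: distr_completion[OF m])
  note m' = measurable_completion[OF m]
  show "distr lebesgue lebesgue to_cart = (lebesgue :: (real ^ 'a basis_index) measure)"
    using completion.completion_distr_eq[OF m'] d by simp
  show "to_cart \<in> measurable (lebesgue :: 'a measure) lebesgue"
    by (rule completion.measurable_completion2[OF m']) (simp add: d)
qed

text \<open>In coordinates in which \<open>q\<close> is a multiple of a basis vector, the matrix differs from the identity in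
  one column only.\<close>

lemma det_identity_plus_rank_one:
  fixes p q :: "real ^ 'n::finite"
  shows "det (matrix (\<lambda>h. c *\<^sub>R (h + (q \<bullet> h) *\<^sub>R p))) = c ^ CARD('n) * (1 + q \<bullet> p)"
proof -
  obtain k :: 'n where True by blast
  obtain R :: "real ^ 'n \<Rightarrow> real ^ 'n" where R: "orthogonal_transformation R" "R q = norm q *\<^sub>R axis k 1"
    using orthogonal_transformation_exists[of q "norm q *\<^sub>R axis k (1::real)"] by auto
  define L where "L = (\<lambda>h. h + (q \<bullet> h) *\<^sub>R p)"
  define L' where "L' = (\<lambda>h. h + (norm q * (h $ k)) *\<^sub>R R p)"
  have lin: "linear L" "linear L'" "linear R"
    using R(1) by (auto intro!: linearI simp: L_def L'_def algebra_simps inner_add_right orthogonal_transformation_linear)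
  have conj: "R (L h) = L' (R h)" for h
  proof -
    have "q \<bullet> h = R q \<bullet> R h" using R(1) by (simp add: orthogonal_transformation_def)
    also have "\<dots> = norm q * (R h $ k)" unfolding R(2) by (simp add: inner_axis')
    finally show ?thesis
      by (simp add: L_def L'_def linear_add[OF lin(3)] linear_scale[OF lin(3)])
  qed
  then have "R \<circ> L = L' \<circ> R" by (simp add: fun_eq_iff)
  then have "matrix R ** matrix L = matrix L' ** matrix R"
    using matrix_compose[OF lin(1) lin(3)] matrix_compose[OF lin(3) lin(2)] by simp
  then have "det (matrix R) * det (matrix L) = det (matrix L') * det (matrix R)"
    by (metis det_mul)
  moreover have "det (matrix R) \<noteq> 0"
  proof -
    have "transpose (matrix R) ** matrix R = mat 1"
      using R(1) unfolding orthogonal_transformation_matrix orthogonal_matrix_def by blast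
    then have "det (matrix R) * det (matrix R) = 1" by (metis det_mul det_transpose det_I)
    then show ?thesis by auto
  qed
  ultimately have "det (matrix L) = det (matrix L')" by simp
  also have "matrix L' = (\<chi> i j. if j = k then (mat 1 *v (axis k 1 + norm q *\<^sub>R R p)) $ i else mat 1 $ i $ j)"
    unfolding matrix_vector_mul_lid by (auto simp: vec_eq_iff matrix_def L'_def axis_def mat_def)
  also have "det \<dots> = (axis k 1 + norm q *\<^sub>R R p) $ k * det (mat 1 :: real^'n^'n)"
    by (rule cramer_lemma)
  also have "\<dots> = 1 + R q \<bullet> R p" unfolding R(2) by (simp add: inner_axis')
  also have "\<dots> = 1 + q \<bullet> p" using R(1) by (simp add: orthogonal_transformation_def)
  finally have detL: "det (matrix L) = 1 + q \<bullet> p" .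
  have "matrix (\<lambda>h. c *\<^sub>R L h) = matrix ((*\<^sub>R) c) ** matrix L"
    using matrix_compose[OF lin(1), of "(*\<^sub>R) c"] by (simp add: o_def)
  then show ?thesis using detL by (simp add: L_def[abs_def] det_mul det_matrix_scaleR)
qed

text \<open>All maps used below have derivatives of this form: the power map with shifted spheres, and the inversion.
  The integral on the left equals the integral of \<open>F\<close> over the image of \<open>S\<close>, hence the inequality.\<close>

lemma nn_integral_substitution_le:
  fixes T :: "'a::euclidean_space \<Rightarrow> 'a" and F :: "'a \<Rightarrow> real"
  assumes S: "open S" and inj: "inj_on T S"
    and der: "\<And>x. x \<in> S \<Longrightarrow> (T has_derivative (\<lambda>h. c x *\<^sub>R (h + (q x \<bullet> h) *\<^sub>R p x))) (at x)"
    and F: "continuous_on UNIV F" "\<And>x. 0 \<le> F x" "compact K" "\<And>x. x \<notin> K \<Longrightarrow> F x = 0"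
  shows "(\<integral>\<^sup>+x\<in>S. ennreal (\<bar>c x ^ DIM('a) * (1 + q x \<bullet> p x)\<bar> * F (T x)) \<partial>lebesgue) \<le> (\<integral>\<^sup>+x. ennreal (F x) \<partial>lebesgue)"
proof -
  define g where "g = (\<lambda>v. to_cart (T (of_cart v)) :: real ^ 'a basis_index)"
  define g' where "g' = (\<lambda>v h. c (of_cart v) *\<^sub>R (h + (to_cart (q (of_cart v)) \<bullet> h) *\<^sub>R to_cart (p (of_cart v)) :: real ^ 'a basis_index))"
  define \<phi> where "\<phi> = (\<lambda>v. F (of_cart v))"
  define S' where "S' = (of_cart -` S :: (real ^ 'a basis_index) set)"
  define J where "J = (\<lambda>x. \<bar>c x ^ DIM('a) * (1 + q x \<bullet> p x)\<bar>)"
  have S'_open: "open S'" unfolding S'_def by (rule open_vimage[OF S continuous_of_cart])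
  have S'_leb: "S' \<in> sets lebesgue" using S'_open by (simp add: borel_open)
  have ip: "to_cart y \<bullet> h = y \<bullet> of_cart h" for y :: 'a and h
    using inner_to_cart[of y "of_cart h"] by simp
  have der_g: "(g has_derivative g' v) (at v within S')" if "v \<in> S'" for v
  proof -
    have d1: "(of_cart has_derivative of_cart) (at v)" by (rule bounded_linear_imp_has_derivative[OF bounded_linear_of_cart])
    have d2: "(to_cart has_derivative to_cart) (at (T (of_cart v)))" by (rule bounded_linear_imp_has_derivative[OF bounded_linear_to_cart])
    have "of_cart v \<in> S" using that unfolding S'_def by simp
    from diff_chain_at[OF diff_chain_at[OF d1 der[OF this]], unfolded o_def, OF d2]
    have "(g has_derivative (\<lambda>h. to_cart (c (of_cart v) *\<^sub>R (of_cart h + (q (of_cart v) \<bullet> of_cart h) *\<^sub>R p (of_cart v))))) (at v)"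
      unfolding g_def .
    moreover have "(\<lambda>h. to_cart (c (of_cart v) *\<^sub>R (of_cart h + (q (of_cart v) \<bullet> of_cart h) *\<^sub>R p (of_cart v)))) = g' v"
      unfolding g'_def by (simp add: fun_eq_iff linear_scale[OF linear_to_cart] linear_add[OF linear_to_cart] ip)
    ultimately show ?thesis by (simp add: has_derivative_at_withinI)
  qed
  have inj_g: "inj_on g S'"
  proof (rule inj_onI)
    fix v w assume vw: "v \<in> S'" "w \<in> S'" "g v = g w"
    then have "T (of_cart v) = T (of_cart w)" unfolding g_def by (metis of_cart_to_cart)
    then have "of_cart v = of_cart w" using inj vw(1,2) unfolding S'_def by (auto dest: inj_onD)
    then show "v = w" by (metis to_cart_of_cart)
  qed
  have det: "\<bar>det (matrix (g' v))\<bar> = J (of_cart v)" for v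
    unfolding g'_def det_identity_plus_rank_one J_def by (simp add: card_basis_index)
  have \<phi>_cont: "continuous_on UNIV \<phi>"
    unfolding \<phi>_def by (rule continuous_on_compose2[OF F(1) continuous_of_cart]) simp
  have cK: "compact (to_cart ` K)" by (rule compact_continuous_image[OF continuous_to_cart F(3)])
  have \<phi>_int: "integrable lborel \<phi>"
  proof -
    have "integrable lborel (\<lambda>x. indicator (to_cart ` K) x *\<^sub>R \<phi> x)"
      by (rule borel_integrable_compact[OF cK continuous_on_subset[OF \<phi>_cont]]) auto
    also have "(\<lambda>x. indicator (to_cart ` K) x *\<^sub>R \<phi> x) = \<phi>"
    proof
      fix x
      have "\<phi> x = 0" if "x \<notin> to_cart ` K"
        unfolding \<phi>_def using F(4)[of "of_cart x"] that by (metis imageI to_cart_of_cart)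
      then show "indicator (to_cart ` K) x *\<^sub>R \<phi> x = \<phi> x" by (cases "x \<in> to_cart ` K") auto
    qed
    finally show ?thesis .
  qed
  have \<phi>_abs: "\<phi> absolutely_integrable_on UNIV"
    unfolding set_integrable_def using \<phi>_int by (simp add: integrable_completion)
  have gS: "g ` S' \<in> sets lebesgue"
    by (rule differentiable_image_in_sets_lebesgue[OF S'_leb]) (use der_g in \<open>auto simp: differentiable_on_def differentiable_def\<close>)
  have \<phi>_gS: "\<phi> absolutely_integrable_on g ` S'"
    by (rule set_integrable_subset[OF \<phi>_abs gS]) simp
  define I where "I = integral (g ` S') \<phi>"
  have cov: "(\<lambda>v. \<bar>det (matrix (g' v))\<bar> * \<phi> (g v)) absolutely_integrable_on S' \<and>
     integral S' (\<lambda>v. \<bar>det (matrix (g' v))\<bar> * \<phi> (g v)) = I"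
    using has_absolute_integral_change_of_variables[OF S'_leb der_g inj_g, of "\<lambda>x. vec (\<phi> x) :: real^1" "vec I"] \<phi>_gS
    unfolding absolutely_integrable_on_1_iff integral_on_1_eq
    by (simp add: I_def vec_eq_iff)
  then have int: "integrable lebesgue (\<lambda>v. indicator S' v *\<^sub>R (J (of_cart v) * \<phi> (g v)))"
    unfolding set_integrable_def det by blast
  have nonneg: "0 \<le> J x * F y" for x y unfolding J_def using F(2) by simp
  have "(\<integral>\<^sup>+x\<in>S. ennreal (J x * F (T x)) \<partial>lebesgue) = (\<integral>\<^sup>+x. ennreal (indicator S' (to_cart x) *\<^sub>R (J (of_cart (to_cart x)) * \<phi> (g (to_cart x)))) \<partial>lebesgue)"
    by (intro nn_integral_cong) (auto simp: S'_def \<phi>_def g_def indicator_def)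
  also have "\<dots> = (\<integral>\<^sup>+v. ennreal (indicator S' v *\<^sub>R (J (of_cart v) * \<phi> (g v))) \<partial>(distr lebesgue lebesgue to_cart))"
    by (rule nn_integral_distr[OF to_cart_lebesgue(1), symmetric])
       (use int in \<open>auto dest: borel_measurable_integrable simp: to_cart_lebesgue(2)\<close>)
  also have "\<dots> = (\<integral>\<^sup>+v. ennreal (indicator S' v *\<^sub>R (J (of_cart v) * \<phi> (g v))) \<partial>lebesgue)"
    by (simp add: to_cart_lebesgue(2))
  also have "\<dots> = ennreal (\<integral>v. indicator S' v *\<^sub>R (J (of_cart v) * \<phi> (g v)) \<partial>lebesgue)"
    using int nonneg unfolding \<phi>_def by (intro nn_integral_eq_integral) auto
  also have "(\<integral>v. indicator S' v *\<^sub>R (J (of_cart v) * \<phi> (g v)) \<partial>lebesgue) = I"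
    using cov set_lebesgue_integral_eq_integral(2)[of S' "\<lambda>v. \<bar>det (matrix (g' v))\<bar> * \<phi> (g v)"]
    unfolding set_lebesgue_integral_def det by simp
  also have "I \<le> integral UNIV \<phi>"
    unfolding I_def using \<phi>_gS \<phi>_abs F(2)
    by (intro integral_subset_le) (auto simp: absolutely_integrable_on_def \<phi>_def)
  also have "integral UNIV \<phi> = integral\<^sup>L lborel \<phi>"
    using has_integral_integral_lborel[OF \<phi>_int] by (rule integral_unique)
  also have "ennreal (integral\<^sup>L lborel \<phi>) = (\<integral>\<^sup>+v. ennreal (\<phi> v) \<partial>lborel)"
    using \<phi>_int F(2) unfolding \<phi>_def by (intro nn_integral_eq_integral[symmetric]) auto
  also have "\<dots> = (\<integral>\<^sup>+x. ennreal (\<phi> (to_cart x)) \<partial>lborel)"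
  proof -
    have "(\<integral>\<^sup>+v. ennreal (\<phi> v) \<partial>lborel) = (\<integral>\<^sup>+v. ennreal (\<phi> v) \<partial>(distr lborel borel to_cart))"
      by (simp add: distr_lborel_to_cart)
    also have "\<dots> = (\<integral>\<^sup>+x. ennreal (\<phi> (to_cart x)) \<partial>lborel)"
      by (rule nn_integral_distr)
         (use borel_measurable_continuous_onI[OF continuous_to_cart[of UNIV]] borel_measurable_continuous_onI[OF \<phi>_cont] in auto)
    finally show ?thesis .
  qed
  also have "\<dots> = (\<integral>\<^sup>+x. ennreal (F x) \<partial>lebesgue)"
    by (simp add: \<phi>_def nn_integral_completion)
  finally show ?thesis unfolding J_def by (simp add: ennreal_leI)
qed

section \<open>An inequality between logarithms\<close>

lemma ln_inverse_le:
  fixes x :: real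
  assumes "0 < x" "x \<le> 1"
  shows "x * ln (1 / x) \<le> (1 - x\<^sup>2) / 2"
proof -
  define h where "h = (\<lambda>y::real. (1 - y\<^sup>2) / 2 + y * ln y)"
  have "h 1 \<le> h x"
  proof (rule DERIV_nonpos_imp_nonincreasing[OF assms(2)])
    fix y assume y: "x \<le> y" "y \<le> 1"
    then have "y > 0" using assms by simp
    then have "(h has_real_derivative (ln y + 1 - y)) (at y)"
      unfolding h_def by (auto intro!: derivative_eq_intros simp: field_simps power2_eq_square)
    moreover have "ln y + 1 - y \<le> 0" using ln_le_minus_one[OF \<open>y > 0\<close>] by simp
    ultimately show "\<exists>d. (h has_real_derivative d) (at y) \<and> d \<le> 0" by blast
  qed
  then have "0 \<le> (1 - x\<^sup>2) / 2 + x * ln x" by (simp add: h_def)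
  moreover have "x * ln (1 / x) = - (x * ln x)" using assms by (simp add: ln_div)
  ultimately show ?thesis by linarith
qed

text \<open>This is the monotonicity of the quotient \<open>log (1 / x) / (1 - x)\<close>, with denominators cleared.\<close>

lemma ln_inverse_over_one_minus_antimono:
  fixes r b :: real
  assumes "0 < r" "r \<le> b" "b < 1"
  shows "ln (1 / b) * (1 - r) \<le> (1 - b) * ln (1 / r)"
proof -
  define h where "h = (\<lambda>x::real. - ln x / (1 - x))"
  have "h b \<le> h r"
  proof (rule DERIV_nonpos_imp_nonincreasing[OF assms(2)])
    fix y assume y: "r \<le> y" "y \<le> b"
    then have y01: "0 < y" "y < 1" using assms by auto
    have "(h has_real_derivative (- (1 / y) * (1 - y) - - ln y * (0 - 1)) / ((1 - y) * (1 - y))) (at y)"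
      unfolding h_def using y01 by (auto intro!: derivative_eq_intros simp: divide_simps)
    moreover have "(- (1 / y) * (1 - y) - - ln y * (0 - 1)) / ((1 - y) * (1 - y)) \<le> 0"
    proof (rule divide_nonpos_nonneg)
      have "ln (1 / y) \<le> 1 / y - 1" using y01 by (intro ln_le_minus_one) auto
      then show "- (1 / y) * (1 - y) - - ln y * (0 - 1) \<le> 0" using y01 by (simp add: ln_div field_simps)
    qed simp
    ultimately show "\<exists>d. (h has_real_derivative d) (at y) \<and> d \<le> 0" by blast
  qed
  then show ?thesis using assms by (simp add: h_def ln_div field_simps)
qed

text \<open>This gives the sign of the derivative in the next lemma. With \<open>d = 1 - \<alpha>\<close> and \<open>b = t (1 + \<alpha>)\<close>, so that \<open>\<beta> = \<alpha> + b\<close> and \<open>b < d\<close>, the two logarithmic bounds above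
  reduce the claim to \<open>(d - b)\<^sup>2 / 2 + 2 b (1 - d) \<ge> 0\<close>.\<close>

lemma deformation_derivative_bound:
  fixes \<alpha> t :: real
  assumes \<alpha>: "0 < \<alpha>" "\<alpha> < 1" and t: "0 \<le> t" "(1 + t) * \<alpha> + t < 1"
  defines "r \<equiv> \<alpha> * (1 - t)" and "\<beta> \<equiv> (1 + t) * \<alpha> + t"
  shows "\<beta> * ln (1 / \<beta>) * ((1 - \<alpha>) / ((1 - r) * (1 - r + t)) + 1 / ((1 - t) * ln (1 / r))) \<le> 1 + \<alpha>"
proof -
  have t1: "t < 1" using t \<alpha> by (smt (verit) mult_pos_pos)
  have "0 < r" "r \<le> \<alpha>" using \<alpha> t t1 by (auto simp: r_def mult_le_cancel_left1)
  then have r: "0 < r" "r \<le> \<alpha>" "r < 1" using \<alpha> by auto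
  have \<beta>: "\<alpha> \<le> \<beta>" "\<beta> < 1" using \<alpha> t by (auto simp: \<beta>_def algebra_simps)
  have \<beta>0: "0 < \<beta>" using \<alpha> \<beta> by simp
  define X where "X = ln (1 / r)"
  define Y where "Y = ln (1 / \<beta>)"
  have X: "X > 0" using r by (simp add: X_def ln_div)
  define d b where "d = 1 - \<alpha>" and "b = t * (1 + \<alpha>)"
  have db: "0 < d" "0 \<le> b" "b < d" "d < 1" "\<alpha> = 1 - d" using \<alpha> t by (auto simp: d_def b_def algebra_simps)
  have \<beta>b: "\<beta> = \<alpha> + b" "1 - \<beta> = d - b" by (auto simp: \<beta>_def b_def d_def algebra_simps)
  have rb: "1 - r + t = d + b" "1 - r = d + \<alpha> * t" by (auto simp: r_def b_def d_def algebra_simps)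
  have tb: "t = b / (1 + \<alpha>)" "1 - t = (1 + \<alpha> - b) / (1 + \<alpha>)" using \<alpha> by (auto simp: b_def field_simps)
  have r1: "1 - r > 0" using r by simp
  have e1: "\<beta> * Y \<le> (d - b) * (1 + \<beta>) / 2"
    using ln_inverse_le[of \<beta>] \<beta> \<beta>0 unfolding Y_def \<beta>b(2)[symmetric] by (simp add: power2_eq_square algebra_simps)
  have e2: "Y * (1 - r) \<le> (d - b) * X"
    using ln_inverse_over_one_minus_antimono[of r \<beta>] r \<beta> unfolding X_def Y_def \<beta>b(2)[symmetric] by simp
  have A: "\<beta> * Y * ((1 - \<alpha>) / ((1 - r) * (1 - r + t))) \<le> (d - b) * (1 + \<alpha> + b) / 2 / (1 - r)"
  proof -
    have "\<beta> * Y * d / (d + b) \<le> (d - b) * (1 + \<alpha> + b) / 2"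
    proof -
      have "\<beta> * Y * d \<le> (d - b) * (1 + \<beta>) / 2 * d" using e1 db by (intro mult_right_mono) auto
      also have "\<dots> \<le> (d - b) * (1 + \<alpha> + b) / 2 * (d + b)"
        unfolding \<beta>b(1) using db \<alpha> by (intro mult_mono mult_nonneg_nonneg) (auto simp: add.assoc)
      finally show ?thesis using db by (simp add: divide_le_eq)
    qed
    then have "\<beta> * Y * d / (d + b) / (1 - r) \<le> (d - b) * (1 + \<alpha> + b) / 2 / (1 - r)"
      using r1 by (intro divide_right_mono) auto
    then show ?thesis unfolding rb(1) d_def[symmetric] by (simp add: field_simps)
  qed
  have B: "\<beta> * Y * (1 / ((1 - t) * X)) \<le> d * (\<alpha> + b) / (1 - r)"
  proof -
    have *: "Y / X \<le> (d - b) / (1 - r)" using e2 X r1 by (simp add: field_simps)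
    have **: "(d - b) / (1 - t) \<le> d"
    proof -
      have "d * t \<le> (1 + \<alpha>) * t" using db \<alpha> t by (intro mult_right_mono) auto
      then have "d * t \<le> b" by (simp add: b_def mult.commute)
      then show ?thesis using t1 by (simp add: divide_le_eq algebra_simps)
    qed
    have "Y / X / (1 - t) \<le> d / (1 - r)"
    proof -
      have "Y / X / (1 - t) \<le> (d - b) / (1 - r) / (1 - t)" using * t1 by (intro divide_right_mono) auto
      also have "\<dots> = (d - b) / (1 - t) / (1 - r)" by simp
      also have "\<dots> \<le> d / (1 - r)" using ** r1 by (intro divide_right_mono) auto
      finally show ?thesis .
    qed
    then have "\<beta> * (Y / X / (1 - t)) \<le> \<beta> * (d / (1 - r))" using \<beta>0 by (intro mult_left_mono) auto
    then show ?thesis unfolding \<beta>b(1) by (simp add: field_simps)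
  qed
  have C: "(d - b) * (1 + \<alpha> + b) / 2 + d * (\<alpha> + b) \<le> (1 + \<alpha>) * (1 - r)"
  proof -
    have eq: "(1 + \<alpha>) * (1 - r) = (1 + \<alpha>) * d + \<alpha> * b" unfolding rb(2) by (simp add: b_def algebra_simps)
    have "(1 + \<alpha>) * d + \<alpha> * b - ((d - b) * (1 + \<alpha> + b) / 2 + d * (\<alpha> + b)) = (d - b)\<^sup>2 / 2 + 2 * b * (1 - d)"
      unfolding db(5) by (simp add: power2_eq_square field_simps)
    moreover have "0 \<le> (d - b)\<^sup>2 / 2 + 2 * b * (1 - d)" using db by simp
    ultimately show ?thesis unfolding eq by linarith
  qed
  have "\<beta> * Y * ((1 - \<alpha>) / ((1 - r) * (1 - r + t)) + 1 / ((1 - t) * X)) \<le> ((d - b) * (1 + \<alpha> + b) / 2 + d * (\<alpha> + b)) / (1 - r)"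
    using A B by (simp add: distrib_left add_divide_distrib)
  also have "\<dots> \<le> 1 + \<alpha>" using C r1 by (simp add: divide_le_eq)
  finally show ?thesis unfolding X_def Y_def .
qed

text \<open>These bounds compare the dilatation of the deformation of balls with the base of the power in the Harnack
  constant. In the first one the two sides agree at \<open>t = 0\<close>, and \<open>deformation_derivative_bound\<close> says that
  the logarithm of their quotient decreases in \<open>t\<close>.\<close>

lemma deformation_dilatation_le:
  fixes \<alpha> t :: real
  assumes \<alpha>: "0 < \<alpha>" "\<alpha> < 1" and t: "0 \<le> t" "(1 + t) * \<alpha> + t < 1"
  defines "r \<equiv> \<alpha> * (1 - t)"
  defines "\<kappa> \<equiv> ln r / ln \<alpha>" and "C \<equiv> ln \<alpha> / ln ((1 + t) * \<alpha> + t)"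
  shows "\<kappa> * (1 + t / (1 - r)) \<le> C" and "1 \<le> C * (\<kappa> * (1 - t / (1 - r)))"
proof -
  have t1: "t < 1" using t \<alpha> by (smt (verit) mult_pos_pos)
  define \<beta> where "\<beta> = (1 + t) * \<alpha> + t"
  have "0 < r" "r \<le> \<alpha>" using \<alpha> t t1 by (auto simp: r_def mult_le_cancel_left1)
  then have r: "0 < r" "r \<le> \<alpha>" "r < 1" using \<alpha> by auto
  have \<beta>: "\<alpha> \<le> \<beta>" "\<beta> < 1" using \<alpha> t by (auto simp: \<beta>_def algebra_simps)
  have \<beta>0: "0 < \<beta>" using \<alpha> \<beta> by simp
  define X Y L where "X = ln (1 / r)" and "Y = ln (1 / \<beta>)" and "L = ln (1 / \<alpha>)"
  have pos: "X > 0" "Y > 0" "L > 0" using r \<beta> \<beta>0 \<alpha> by (auto simp: X_def Y_def L_def ln_div)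
  have \<kappa>C: "\<kappa> = X / L" "C = L / Y"
    using r \<beta>0 \<alpha> by (auto simp: \<kappa>_def C_def X_def Y_def L_def ln_div \<beta>_def[symmetric])
  have e2: "Y * (1 - r) \<le> (1 - \<beta>) * X"
    using ln_inverse_over_one_minus_antimono[of r \<beta>] r \<beta> unfolding X_def Y_def by simp
  have eps: "1 - t / (1 - r) = (1 - t) * (1 - \<alpha>) / (1 - r)" using r by (simp add: r_def field_simps)
  show "1 \<le> C * (\<kappa> * (1 - t / (1 - r)))"
  proof -
    have "1 - \<beta> \<le> (1 - t) * (1 - \<alpha>)" using t \<alpha> by (simp add: \<beta>_def algebra_simps)
    then have "(1 - \<beta>) * X \<le> (1 - t) * (1 - \<alpha>) * X" using pos by (intro mult_right_mono) auto
    with e2 have "Y * (1 - r) \<le> (1 - t) * (1 - \<alpha>) * X" by simp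
    moreover have "C * (\<kappa> * (1 - t / (1 - r))) = (1 - t) * (1 - \<alpha>) * X / (Y * (1 - r))"
      unfolding eps \<kappa>C using pos by simp
    ultimately show ?thesis using pos r by (simp add: le_divide_eq)
  qed
  define rr bb where "rr = (\<lambda>\<tau>. \<alpha> * (1 - \<tau>))" and "bb = (\<lambda>\<tau>. (1 + \<tau>) * \<alpha> + \<tau>)"
  \<comment> \<open>the logarithm of \<open>(1 + \<epsilon>) X Y\<close> as a function of \<open>t\<close>; its value at \<open>0\<close> is that of \<open>L\<^sup>2\<close>\<close>
  define \<Phi> where "\<Phi> = (\<lambda>\<tau>. ln (1 - rr \<tau> + \<tau>) - ln (1 - rr \<tau>) + ln (- ln (rr \<tau>)) + ln (- ln (bb \<tau>)))"
  have "\<Phi> t \<le> \<Phi> 0"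
  proof (rule DERIV_nonpos_imp_nonincreasing[OF t(1)])
    fix \<tau> assume \<tau>: "0 \<le> \<tau>" "\<tau> \<le> t"
    have bt: "bb \<tau> < 1"
    proof -
      have "bb \<tau> \<le> \<beta>" using \<tau> \<alpha> unfolding bb_def \<beta>_def by (intro add_mono mult_right_mono) auto
      then show ?thesis using \<beta> by simp
    qed
    have \<tau>1: "\<tau> < 1" using \<tau> t1 by simp
    have "0 < rr \<tau>" "rr \<tau> \<le> \<alpha>"
      using \<alpha> \<tau> \<tau>1 by (auto simp: rr_def mult_le_cancel_left1)
    then have rt: "0 < rr \<tau>" "rr \<tau> \<le> \<alpha>" "rr \<tau> < 1" using \<alpha> by auto
    have b0: "0 < bb \<tau>" using \<alpha> \<tau> by (simp add: bb_def add_pos_nonneg)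
    have lns: "ln (rr \<tau>) < 0" "ln (bb \<tau>) < 0" using rt bt b0 by auto
    have drr: "(rr has_real_derivative - \<alpha>) (at \<tau>)" unfolding rr_def by (auto intro!: derivative_eq_intros)
    have dbb: "(bb has_real_derivative (1 + \<alpha>)) (at \<tau>)" unfolding bb_def by (auto intro!: derivative_eq_intros)
    define D where "D = (\<alpha> + 1) / (1 - rr \<tau> + \<tau>) - \<alpha> / (1 - rr \<tau>) + (\<alpha> / rr \<tau>) / (- ln (rr \<tau>)) + (- ((1 + \<alpha>) / bb \<tau>)) / (- ln (bb \<tau>))"
    have "(\<Phi> has_real_derivative D) (at \<tau>)"
    proof -
      have ln_comp: "((\<lambda>\<tau>. ln (f \<tau>)) has_real_derivative f' / f \<tau>) (at \<tau>)"
        if "(f has_real_derivative f') (at \<tau>)" "0 < f \<tau>" for f f'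
        using DERIV_chain2[OF DERIV_ln_divide that(1)] that(2) by simp
      have "((\<lambda>\<tau>. 1 - rr \<tau> + \<tau>) has_real_derivative \<alpha> + 1) (at \<tau>)" "((\<lambda>\<tau>. 1 - rr \<tau>) has_real_derivative \<alpha>) (at \<tau>)"
        by (auto intro!: derivative_eq_intros drr)
      moreover have "((\<lambda>\<tau>. - ln (rr \<tau>)) has_real_derivative \<alpha> / rr \<tau>) (at \<tau>)"
        using DERIV_minus[OF ln_comp[OF drr rt(1)]] by simp
      moreover have "((\<lambda>\<tau>. - ln (bb \<tau>)) has_real_derivative - ((1 + \<alpha>) / bb \<tau>)) (at \<tau>)"
        using DERIV_minus[OF ln_comp[OF dbb b0]] .
      ultimately show ?thesis
        unfolding \<Phi>_def D_def using rt \<tau> lns by (intro DERIV_add DERIV_diff ln_comp) auto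
    qed
    moreover have "D \<le> 0"
    proof -
      have p: "0 < 1 - rr \<tau> + \<tau>" "0 < 1 - rr \<tau>" using rt \<tau> by auto
      have "(\<alpha> + 1) / (1 - rr \<tau> + \<tau>) - \<alpha> / (1 - rr \<tau>) = (1 - \<alpha>) / ((1 - rr \<tau>) * (1 - rr \<tau> + \<tau>))"
        using p unfolding diff_frac_eq[OF less_imp_neq[OF p(1), symmetric] less_imp_neq[OF p(2), symmetric]]
        by (simp add: rr_def algebra_simps)
      moreover have "(\<alpha> / rr \<tau>) / (- ln (rr \<tau>)) = 1 / ((1 - \<tau>) * ln (1 / rr \<tau>))"
        using \<alpha> rt \<tau>1 by (simp add: rr_def ln_div)
      moreover have "(1 - \<alpha>) / ((1 - rr \<tau>) * (1 - rr \<tau> + \<tau>)) + 1 / ((1 - \<tau>) * ln (1 / rr \<tau>)) \<le> (1 + \<alpha>) / (bb \<tau> * ln (1 / bb \<tau>))"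
      proof -
        have "0 < ln (1 / bb \<tau>)" using b0 lns(2) by (simp add: ln_div)
        then have "0 < bb \<tau> * ln (1 / bb \<tau>)" using b0 by simp
        moreover have "bb \<tau> * ln (1 / bb \<tau>) * ((1 - \<alpha>) / ((1 - rr \<tau>) * (1 - rr \<tau> + \<tau>)) + 1 / ((1 - \<tau>) * ln (1 / rr \<tau>))) \<le> 1 + \<alpha>"
          using deformation_derivative_bound[OF \<alpha> \<tau>(1)] bt unfolding rr_def bb_def by blast
        ultimately show ?thesis by (simp only: pos_le_divide_eq mult.commute)
      qed
      moreover have "(- ((1 + \<alpha>) / bb \<tau>)) / (- ln (bb \<tau>)) = - ((1 + \<alpha>) / (bb \<tau> * ln (1 / bb \<tau>)))"
        using b0 lns by (simp add: ln_div)
      ultimately show ?thesis unfolding D_def by linarith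
    qed
    ultimately show "\<exists>d. (\<Phi> has_real_derivative d) (at \<tau>) \<and> d \<le> 0" by blast
  qed
  moreover have XY: "- ln r = X" "- ln \<beta> = Y" "- ln \<alpha> = L"
    using r \<beta>0 \<alpha> by (auto simp: X_def Y_def L_def ln_div)
  moreover have "\<Phi> t = ln ((1 - r + t) / (1 - r) * (X * Y))"
    using r t pos unfolding \<Phi>_def rr_def bb_def r_def[symmetric] \<beta>_def[symmetric] XY
    by (simp add: ln_div ln_mult)
  moreover have "\<Phi> 0 = ln (L * L)"
    using pos XY(3) unfolding \<Phi>_def rr_def bb_def by (simp add: ln_mult)
  ultimately have "ln ((1 - r + t) / (1 - r) * (X * Y)) \<le> ln (L * L)" by simp
  then have "(1 - r + t) / (1 - r) * (X * Y) \<le> L * L"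
    using r t pos by (subst (asm) ln_le_cancel_iff) (auto intro!: mult_pos_pos divide_pos_pos)
  moreover have "1 + t / (1 - r) = (1 - r + t) / (1 - r)" using r by (simp add: field_simps)
  ultimately show "\<kappa> * (1 + t / (1 - r)) \<le> C"
    unfolding \<kappa>C using pos r by (simp add: field_simps)
qed

section \<open>Transport of capacity and deformation of balls\<close>

lemma gradient_eq_0_off_support:
  fixes w :: "'a::euclidean_space \<Rightarrow> real"
  assumes w: "\<And>x. (w has_derivative (\<lambda>h. W x \<bullet> h)) (at x)" and x: "x \<notin> closure {x. w x \<noteq> 0}"
  shows "W x = 0"
proof -
  have o: "open (- closure {x. w x \<noteq> 0})" and xK: "x \<in> - closure {x. w x \<noteq> 0}" using x by auto
  have z: "0 = w y" if "y \<in> - closure {x. w x \<noteq> 0}" for y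
    using that closure_subset[of "{x. w x \<noteq> 0}"] by auto
  have "((\<lambda>_. 0::real) has_derivative (\<lambda>_. 0)) (at x)" by simp
  from has_derivative_transform_within_open[OF this o xK z]
  have "(w has_derivative (\<lambda>_. 0)) (at x)" by simp
  then have "(\<lambda>h. W x \<bullet> h) = (\<lambda>_. 0)" using w has_derivative_unique by blast
  then have "W x \<bullet> W x = 0" by meson
  then show ?thesis by simp
qed

lemma gradient_bounded_compact_support:
  fixes w :: "'a::euclidean_space \<Rightarrow> real"
  assumes w: "\<And>x. (w has_derivative (\<lambda>h. W x \<bullet> h)) (at x)" and W: "continuous_on UNIV W"
    and K: "compact (closure {x. w x \<noteq> 0})"
  obtains M where "0 \<le> M" "\<And>x. norm (W x) \<le> M"
proof -
  let ?K = "closure {x. w x \<noteq> 0}"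
  have "bounded (W ` ?K)" by (intro compact_imp_bounded compact_continuous_image continuous_on_subset[OF W] K) auto
  then obtain M where M: "\<forall>y\<in>?K. norm (W y) \<le> M" unfolding bounded_iff by auto
  have "norm (W y) \<le> max M 0" for y
  proof (cases "y \<in> ?K")
    case True
    then show ?thesis using M by (simp add: le_max_iff_disj)
  next
    case False
    then show ?thesis using gradient_eq_0_off_support[OF w False] by simp
  qed
  then show ?thesis using that[of "max M 0"] by simp
qed

text \<open>The vector \<open>c (\<xi> + (p \<bullet> \<xi>) q)\<close> is the adjoint derivative of \<open>T\<close> applied to \<open>\<xi>\<close>, hence the gradient of
  \<open>w \<circ> T\<close> when \<open>\<xi>\<close> is the gradient of \<open>w\<close>; \<open>c ^ n (1 + q \<bullet> p)\<close> is the Jacobian of \<open>T\<close>.\<close>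

lemma condenser_cap_transport:
  fixes T :: "'a::euclidean_space \<Rightarrow> 'a"
  assumes A: "open A" and Tc: "continuous_on UNIV T" and N: "closed N" "negligible N"
    and lines: "\<And>i y. i \<in> Basis \<Longrightarrow> finite {t. line_point i y t \<in> N}"
    and inj: "inj_on T (- N)"
    and der: "\<And>x. x \<notin> N \<Longrightarrow> (T has_derivative (\<lambda>h. c x *\<^sub>R (h + (q x \<bullet> h) *\<^sub>R p x))) (at x)"
    and pre: "\<And>C. compact C \<Longrightarrow> C \<subseteq> A \<Longrightarrow> compact (T -` C) \<and> T -` C \<subseteq> A'"
    and F: "\<And>x. x \<in> F' \<Longrightarrow> T x \<in> F"
    and dil: "\<And>x \<xi>. x \<notin> N \<Longrightarrow> norm (c x *\<^sub>R (\<xi> + (p x \<bullet> \<xi>) *\<^sub>R q x)) ^ DIM('a)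
        \<le> k * \<bar>c x ^ DIM('a) * (1 + q x \<bullet> p x)\<bar> * norm \<xi> ^ DIM('a)"
    and bnd: "\<And>x \<xi>. x \<notin> N \<Longrightarrow> norm (c x *\<^sub>R (\<xi> + (p x \<bullet> \<xi>) *\<^sub>R q x)) \<le> B * norm \<xi>"
    and k: "0 < k" and B: "0 \<le> B"
  shows "condenser_cap A' F' \<le> ennreal k * condenser_cap A F"
proof -
  let ?n = "DIM('a)"
  have step: "condenser_cap A' F' \<le> ennreal k * c0" if c0: "condenser_cap A F < c0" for c0
  proof -
    obtain w W where w: "\<And>x. (w has_derivative (\<lambda>h. W x \<bullet> h)) (at x)" "continuous_on UNIV W"
      "\<And>x. 0 \<le> w x" "\<And>x. x \<in> F \<Longrightarrow> 1 \<le> w x" "compact (closure {x. w x \<noteq> 0})" "closure {x. w x \<noteq> 0} \<subseteq> A"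
      "(\<integral>\<^sup>+x. ennreal (norm (W x) ^ ?n) \<partial>lborel) < c0"
      using condenser_smooth_test_function[OF A c0] by metis
    let ?K = "closure {x. w x \<noteq> 0}"
    have wc: "continuous_on UNIV w" using w(1) by (meson continuous_at_imp_continuous_on has_derivative_continuous)
    have W0: "W x = 0" if "x \<notin> ?K" for x using gradient_eq_0_off_support[OF w(1) that] .
    obtain M where M: "\<And>y. norm (W y) \<le> M" using gradient_bounded_compact_support[OF w(1,2,5)] by metis
    define U where "U = (\<lambda>x. c x *\<^sub>R (W (T x) + (p x \<bullet> W (T x)) *\<^sub>R q x))"
    have TK: "compact (T -` ?K)" "T -` ?K \<subseteq> A'" using pre[OF w(5,6)] by auto
    have sub: "closure {x. w (T x) \<noteq> 0} \<subseteq> T -` ?K"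
      by (rule closure_minimal) (use closure_subset[of "{x. w x \<noteq> 0}"] TK in \<open>auto simp: compact_imp_closed\<close>)
    have cc: "compact (closure {x. w (T x) \<noteq> 0})"
      using closed_Int_compact[OF closed_closure TK(1), of "{x. w (T x) \<noteq> 0}"] sub by (simp add: Int_absorb2)
    have "condenser_cap A' F' \<le> (\<integral>\<^sup>+x\<in>-N. ennreal (norm (U x) ^ ?n) \<partial>lebesgue)"
    proof (rule piecewise_C1_admissible(2)[OF _ N lines])
      show "continuous_on UNIV (\<lambda>x. w (T x))" by (rule continuous_on_compose2[OF wc Tc]) simp
      show "((\<lambda>x. w (T x)) has_derivative (\<lambda>h. U x \<bullet> h)) (at x)" if x: "x \<notin> N" for x
      proof -
        have "W (T x) \<bullet> (c x *\<^sub>R (h + (q x \<bullet> h) *\<^sub>R p x)) = U x \<bullet> h" for h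
          unfolding U_def by (simp add: inner_add_right inner_add_left inner_commute algebra_simps)
        then show ?thesis using diff_chain_at[OF der[OF x] w(1)] by (simp add: o_def)
      qed
      show "norm (U x) \<le> B * M" if "x \<notin> N" for x
        using order_trans[OF bnd[OF that] mult_left_mono[OF M B]] unfolding U_def .
      show "closure {x. w (T x) \<noteq> 0} \<subseteq> A'" using sub TK by blast
    qed (use cc w(3,4) F in auto)
    also have "\<dots> \<le> (\<integral>\<^sup>+x\<in>-N. ennreal (\<bar>c x ^ ?n * (1 + q x \<bullet> p x)\<bar> * (k * norm (W (T x)) ^ ?n)) \<partial>lebesgue)"
    proof (intro nn_integral_mono)
      fix x
      show "ennreal (norm (U x) ^ ?n) * indicator (- N) x \<le>
        ennreal (\<bar>c x ^ ?n * (1 + q x \<bullet> p x)\<bar> * (k * norm (W (T x)) ^ ?n)) * indicator (- N) x"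
        using dil[of x "W (T x)"] unfolding U_def by (auto simp: indicator_def mult_ac intro!: ennreal_leI)
    qed
    also have "\<dots> \<le> (\<integral>\<^sup>+x. ennreal (k * norm (W x) ^ ?n) \<partial>lebesgue)"
    proof (rule nn_integral_substitution_le[OF _ inj])
      show "open (- N)" using N(1) by auto
      show "continuous_on UNIV (\<lambda>x. k * norm (W x) ^ ?n)" by (intro continuous_intros w(2))
      show "k * norm (W x) ^ ?n = 0" if "x \<notin> ?K" for x using W0[OF that] by (simp add: zero_power)
    qed (use der w(5) k in auto)
    also have "\<dots> = (\<integral>\<^sup>+x. ennreal k * ennreal (norm (W x) ^ ?n) \<partial>lborel)"
      using k by (simp add: nn_integral_completion ennreal_mult)
    also have "\<dots> = ennreal k * (\<integral>\<^sup>+x. ennreal (norm (W x) ^ ?n) \<partial>lborel)"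
    proof (rule nn_integral_cmult)
      show "(\<lambda>x. ennreal (norm (W x) ^ ?n)) \<in> borel_measurable lborel"
        using borel_measurable_continuous_onI[OF w(2)] by simp
    qed
    also have "\<dots> \<le> ennreal k * c0" using w(7) by (intro mult_left_mono) auto
    finally show ?thesis .
  qed
  show ?thesis
  proof (cases "condenser_cap A F = \<infinity>")
    case True
    then show ?thesis using k by (simp add: ennreal_mult_top)
  next
    case False
    show ?thesis
    proof (rule ennreal_le_epsilon)
      fix e :: real assume "0 < e"
      have "condenser_cap A F < condenser_cap A F + ennreal (e / k)"
        using False \<open>0 < e\<close> k by (cases "condenser_cap A F") (auto simp: ennreal_less_iff simp flip: ennreal_plus)
      from step[OF this] have "condenser_cap A' F' \<le> ennreal k * condenser_cap A F + ennreal k * ennreal (e / k)"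
        by (simp add: distrib_left)
      also have "ennreal k * ennreal (e / k) = ennreal e" using k \<open>0 < e\<close> by (simp add: ennreal_mult[symmetric])
      finally show "condenser_cap A' F' \<le> ennreal k * condenser_cap A F + ennreal e" .
    qed
  qed
qed

lemma finite_line_sphere:
  fixes z :: "'a::euclidean_space"
  assumes i: "i \<in> Basis"
  shows "finite {t. line_point i y t \<in> sphere z \<rho>}"
proof -
  define v where "v = line_point i y 0 - z"
  have lp: "line_point i y t - z = v + t *\<^sub>R i" for t unfolding v_def line_point_def by simp
  have "{t. line_point i y t \<in> sphere z \<rho>} \<subseteq> {t. poly [:v \<bullet> v - \<rho>\<^sup>2, 2 * (v \<bullet> i), 1:] t = 0}"
  proof
    fix t assume "t \<in> {t. line_point i y t \<in> sphere z \<rho>}"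
    then have "norm (v + t *\<^sub>R i) = \<rho>" by (simp add: dist_norm norm_minus_commute flip: lp)
    then have "(v + t *\<^sub>R i) \<bullet> (v + t *\<^sub>R i) = \<rho>\<^sup>2" by (metis power2_norm_eq_inner)
    then show "t \<in> {t. poly [:v \<bullet> v - \<rho>\<^sup>2, 2 * (v \<bullet> i), 1:] t = 0}"
      using i by (simp add: inner_add_left inner_add_right inner_commute algebra_simps)
  qed
  moreover have "finite {t. poly [:v \<bullet> v - \<rho>\<^sup>2, 2 * (v \<bullet> i), 1:] t = 0}"
    by (rule poly_roots_finite) simp
  ultimately show ?thesis by (rule finite_subset)
qed

text \<open>For fixed component of \<open>a\<close> along \<open>\<omega>\<close> this is a bound for the larger eigenvalue of a symmetric
  two by two matrix. The determinant condition is affine in that component, so that it need only be checked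
  when \<open>a\<close> is a multiple of \<open>\<omega>\<close>.\<close>

lemma radial_shift_dilatation_square:
  fixes \<omega> a \<xi> :: "'a::euclidean_space"
  assumes \<omega>: "norm \<omega> = 1" and a: "norm a \<le> \<epsilon>" and \<epsilon>: "\<epsilon> < 1" and \<kappa>: "0 < \<kappa>"
    and k: "\<kappa> * (1 + \<epsilon>) \<le> k" "1 \<le> k * (\<kappa> * (1 - \<epsilon>))"
  shows "(norm (\<xi> + (((\<kappa> - 1) *\<^sub>R \<omega> - \<kappa> *\<^sub>R a) \<bullet> \<xi>) *\<^sub>R \<omega>))\<^sup>2 \<le> k * (\<kappa> * (1 - a \<bullet> \<omega>)) * (norm \<xi>)\<^sup>2"
    and "0 < \<kappa> * (1 - a \<bullet> \<omega>)" and "\<kappa> * (1 - a \<bullet> \<omega>) \<le> k"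
proof -
  define e where "e = norm a"
  define s where "s = a \<bullet> \<omega>"
  define q where "q = \<omega> \<bullet> \<xi>"
  define \<xi>' a' where "\<xi>' = \<xi> - q *\<^sub>R \<omega>" and "a' = a - s *\<^sub>R \<omega>"
  define b where "b = a' \<bullet> \<xi>'"
  define X where "X = \<kappa> * (1 - s)"
  define Z where "Z = \<xi>' \<bullet> \<xi>'"
  have \<omega>\<omega>: "\<omega> \<bullet> \<omega> = 1" using \<omega> by (simp add: norm_eq_1)
  have e: "0 \<le> e" "e \<le> \<epsilon>" "e < 1" using a \<epsilon> by (auto simp: e_def)
  have s: "\<bar>s\<bar> \<le> e" using Cauchy_Schwarz_ineq2[of a \<omega>] \<omega> by (simp add: s_def e_def)
  have kpos: "0 < k" using k(1) \<kappa> e by (smt (verit) mult_pos_pos)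
  have X0: "0 < X" unfolding X_def using \<kappa> s e by (intro mult_pos_pos) auto
  have "X \<le> \<kappa> * (1 + \<epsilon>)" unfolding X_def using \<kappa> s e by (intro mult_left_mono) auto
  then have Xk: "X \<le> k" using k(1) by simp
  show "0 < \<kappa> * (1 - a \<bullet> \<omega>)" "\<kappa> * (1 - a \<bullet> \<omega>) \<le> k" using X0 Xk unfolding X_def s_def by auto
  have kp: "\<kappa> * (1 + e) \<le> k" using k(1) \<kappa> e by (smt (verit) mult_left_mono)
  have km: "1 \<le> k * (\<kappa> * (1 - e))"
  proof -
    have "k * (\<kappa> * (1 - \<epsilon>)) \<le> k * (\<kappa> * (1 - e))" using kpos \<kappa> e by (intro mult_left_mono) auto
    then show ?thesis using k(2) by simp
  qed
  have "\<kappa> * (1 - e) \<le> \<kappa> * (1 + e)" using \<kappa> e by (intro mult_left_mono) auto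
  then have km': "\<kappa> * (1 - e) \<le> k" and "k * (\<kappa> * (1 - e)) \<le> k * (\<kappa> * (1 + e))"
    using kp kpos by (auto intro: mult_left_mono)
  then have kp': "1 \<le> k * (\<kappa> * (1 + e))" using km by simp
  \<comment> \<open>the determinant condition; the squares of \<open>s\<close> cancel, so it is affine in \<open>s\<close>\<close>
  define G where "G = (\<lambda>s. (k * (\<kappa> * (1 - s)) - 1) * (k - \<kappa> * (1 - s)) - \<kappa>\<^sup>2 * k * (e\<^sup>2 - s\<^sup>2))"
  have Ge: "0 \<le> G e" using km km' by (simp add: G_def)
  have Gme: "0 \<le> G (- e)" using kp kp' by (simp add: G_def)
  have G0: "0 \<le> G s"
  proof (cases "e = 0")
    case True
    then show ?thesis using s Ge by simp
  next
    case False
    have "2 * e * G s = (e + s) * G e + (e - s) * G (- e)"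
      unfolding G_def by (simp add: power2_eq_square algebra_simps)
    moreover have "0 \<le> e + s" "0 \<le> e - s" using s by linarith+
    ultimately have "0 \<le> 2 * e * G s" using Ge Gme by simp
    then show ?thesis using False e by (simp add: zero_le_mult_iff)
  qed
  have b2: "b\<^sup>2 \<le> (e\<^sup>2 - s\<^sup>2) * Z"
  proof -
    have "b\<^sup>2 \<le> (a' \<bullet> a') * Z" unfolding b_def Z_def by (rule Cauchy_Schwarz_ineq)
    also have "a' \<bullet> a' = e\<^sup>2 - s\<^sup>2"
      unfolding a'_def e_def power2_norm_eq_inner
      by (simp add: inner_diff_left inner_diff_right \<omega>\<omega> s_def inner_commute power2_eq_square)
    finally show ?thesis .
  qed
  have Z0: "0 \<le> Z" by (simp add: Z_def)
  have "\<omega> \<bullet> \<xi>' = 0" by (simp add: \<xi>'_def inner_diff_right \<omega>\<omega> q_def)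
  then have orth: "\<omega> \<bullet> \<xi>' = 0" "\<xi>' \<bullet> \<omega> = 0" by (simp_all add: inner_commute)
  have \<xi>_eq: "\<xi> = \<xi>' + q *\<^sub>R \<omega>" by (simp add: \<xi>'_def)
  have norm_\<xi>: "(norm \<xi>)\<^sup>2 = q\<^sup>2 + Z"
    unfolding power2_norm_eq_inner by (subst (1 2) \<xi>_eq) (simp add: inner_add_left inner_add_right orth \<omega>\<omega> Z_def power2_eq_square)
  have a\<xi>: "a \<bullet> \<xi> = s * q + b"
  proof -
    have "a \<bullet> \<xi> = a \<bullet> \<xi>' + q * s" by (subst \<xi>_eq) (simp add: inner_add_right s_def)
    also have "a \<bullet> \<xi>' = b" unfolding b_def a'_def by (simp add: inner_diff_left orth)
    finally show ?thesis by simp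
  qed
  have "\<xi> + (((\<kappa> - 1) *\<^sub>R \<omega> - \<kappa> *\<^sub>R a) \<bullet> \<xi>) *\<^sub>R \<omega> = \<xi>' + (X * q - \<kappa> * b) *\<^sub>R \<omega>"
  proof -
    have eq: "((\<kappa> - 1) *\<^sub>R \<omega> - \<kappa> *\<^sub>R a) \<bullet> \<xi> = (\<kappa> - 1) * q - \<kappa> * (s * q + b)"
      by (simp add: inner_diff_left a\<xi> q_def)
    show ?thesis unfolding eq by (simp add: \<xi>'_def X_def algebra_simps)
  qed
  then have lhs: "(norm (\<xi> + (((\<kappa> - 1) *\<^sub>R \<omega> - \<kappa> *\<^sub>R a) \<bullet> \<xi>) *\<^sub>R \<omega>))\<^sup>2 = Z + (X * q - \<kappa> * b)\<^sup>2"
    unfolding power2_norm_eq_inner by (simp add: inner_add_left inner_add_right orth \<omega>\<omega> Z_def power2_eq_square)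
  define P where "P = k * X * (q\<^sup>2 + Z) - (Z + (X * q - \<kappa> * b)\<^sup>2)"
  have Gs: "G s = (k * X - 1) * (k - X) - \<kappa>\<^sup>2 * k * (e\<^sup>2 - s\<^sup>2)" by (simp add: G_def X_def)
  have "0 \<le> P"
  proof (cases "X = k")
    case True
    have es: "0 \<le> e\<^sup>2 - s\<^sup>2" using s power_mono[of "\<bar>s\<bar>" e 2] by simp
    have "\<kappa>\<^sup>2 * k * (e\<^sup>2 - s\<^sup>2) \<le> 0" using G0 True unfolding Gs by simp
    then have "e\<^sup>2 - s\<^sup>2 \<le> 0" using \<kappa> kpos by (simp add: mult_le_0_iff)
    with es have "e\<^sup>2 - s\<^sup>2 = 0" by simp
    then have "b = 0" using b2 by simp
    moreover have "1 \<le> k * k"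
    proof -
      have "k * (\<kappa> * (1 - e)) \<le> k * k" using km' kpos by (intro mult_left_mono) auto
      then show ?thesis using km by simp
    qed
    then have "0 \<le> (k * k - 1) * Z" using Z0 by simp
    ultimately show ?thesis unfolding P_def True by (simp add: power2_eq_square algebra_simps)
  next
    case False
    then have kX: "0 < k - X" using Xk by simp
    have "(k - X) * P = X * ((k - X) * q + \<kappa> * b)\<^sup>2 + ((k * X - 1) * (k - X) * Z - k * \<kappa>\<^sup>2 * b\<^sup>2)"
      unfolding P_def by (simp add: power2_eq_square algebra_simps)
    moreover have "k * \<kappa>\<^sup>2 * b\<^sup>2 \<le> (k * X - 1) * (k - X) * Z"
    proof -
      have "k * \<kappa>\<^sup>2 * b\<^sup>2 \<le> k * \<kappa>\<^sup>2 * ((e\<^sup>2 - s\<^sup>2) * Z)" using b2 kpos by (intro mult_left_mono) auto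
      also have "\<dots> = (\<kappa>\<^sup>2 * k * (e\<^sup>2 - s\<^sup>2)) * Z" by simp
      also have "\<dots> \<le> ((k * X - 1) * (k - X)) * Z" using G0 Z0 unfolding Gs by (intro mult_right_mono) auto
      finally show ?thesis .
    qed
    ultimately have "0 \<le> (k - X) * P" using X0 by simp
    then show ?thesis using kX by (simp add: zero_le_mult_iff)
  qed
  then show "(norm (\<xi> + (((\<kappa> - 1) *\<^sub>R \<omega> - \<kappa> *\<^sub>R a) \<bullet> \<xi>) *\<^sub>R \<omega>))\<^sup>2 \<le> k * (\<kappa> * (1 - a \<bullet> \<omega>)) * (norm \<xi>)\<^sup>2"
    unfolding lhs norm_\<xi> P_def X_def s_def by (simp add: mult.assoc)
qed

text \<open>In dimension at least two a bound for the squared expansion by \<open>k\<close> times the Jacobian \<open>X\<close> improves to the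
  bound needed for the conformal energy, since \<open>X \<le> k\<close>.\<close>

lemma power_dilatation_of_square:
  fixes m x X k :: real
  assumes "m\<^sup>2 \<le> k * X * x\<^sup>2" "0 < X" "X \<le> k" "0 \<le> m" "0 \<le> x" "2 \<le> n"
  shows "m ^ n \<le> k ^ (n - 1) * X * x ^ n"
proof (rule power2_le_imp_le)
  have "(m ^ n)\<^sup>2 = (m\<^sup>2) ^ n" by (simp add: power_mult[symmetric] mult.commute)
  also have "\<dots> \<le> (k * X * x\<^sup>2) ^ n" using assms by (intro power_mono) auto
  also have "\<dots> = (k * X) ^ n * (x ^ n)\<^sup>2" by (simp add: power_mult_distrib power_mult[symmetric] mult.commute)
  also have "\<dots> \<le> (k ^ (n - 1) * X)\<^sup>2 * (x ^ n)\<^sup>2"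
  proof (rule mult_right_mono)
    obtain j where n: "n = Suc (Suc j)" using \<open>2 \<le> n\<close> by (metis add_2_eq_Suc le_Suc_ex)
    have "X ^ j \<le> k ^ j" using assms by (intro power_mono) auto
    then have "k ^ Suc (Suc j) * X\<^sup>2 * X ^ j \<le> k ^ Suc (Suc j) * X\<^sup>2 * k ^ j"
      using assms by (intro mult_left_mono) auto
    then show "(k * X) ^ n \<le> (k ^ (n - 1) * X)\<^sup>2"
      unfolding n by (simp add: power_mult_distrib power2_eq_square mult_ac)
  qed simp
  finally show "(m ^ n)\<^sup>2 \<le> (k ^ (n - 1) * X * x ^ n)\<^sup>2" by (simp add: power_mult_distrib)
  show "0 \<le> k ^ (n - 1) * X * x ^ n" using assms by simp
qed

definition radial_profile :: "real \<Rightarrow> real \<Rightarrow> real" where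
  "radial_profile \<kappa> \<rho> = (min \<rho> 1) powr \<kappa> + max \<rho> 1 - 1"

definition shift_profile :: "real \<Rightarrow> real \<Rightarrow> real" where
  "shift_profile r \<gamma> = min 1 (max 0 ((1 - \<gamma>) / (1 - r)))"

text \<open>In units of the radius of the ball: a radial power map of the unit ball, followed by translations of the
  concentric spheres towards the point \<open>e\<close>. The full translation is reached on the sphere of radius \<open>r\<close>, so
  that the translations carry the ball of radius \<open>r\<close> about the origin rigidly to the one about \<open>e\<close>.\<close>

definition unit_deformation :: "real \<Rightarrow> real \<Rightarrow> 'a \<Rightarrow> 'a \<Rightarrow> 'a::euclidean_space" where
  "unit_deformation \<kappa> r e y =
     radial_profile \<kappa> (norm y) *\<^sub>R sgn y + shift_profile r (radial_profile \<kappa> (norm y)) *\<^sub>R e"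

lemma radial_profile_le_1: "\<rho> \<le> 1 \<Longrightarrow> radial_profile \<kappa> \<rho> = \<rho> powr \<kappa>"
  by (simp add: radial_profile_def)

lemma radial_profile_ge_1: "1 \<le> \<rho> \<Longrightarrow> radial_profile \<kappa> \<rho> = \<rho>"
  by (simp add: radial_profile_def)

lemma radial_profile_nonneg: "0 \<le> radial_profile \<kappa> \<rho>"
  by (auto simp: radial_profile_def min_def max_def)

lemma radial_profile_strict_mono:
  assumes "0 < \<kappa>" "0 \<le> \<rho>" "\<rho> < \<rho>'"
  shows "radial_profile \<kappa> \<rho> < radial_profile \<kappa> \<rho>'"
proof (cases "\<rho>' \<le> 1")
  case True
  then show ?thesis using assms by (simp add: radial_profile_le_1 powr_less_mono2)
next
  case False
  show ?thesis
  proof (cases "\<rho> \<le> 1")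
    case True
    have "\<rho> powr \<kappa> \<le> 1 powr \<kappa>" using assms True by (intro powr_mono2) auto
    then show ?thesis using False True by (simp add: radial_profile_le_1 radial_profile_ge_1)
  qed (use False assms in \<open>simp add: radial_profile_ge_1\<close>)
qed

lemma continuous_radial_profile: "0 < \<kappa> \<Longrightarrow> continuous_on {0..} (radial_profile \<kappa>)"
proof -
  assume "0 < \<kappa>"
  have "continuous_on {0..} (\<lambda>\<rho>. min \<rho> 1 powr \<kappa>)"
    by (rule continuous_on_powr'[OF continuous_on_min[OF continuous_on_id continuous_on_const] continuous_on_const])
       (use \<open>0 < \<kappa>\<close> in auto)
  then show ?thesis
    unfolding radial_profile_def[abs_def] by (intro continuous_on_add continuous_on_diff continuous_on_max continuous_on_id continuous_on_const)
qed

lemma continuous_unit_deformation: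
  assumes \<kappa>: "0 < \<kappa>"
  shows "continuous_on UNIV (unit_deformation \<kappa> r e)"
proof -
  let ?g = "\<lambda>y::'a. radial_profile \<kappa> (norm y)"
  have gc: "continuous_on UNIV ?g"
    by (rule continuous_on_compose2[OF continuous_radial_profile[OF \<kappa>] continuous_on_norm_id]) auto
  have sc: "continuous_on UNIV (\<lambda>y::'a. ?g y *\<^sub>R sgn y)"
    unfolding continuous_on_eq_continuous_at[OF open_UNIV]
  proof
    fix y :: 'a
    show "isCont (\<lambda>y. ?g y *\<^sub>R sgn y) y"
    proof (cases "y = 0")
      case True
      have "isCont ?g 0" using gc by (simp add: continuous_on_eq_continuous_at)
      then have "(?g \<longlongrightarrow> ?g 0) (at 0)" unfolding isCont_def .
      then have "((\<lambda>y. ?g y *\<^sub>R sgn y) \<longlongrightarrow> 0) (at 0)"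
        by (rule_tac Lim_null_comparison[of _ ?g])
           (use \<kappa> in \<open>auto simp: norm_sgn radial_profile_nonneg radial_profile_le_1\<close>)
      then show ?thesis using True by (simp add: isCont_def)
    next
      case False
      then show ?thesis using gc
        by (intro continuous_intros) (auto simp: continuous_on_eq_continuous_at isCont_def sgn_div_norm intro!: tendsto_intros)
    qed
  qed
  show ?thesis
    unfolding unit_deformation_def[abs_def] shift_profile_def divide_inverse
    by (rule continuous_on_add[OF sc continuous_on_scaleR[OF _ continuous_on_const]])
       (intro continuous_on_min continuous_on_max continuous_on_mult continuous_on_diff continuous_on_const gc)
qed

lemma shift_profile_lipschitz:
  assumes "r < 1"
  shows "\<bar>shift_profile r \<gamma> - shift_profile r \<gamma>'\<bar> \<le> \<bar>\<gamma> - \<gamma>'\<bar> / (1 - r)"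
proof -
  have "\<bar>shift_profile r \<gamma> - shift_profile r \<gamma>'\<bar> \<le> \<bar>(1 - \<gamma>) / (1 - r) - (1 - \<gamma>') / (1 - r)\<bar>"
    unfolding shift_profile_def by (auto simp: min_def max_def abs_if)
  also have "\<dots> = \<bar>\<gamma> - \<gamma>'\<bar> / (1 - r)"
    using assms by (simp add: diff_divide_distrib[symmetric] abs_divide abs_minus_commute)
  finally show ?thesis .
qed

text \<open>The images of concentric spheres are nested, because each radius exceeds a smaller one by more than
  the distance of the centres.\<close>

lemma inj_unit_deformation:
  assumes \<kappa>: "0 < \<kappa>" and "r < 1" and e: "norm e < 1 - r"
  shows "inj (unit_deformation \<kappa> r e)"
proof (rule injI)
  fix y y' :: 'a
  let ?g = "\<lambda>y::'a. radial_profile \<kappa> (norm y)"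
  let ?m = "\<lambda>y::'a. shift_profile r (?g y)"
  assume eq: "unit_deformation \<kappa> r e y = unit_deformation \<kappa> r e y'"
  have ng: "norm (?g y *\<^sub>R sgn y) = ?g y" for y :: 'a
    using \<kappa> by (cases "y = 0") (auto simp: norm_sgn radial_profile_nonneg radial_profile_le_1)
  have diff: "?g y *\<^sub>R sgn y - ?g y' *\<^sub>R sgn y' = (?m y' - ?m y) *\<^sub>R e"
    using eq unfolding unit_deformation_def by (simp add: algebra_simps)
  have "\<bar>?g y - ?g y'\<bar> \<le> norm (?g y *\<^sub>R sgn y - ?g y' *\<^sub>R sgn y')"
    using norm_triangle_ineq3[of "?g y *\<^sub>R sgn y" "?g y' *\<^sub>R sgn y'"] unfolding ng .
  also have "\<dots> = \<bar>?m y - ?m y'\<bar> * norm e" unfolding diff by (simp add: abs_minus_commute)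
  also have "\<dots> \<le> \<bar>?g y - ?g y'\<bar> / (1 - r) * norm e"
    by (intro mult_right_mono shift_profile_lipschitz assms) auto
  finally have le: "\<bar>?g y - ?g y'\<bar> \<le> \<bar>?g y - ?g y'\<bar> * (norm e / (1 - r))" by simp
  have lt: "norm e / (1 - r) < 1" using assms by (simp add: divide_less_eq)
  have gg: "?g y = ?g y'"
  proof (rule ccontr)
    assume "?g y \<noteq> ?g y'"
    then have "\<bar>?g y - ?g y'\<bar> * (norm e / (1 - r)) < \<bar>?g y - ?g y'\<bar> * 1"
      using lt by (intro mult_strict_left_mono) auto
    then show False using le by simp
  qed
  have nn: "norm y = norm y'"
    using radial_profile_strict_mono[OF \<kappa>, of "norm y" "norm y'"] radial_profile_strict_mono[OF \<kappa>, of "norm y'" "norm y"] gg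
    by (metis less_irrefl linorder_neqE_linordered_idom norm_ge_zero)
  show "y = y'"
  proof (cases "y = 0")
    case True
    then show ?thesis using nn by simp
  next
    case False
    have "?g y > 0" using radial_profile_strict_mono[OF \<kappa>, of 0 "norm y"] False \<kappa> radial_profile_nonneg[of \<kappa> 0] by (simp add: le_less_trans)
    moreover have "?g y *\<^sub>R sgn y = ?g y *\<^sub>R sgn y'" using diff gg by simp
    ultimately have "sgn y = sgn y'" by simp
    moreover have "norm v *\<^sub>R sgn v = v" for v :: 'a by (cases "v = 0") (simp_all add: sgn_div_norm)
    ultimately show ?thesis using nn by metis
  qed
qed

lemma power_map_has_derivative:
  fixes y :: "'a::euclidean_space"
  assumes "y \<noteq> 0"
  shows "((\<lambda>y. norm y powr s *\<^sub>R y) has_derivative (\<lambda>h. norm y powr s *\<^sub>R (h + (sgn y \<bullet> h) *\<^sub>R (s *\<^sub>R sgn y)))) (at y)"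
proof -
  have n: "norm y > 0" using assms by simp
  have "((\<lambda>\<rho>. \<rho> powr s) has_derivative (\<lambda>h. h * (s * norm y powr (s - 1)))) (at (norm y))"
    using has_real_derivative_powr[OF n, of s] by (simp add: has_field_derivative_def mult_commute_abs)
  from diff_chain_at[OF has_derivative_norm[OF assms] this]
  have d: "((\<lambda>y. norm y powr s) has_derivative (\<lambda>h. (h \<bullet> sgn y) * (s * norm y powr (s - 1)))) (at y)"
    by (simp add: o_def)
  have "norm y powr s = norm y powr (s - 1) * norm y"
    using n by (simp add: powr_diff)
  then show ?thesis
    by (intro has_derivative_eq_rhs[OF has_derivative_scaleR[OF d has_derivative_ident]])
       (auto simp: fun_eq_iff sgn_div_norm inner_commute algebra_simps)
qed

lemma norm_powr_has_derivative:
  fixes y :: "'a::euclidean_space"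
  assumes "y \<noteq> 0"
  shows "((\<lambda>y. norm y powr s) has_derivative (\<lambda>h. norm y powr (s - 1) * (s * (sgn y \<bullet> h)))) (at y)"
proof -
  have n: "norm y > 0" using assms by simp
  have "((\<lambda>\<rho>. \<rho> powr s) has_derivative (\<lambda>h. h * (s * norm y powr (s - 1)))) (at (norm y))"
    using has_real_derivative_powr[OF n, of s] by (simp add: has_field_derivative_def mult_commute_abs)
  from diff_chain_at[OF has_derivative_norm[OF assms] this]
  show ?thesis by (simp add: o_def inner_commute mult_ac)
qed

lemma powr_norm_sgn: "y \<noteq> 0 \<Longrightarrow> norm y powr \<kappa> *\<^sub>R sgn y = norm y powr (\<kappa> - 1) *\<^sub>R (y::'a::euclidean_space)"
  by (simp add: sgn_div_norm powr_diff divide_inverse)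

text \<open>Off three spheres the derivative is a multiple of a rank-one perturbation of the identity.\<close>

definition deformation_factor :: "real \<Rightarrow> 'a::euclidean_space \<Rightarrow> real" where
  "deformation_factor \<kappa> y = (if norm y < 1 then norm y powr (\<kappa> - 1) else 1)"

definition deformation_vector :: "real \<Rightarrow> real \<Rightarrow> 'a \<Rightarrow> 'a \<Rightarrow> 'a::euclidean_space" where
  "deformation_vector \<kappa> r e y =
     (if 1 < norm y then 0
      else (\<kappa> - 1) *\<^sub>R sgn y - \<kappa> *\<^sub>R (if norm y powr \<kappa> < r then 0 else e /\<^sub>R (1 - r)))"

lemma unit_deformation_has_derivative:
  fixes y e :: "'a::euclidean_space"
  assumes \<kappa>: "0 < \<kappa>" and r: "0 < r" "r < 1" and y: "y \<noteq> 0" "norm y \<noteq> 1" "norm y powr \<kappa> \<noteq> r"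
  shows "(unit_deformation \<kappa> r e has_derivative
     (\<lambda>h. deformation_factor \<kappa> y *\<^sub>R (h + (sgn y \<bullet> h) *\<^sub>R deformation_vector \<kappa> r e y))) (at y)"
proof -
  have nc: "continuous_on UNIV (\<lambda>y::'a. norm y)" by (intro continuous_intros)
  have pc: "continuous_on UNIV (\<lambda>y::'a. norm y powr \<kappa>)"
    by (rule continuous_on_powr'[OF nc continuous_on_const]) (use \<kappa> in auto)
  consider "1 < norm y" | "norm y < 1" "norm y powr \<kappa> < r" | "norm y < 1" "r < norm y powr \<kappa>"
    using y by linarith
  then show ?thesis
  proof cases
    case 1
    have o: "open {y::'a. 1 < norm y}" by (intro open_Collect_less continuous_intros)
    have eq: "x = unit_deformation \<kappa> r e x" if "x \<in> {y. 1 < norm y}" for x :: 'a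
    proof -
      have x: "x \<noteq> 0" "1 < norm x" using that by auto
      then have "(1 - norm x) / (1 - r) \<le> 0" using r by (intro divide_nonpos_pos) auto
      then show ?thesis using x
        by (simp add: unit_deformation_def radial_profile_ge_1 shift_profile_def sgn_div_norm max_absorb1)
    qed
    have "((\<lambda>x. x) has_derivative (\<lambda>h. h)) (at y)" by simp
    from has_derivative_transform_within_open[OF this o _ eq] 1
    show ?thesis by (simp add: deformation_factor_def deformation_vector_def)
  next
    case 2
    define S where "S = {y::'a. norm y powr \<kappa> < r} \<inter> {y. norm y < 1} \<inter> - {0}"
    have o: "open S" unfolding S_def
      by (intro open_Int open_Collect_less[OF pc continuous_on_const] open_Collect_less[OF continuous_on_const pc]
          open_Collect_less[OF nc continuous_on_const]) auto
    have eq: "norm x powr (\<kappa> - 1) *\<^sub>R x + e = unit_deformation \<kappa> r e x" if "x \<in> S" for x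
    proof -
      have "1 \<le> (1 - norm x powr \<kappa>) / (1 - r)" using that r unfolding S_def by (simp add: le_divide_eq)
      then show ?thesis using that unfolding S_def
        by (simp add: unit_deformation_def radial_profile_le_1 shift_profile_def powr_norm_sgn min_def max_def)
    qed
    have "((\<lambda>x. norm x powr (\<kappa> - 1) *\<^sub>R x + e) has_derivative
      (\<lambda>h. norm y powr (\<kappa> - 1) *\<^sub>R (h + (sgn y \<bullet> h) *\<^sub>R ((\<kappa> - 1) *\<^sub>R sgn y)))) (at y)"
      using has_derivative_add[OF power_map_has_derivative[OF y(1), of "\<kappa> - 1"] has_derivative_const[of e]] by simp
    from has_derivative_transform_within_open[OF this o _ eq] 2 y(1)
    show ?thesis by (simp add: deformation_factor_def deformation_vector_def S_def)
  next
    case 3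
    define S where "S = {y::'a. r < norm y powr \<kappa>} \<inter> {y. norm y < 1} \<inter> - {0}"
    have o: "open S" unfolding S_def
      by (intro open_Int open_Collect_less[OF pc continuous_on_const] open_Collect_less[OF continuous_on_const pc]
          open_Collect_less[OF nc continuous_on_const]) auto
    define a where "a = e /\<^sub>R (1 - r)"
    have eq: "norm x powr (\<kappa> - 1) *\<^sub>R x + (1 - norm x powr \<kappa>) *\<^sub>R a = unit_deformation \<kappa> r e x" if "x \<in> S" for x
    proof -
      have "(1 - norm x powr \<kappa>) / (1 - r) \<le> 1" using that r unfolding S_def by (simp add: divide_le_eq)
      moreover have "norm x powr \<kappa> \<le> 1 powr \<kappa>" using that \<kappa> unfolding S_def by (intro powr_mono2) auto
      then have "0 \<le> (1 - norm x powr \<kappa>) / (1 - r)" using r by simp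
      ultimately show ?thesis using that unfolding S_def
        by (simp add: unit_deformation_def radial_profile_le_1 shift_profile_def powr_norm_sgn a_def divide_inverse)
    qed
    have "((\<lambda>x. norm x powr (\<kappa> - 1) *\<^sub>R x + (1 - norm x powr \<kappa>) *\<^sub>R a) has_derivative
      (\<lambda>h. norm y powr (\<kappa> - 1) *\<^sub>R (h + (sgn y \<bullet> h) *\<^sub>R ((\<kappa> - 1) *\<^sub>R sgn y)) + (0 - norm y powr (\<kappa> - 1) * (\<kappa> * (sgn y \<bullet> h))) *\<^sub>R a)) (at y)"
      by (intro has_derivative_add power_map_has_derivative[OF y(1)] has_derivative_scaleR_left has_derivative_diff has_derivative_const norm_powr_has_derivative[OF y(1)])
    moreover have "(\<lambda>h. norm y powr (\<kappa> - 1) *\<^sub>R (h + (sgn y \<bullet> h) *\<^sub>R ((\<kappa> - 1) *\<^sub>R sgn y)) + (0 - norm y powr (\<kappa> - 1) * (\<kappa> * (sgn y \<bullet> h))) *\<^sub>R a)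
      = (\<lambda>h. norm y powr (\<kappa> - 1) *\<^sub>R (h + (sgn y \<bullet> h) *\<^sub>R ((\<kappa> - 1) *\<^sub>R sgn y - \<kappa> *\<^sub>R a)))"
      by (simp add: fun_eq_iff algebra_simps)
    ultimately have "((\<lambda>x. norm x powr (\<kappa> - 1) *\<^sub>R x + (1 - norm x powr \<kappa>) *\<^sub>R a) has_derivative
      (\<lambda>h. norm y powr (\<kappa> - 1) *\<^sub>R (h + (sgn y \<bullet> h) *\<^sub>R ((\<kappa> - 1) *\<^sub>R sgn y - \<kappa> *\<^sub>R a)))) (at y)" by simp
    from has_derivative_transform_within_open[OF this o _ eq] 3 y(1)
    show ?thesis by (simp add: deformation_factor_def deformation_vector_def S_def a_def)
  qed
qed

section \<open>Comparison of capacities of balls\<close>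

lemma condenser_cap_mono: "F \<subseteq> F' \<Longrightarrow> condenser_cap A F \<le> condenser_cap A F'"
  unfolding condenser_cap_def condenser_admissible_def by (rule INF_superset_mono) auto

text \<open>The deformation \<open>T\<close>, scaled to the ball of radius \<open>R\<close> about \<open>z\<close>, moves the ball on the left onto the ball
  on the right. It is the identity off \<open>ball z R\<close>, so it preserves \<open>G\<close> and the compactness of supports.\<close>

lemma condenser_cap_cball_le:
  fixes G :: "'a::euclidean_space set"
  assumes n: "2 \<le> DIM('a)" and G: "open G" "ball z R \<subseteq> G" and R: "0 < R" and \<alpha>: "0 < \<alpha>" "\<alpha> < 1"
    and t: "dist z x = t * R" "(1 + t) * \<alpha> + t < 1"
  shows "condenser_cap G (cball z (\<alpha> * R)) \<le>
    ennreal ((ln \<alpha> / ln ((1 + t) * \<alpha> + t)) ^ (DIM('a) - 1)) * condenser_cap G (cball x (\<alpha> * ((1 - t) * R)))"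
proof -
  let ?n = "DIM('a)"
  have t0: "0 \<le> t" using t(1) R by (metis zero_le_dist zero_le_mult_iff not_less order_less_imp_le)
  have t1: "t < 1" using t(2) \<alpha> t0 by (smt (verit) mult_pos_pos)
  define r where "r = \<alpha> * (1 - t)"
  define \<kappa> where "\<kappa> = ln r / ln \<alpha>"
  define C where "C = ln \<alpha> / ln ((1 + t) * \<alpha> + t)"
  define \<epsilon> where "\<epsilon> = t / (1 - r)"
  define e where "e = (x - z) /\<^sub>R R"
  have "0 < r" "r \<le> \<alpha>" using \<alpha> t0 t1 by (auto simp: r_def mult_le_cancel_left1)
  then have r: "0 < r" "r \<le> \<alpha>" "r < 1" using \<alpha> by auto
  have norm_e: "norm e = t" using t(1) R by (simp add: e_def dist_norm norm_minus_commute divide_inverse_commute)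
  have "ln r \<le> ln \<alpha>" "ln \<alpha> < 0" using r \<alpha> by auto
  then have \<kappa>1: "1 \<le> \<kappa>" by (simp add: \<kappa>_def le_divide_eq)
  then have \<kappa>: "0 < \<kappa>" by simp
  have \<alpha>\<kappa>: "\<alpha> powr \<kappa> = r" using \<alpha> r by (simp add: powr_def \<kappa>_def)
  have tr: "t < 1 - r"
  proof -
    have "0 < (1 - t) * (1 - \<alpha>)" using t1 \<alpha> by simp
    then show ?thesis by (simp add: r_def algebra_simps)
  qed
  have \<epsilon>: "\<epsilon> < 1" "0 \<le> \<epsilon>" using tr r t0 by (auto simp: \<epsilon>_def)
  have k1: "\<kappa> * (1 + \<epsilon>) \<le> C" and k2: "1 \<le> C * (\<kappa> * (1 - \<epsilon>))"
    using deformation_dilatation_le[OF \<alpha> t0 t(2)] unfolding \<kappa>_def C_def \<epsilon>_def r_def by auto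
  have C1: "1 \<le> C"
  proof -
    have "1 * 1 \<le> \<kappa> * (1 + \<epsilon>)" using \<kappa>1 \<epsilon> by (intro mult_mono) auto
    then show ?thesis using k1 by simp
  qed
  \<comment> \<open>\<open>unit_deformation\<close> in units of \<open>R\<close> about \<open>z\<close>; it is not differentiable on the spheres in \<open>N\<close>\<close>
  define s where "s = (\<lambda>y. (y - z) /\<^sub>R R)"
  define T where "T = (\<lambda>y. z + R *\<^sub>R unit_deformation \<kappa> r e (s y))"
  define N where "N = sphere z 0 \<union> sphere z R \<union> sphere z (\<alpha> * R)"
  have norm_s: "norm (s y) = dist y z / R" for y using R by (simp add: s_def dist_norm divide_inverse_commute)
  have s_N: "s y \<noteq> 0" "norm (s y) \<noteq> 1" "norm (s y) powr \<kappa> \<noteq> r" if "y \<notin> N" for y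
  proof -
    show "s y \<noteq> 0" using that R by (auto simp: s_def N_def)
    show "norm (s y) \<noteq> 1" using that R by (auto simp: norm_s N_def dist_commute)
    show "norm (s y) powr \<kappa> \<noteq> r"
    proof
      assume "norm (s y) powr \<kappa> = r"
      then have "norm (s y) powr \<kappa> = \<alpha> powr \<kappa>" using \<alpha>\<kappa> by simp
      then have "norm (s y) = \<alpha>"
        using powr_less_mono2[OF \<kappa>, of "norm (s y)" \<alpha>] powr_less_mono2[OF \<kappa>, of \<alpha> "norm (s y)"] \<alpha>
        by (metis less_irrefl linorder_neqE_linordered_idom norm_ge_zero order_less_imp_le)
      then show False using that R by (auto simp: norm_s N_def dist_commute)
    qed
  qed
  define c where "c = (\<lambda>y. deformation_factor \<kappa> (s y))"
  define q where "q = (\<lambda>y. sgn (s y))"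
  define p where "p = (\<lambda>y. deformation_vector \<kappa> r e (s y))"
  have sc: "continuous_on UNIV s" unfolding s_def by (intro continuous_intros)
  have Tc: "continuous_on UNIV T"
    unfolding T_def
    by (intro continuous_on_add continuous_on_scaleR continuous_on_const continuous_on_compose2[OF continuous_unit_deformation[OF \<kappa>] sc]) auto
  have T_out: "T y = y" if "R \<le> dist y z" for y
  proof -
    have "1 \<le> norm (s y)" using that R by (simp add: norm_s)
    moreover from this have "s y \<noteq> 0" by auto
    moreover from \<open>1 \<le> norm (s y)\<close> have "(1 - norm (s y)) / (1 - r) \<le> 0" using r by (intro divide_nonpos_pos) auto
    ultimately have "unit_deformation \<kappa> r e (s y) = s y"
      by (auto simp: unit_deformation_def radial_profile_ge_1 shift_profile_def max_absorb1 sgn_div_norm)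
    then show ?thesis using R by (simp add: T_def s_def)
  qed
  have der: "(T has_derivative (\<lambda>h. c y *\<^sub>R (h + (q y \<bullet> h) *\<^sub>R p y))) (at y)" if y: "y \<notin> N" for y
  proof -
    have RR: "R * (inverse R * v) = v" for v using R by simp
    have ds: "(s has_derivative (\<lambda>h. h /\<^sub>R R)) (at y)"
      unfolding s_def by (auto intro!: derivative_eq_intros)
    have "((\<lambda>y. unit_deformation \<kappa> r e (s y)) has_derivative
      (\<lambda>h. c y *\<^sub>R (h /\<^sub>R R + (q y \<bullet> (h /\<^sub>R R)) *\<^sub>R p y))) (at y)"
      using diff_chain_at[OF ds unit_deformation_has_derivative[OF \<kappa> r(1,3) s_N[OF y]]]
      by (simp add: o_def c_def q_def p_def)
    from has_derivative_add[OF has_derivative_const[of z] has_derivative_scaleR_right[OF this, of R]]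
    have "(T has_derivative (\<lambda>h. 0 + R *\<^sub>R (c y *\<^sub>R (h /\<^sub>R R + (q y \<bullet> (h /\<^sub>R R)) *\<^sub>R p y)))) (at y)"
      unfolding T_def .
    then show ?thesis
      by (rule has_derivative_eq_rhs) (simp add: fun_eq_iff algebra_simps RR)
  qed
  have c01: "0 \<le> c y" "c y \<le> 1" for y
  proof -
    show "0 \<le> c y" by (simp add: c_def deformation_factor_def)
    have "norm (s y) powr (\<kappa> - 1) \<le> 1" if "norm (s y) < 1"
      using that \<kappa>1 powr_mono2[of "\<kappa> - 1" "norm (s y)" 1] by simp
    then show "c y \<le> 1" by (simp add: c_def deformation_factor_def)
  qed
  have main: "norm (\<xi> + (p y \<bullet> \<xi>) *\<^sub>R q y) ^ ?n \<le> C ^ (?n - 1) * (1 + q y \<bullet> p y) * norm \<xi> ^ ?n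
      \<and> 0 < 1 + q y \<bullet> p y \<and> norm (\<xi> + (p y \<bullet> \<xi>) *\<^sub>R q y) \<le> C * norm \<xi>"
    if y: "y \<notin> N" for y \<xi>
  proof (cases "1 < norm (s y)")
    case True
    have "1 * norm \<xi> ^ ?n \<le> C ^ (?n - 1) * norm \<xi> ^ ?n"
      using C1 by (intro mult_right_mono one_le_power) auto
    moreover have "1 * norm \<xi> \<le> C * norm \<xi>" using C1 by (intro mult_right_mono) auto
    ultimately show ?thesis using True by (simp add: p_def deformation_vector_def)
  next
    case False
    define a where "a = (if norm (s y) powr \<kappa> < r then 0 else e /\<^sub>R (1 - r))"
    have pa: "p y = (\<kappa> - 1) *\<^sub>R q y - \<kappa> *\<^sub>R a" using False by (simp add: p_def deformation_vector_def q_def a_def)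
    have q1: "norm (q y) = 1" using s_N(1)[OF y] by (simp add: q_def norm_sgn)
    then have qq: "q y \<bullet> q y = 1" by (simp add: norm_eq_1)
    have a\<epsilon>: "norm a \<le> \<epsilon>" using r \<epsilon> norm_e by (simp add: a_def \<epsilon>_def divide_inverse_commute)
    note D = radial_shift_dilatation_square[OF q1 a\<epsilon> \<epsilon>(1) \<kappa> k1 k2]
    have J: "1 + q y \<bullet> p y = \<kappa> * (1 - a \<bullet> q y)"
      unfolding pa by (simp add: inner_diff_right qq inner_commute algebra_simps)
    have sq: "(norm (\<xi> + (p y \<bullet> \<xi>) *\<^sub>R q y))\<^sup>2 \<le> C * (\<kappa> * (1 - a \<bullet> q y)) * (norm \<xi>)\<^sup>2"
      using D(1)[of \<xi>] unfolding pa .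
    have "norm (\<xi> + (p y \<bullet> \<xi>) *\<^sub>R q y) \<le> C * norm \<xi>"
    proof (rule power2_le_imp_le)
      have "C * (\<kappa> * (1 - a \<bullet> q y)) * (norm \<xi>)\<^sup>2 \<le> C * C * (norm \<xi>)\<^sup>2"
        using D(3) C1 by (intro mult_right_mono mult_left_mono) auto
      also have "C * C * (norm \<xi>)\<^sup>2 = (C * norm \<xi>)\<^sup>2" by (simp add: power2_eq_square mult_ac)
      finally show "(norm (\<xi> + (p y \<bullet> \<xi>) *\<^sub>R q y))\<^sup>2 \<le> (C * norm \<xi>)\<^sup>2" using sq by linarith
    qed (use C1 in auto)
    moreover have "norm (\<xi> + (p y \<bullet> \<xi>) *\<^sub>R q y) ^ ?n \<le> C ^ (?n - 1) * (\<kappa> * (1 - a \<bullet> q y)) * norm \<xi> ^ ?n"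
      by (rule power_dilatation_of_square[OF sq D(2,3) _ _ n]) auto
    ultimately show ?thesis unfolding J using D(2) by blast
  qed
  have "condenser_cap G (cball z (\<alpha> * R)) \<le> ennreal (C ^ (?n - 1)) * condenser_cap G (cball x (\<alpha> * ((1 - t) * R)))"
  proof (rule condenser_cap_transport[OF G(1) Tc])
    show "closed N" unfolding N_def by (intro closed_Un closed_sphere)
    show "negligible N" unfolding N_def by (intro negligible_Un negligible_sphere)
    show "finite {t. line_point i y t \<in> N}" if "i \<in> Basis" for i y
    proof -
      have "{t. line_point i y t \<in> N} = {t. line_point i y t \<in> sphere z 0} \<union> {t. line_point i y t \<in> sphere z R} \<union> {t. line_point i y t \<in> sphere z (\<alpha> * R)}"
        unfolding N_def by blast
      then show ?thesis by (simp only: finite_Un finite_line_sphere[OF that])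
    qed
    show "inj_on T (- N)"
    proof (rule inj_onI)
      fix y y' assume "T y = T y'"
      then have "unit_deformation \<kappa> r e (s y) = unit_deformation \<kappa> r e (s y')" using R by (simp add: T_def)
      then have "s y = s y'" using inj_unit_deformation[OF \<kappa> r(3)] norm_e tr by (auto dest: injD)
      then show "y = y'" using R by (simp add: s_def)
    qed
    show "(T has_derivative (\<lambda>h. c y *\<^sub>R (h + (q y \<bullet> h) *\<^sub>R p y))) (at y)" if "y \<notin> N" for y by (rule der[OF that])
    show "compact (T -` D) \<and> T -` D \<subseteq> G" if D: "compact D" "D \<subseteq> G" for D
    proof
      have sub: "T -` D \<subseteq> D \<union> ball z R"
      proof
        fix y assume "y \<in> T -` D"
        then show "y \<in> D \<union> ball z R" using T_out[of y] by (cases "dist y z < R") (auto simp: dist_commute)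
      qed
      then show "T -` D \<subseteq> G" using D(2) G(2) by blast
      have "closed (T -` D)" by (rule closed_vimage[OF compact_imp_closed[OF D(1)] Tc])
      moreover have "bounded (T -` D)"
        by (rule bounded_subset[OF _ sub]) (use D(1) in \<open>auto simp: compact_imp_bounded\<close>)
      ultimately show "compact (T -` D)" by (simp add: compact_eq_bounded_closed)
    qed
    show "T y \<in> cball x (\<alpha> * ((1 - t) * R))" if "y \<in> cball z (\<alpha> * R)" for y
    proof -
      have ny: "norm (s y) \<le> \<alpha>" using that R by (simp add: norm_s dist_commute divide_le_eq)
      let ?g = "radial_profile \<kappa> (norm (s y))"
      have g: "?g = norm (s y) powr \<kappa>" using ny \<alpha> by (intro radial_profile_le_1) simp
      have "?g \<le> r" unfolding g \<alpha>\<kappa>[symmetric] using ny \<kappa> by (intro powr_mono2) auto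
      then have "1 \<le> (1 - ?g) / (1 - r)" using r by (simp add: le_divide_eq)
      then have m: "shift_profile r ?g = 1" by (simp add: shift_profile_def)
      have "T y = x + R *\<^sub>R (?g *\<^sub>R sgn (s y))"
        unfolding T_def unit_deformation_def m using R by (simp add: e_def algebra_simps)
      then have "dist x (T y) = R * norm (?g *\<^sub>R sgn (s y))" using R by (simp add: dist_norm abs_mult)
      also have "\<dots> \<le> R * r"
        using \<open>?g \<le> r\<close> R r radial_profile_nonneg[of \<kappa> "norm (s y)"] by (intro mult_left_mono) (auto simp: norm_sgn)
      finally show ?thesis by (simp add: r_def mult_ac)
    qed
    show "norm (c y *\<^sub>R (\<xi> + (p y \<bullet> \<xi>) *\<^sub>R q y)) ^ ?n \<le> C ^ (?n - 1) * \<bar>c y ^ ?n * (1 + q y \<bullet> p y)\<bar> * norm \<xi> ^ ?n"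
      if "y \<notin> N" for y \<xi>
    proof -
      have "norm (c y *\<^sub>R (\<xi> + (p y \<bullet> \<xi>) *\<^sub>R q y)) ^ ?n = c y ^ ?n * norm (\<xi> + (p y \<bullet> \<xi>) *\<^sub>R q y) ^ ?n"
        using c01(1)[of y] by (simp add: power_mult_distrib)
      also have "\<dots> \<le> c y ^ ?n * (C ^ (?n - 1) * (1 + q y \<bullet> p y) * norm \<xi> ^ ?n)"
        using main[OF that, of \<xi>] c01(1)[of y] by (intro mult_left_mono) auto
      also have "\<dots> = C ^ (?n - 1) * \<bar>c y ^ ?n * (1 + q y \<bullet> p y)\<bar> * norm \<xi> ^ ?n"
        using main[OF that, of \<xi>] c01(1)[of y] by (simp add: abs_mult)
      finally show ?thesis .
    qed
    show "norm (c y *\<^sub>R (\<xi> + (p y \<bullet> \<xi>) *\<^sub>R q y)) \<le> C * norm \<xi>" if "y \<notin> N" for y \<xi>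
    proof -
      have "norm (c y *\<^sub>R (\<xi> + (p y \<bullet> \<xi>) *\<^sub>R q y)) \<le> 1 * norm (\<xi> + (p y \<bullet> \<xi>) *\<^sub>R q y)"
        unfolding norm_scaleR using c01[of y] by (intro mult_right_mono) auto
      then show ?thesis using main[OF that, of \<xi>] by linarith
    qed
  qed (use C1 in auto)
  then show ?thesis unfolding C_def .
qed

lemma condenser_cap_cball_finite:
  fixes G :: "'a::euclidean_space set"
  assumes "0 \<le> \<rho>" "\<rho> < \<rho>'" "cball z \<rho>' \<subseteq> G"
  shows "condenser_cap G (cball z \<rho>) < \<infinity>"
proof -
  define m where "m = (1 - \<rho>\<^sup>2 / \<rho>'\<^sup>2)\<^sup>2"
  have \<rho>': "0 < \<rho>'" using assms by simp
  have quot: "0 < 1 - \<rho>\<^sup>2 / \<rho>'\<^sup>2" using assms \<rho>' by (simp add: power_strict_mono)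
  then have m: "0 < m" unfolding m_def by (rule zero_less_power)
  define u where "u = (\<lambda>y. bump \<rho>' (y - z) / m)"
  define U where "U = (\<lambda>y. grad_bump \<rho>' (y - z) /\<^sub>R m)"
  have sub: "{x. u x \<noteq> 0} \<subseteq> cball z \<rho>'"
    using bump_eq_0[OF \<rho>'] by (force simp: u_def dist_norm norm_minus_commute)
  then have cl: "closure {x. u x \<noteq> 0} \<subseteq> cball z \<rho>'" by (rule closure_minimal) simp
  have cU: "continuous_on UNIV U"
    unfolding U_def by (intro continuous_intros continuous_on_compose2[OF continuous_on_grad_bump[of UNIV]]) auto
  have U0: "U x = 0" if "x \<notin> cball z \<rho>'" for x
    using grad_bump_eq_0[OF \<rho>', of "x - z"] that by (simp add: U_def dist_norm norm_minus_commute)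
  have der: "(u has_derivative (\<lambda>h. U y \<bullet> h)) (at y)" for y
  proof -
    have "((\<lambda>y. y - z) has_derivative (\<lambda>h. h)) (at y)" by (auto intro!: derivative_eq_intros)
    from diff_chain_at[OF this bump_has_derivative]
    have "((\<lambda>y. bump \<rho>' (y - z)) has_derivative (\<lambda>h. grad_bump \<rho>' (y - z) \<bullet> h)) (at y)" by (simp add: o_def)
    from has_derivative_mult_right[OF this, of "inverse m"]
    show ?thesis unfolding u_def U_def by (simp add: divide_inverse mult.commute)
  qed
  have "bounded (U ` cball z \<rho>')" by (intro compact_imp_bounded compact_continuous_image continuous_on_subset[OF cU]) auto
  then obtain B0 where B0: "\<forall>y\<in>cball z \<rho>'. norm (U y) \<le> B0" unfolding bounded_iff by auto
  have B: "norm (U y) \<le> max B0 0" for y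
  proof (cases "y \<in> cball z \<rho>'")
    case True
    then show ?thesis using B0 by (simp add: le_max_iff_disj)
  next
    case False
    then show ?thesis using U0[of y] by simp
  qed
  have "condenser_cap G (cball z \<rho>) \<le> (\<integral>\<^sup>+x\<in>-{}. ennreal (norm (U x) ^ DIM('a)) \<partial>lebesgue)"
  proof (rule piecewise_C1_admissible(2)[where u = u and B = "max B0 0"])
    show "continuous_on UNIV u" using der by (meson continuous_at_imp_continuous_on has_derivative_continuous)
    show "compact (closure {x. u x \<noteq> 0})"
      using closed_Int_compact[OF closed_closure compact_cball, of "{x. u x \<noteq> 0}" z \<rho>'] cl by (simp add: Int_absorb2)
    show "closure {x. u x \<noteq> 0} \<subseteq> G" using cl assms(3) by blast
    show "0 \<le> u x" for x using m by (simp add: u_def bump_nonneg)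
    show "1 \<le> u x" if "x \<in> cball z \<rho>" for x
    proof -
      have "(norm (x - z))\<^sup>2 \<le> \<rho>\<^sup>2" using that by (intro power_mono) (auto simp: dist_norm norm_minus_commute)
      then have "1 - \<rho>\<^sup>2 / \<rho>'\<^sup>2 \<le> max 0 (1 - (norm (x - z))\<^sup>2 / \<rho>'\<^sup>2)"
        using \<rho>' by (simp add: le_max_iff_disj divide_right_mono)
      then have "m \<le> bump \<rho>' (x - z)" unfolding m_def bump_def using quot by (intro power_mono) auto
      then show ?thesis using m by (simp add: u_def)
    qed
  qed (use der B in auto)
  also have "\<dots> = (\<integral>\<^sup>+x. ennreal (norm (U x) ^ DIM('a)) \<partial>lborel)"
    by (simp add: nn_integral_completion)
  also have "\<dots> < \<infinity>"
  proof -
    have "integrable lborel (\<lambda>x. norm (U x) ^ DIM('a))"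
      by (rule integrable_continuous_compact_support[OF _ compact_cball[of z \<rho>']])
         (intro continuous_on_power continuous_on_norm cU, simp add: U0 zero_power)
    then show ?thesis unfolding integrable_iff_bounded by simp
  qed
  finally show ?thesis .
qed

section \<open>Inversion of the boundary\<close>

definition unit_inversion :: "'a::euclidean_space \<Rightarrow> 'a \<Rightarrow> 'a" where
  "unit_inversion z y = z + (y - z) /\<^sub>R (norm (y - z))\<^sup>2"

lemma unit_inversion_neq: "y \<noteq> z \<Longrightarrow> unit_inversion z y \<noteq> z"
  by (simp add: unit_inversion_def)

lemma norm_unit_inversion: "norm (unit_inversion z y - z) = inverse (norm (y - z))"
  by (cases "y = z") (simp_all add: unit_inversion_def power2_eq_square)

lemma unit_inversion_involution: "y \<noteq> z \<Longrightarrow> unit_inversion z (unit_inversion z y) = y"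
proof -
  assume "y \<noteq> z"
  have "unit_inversion z (unit_inversion z y) = z + (unit_inversion z y - z) /\<^sub>R (inverse (norm (y - z)))\<^sup>2"
    by (simp add: unit_inversion_def[of z "unit_inversion z y"] norm_unit_inversion)
  also have "\<dots> = z + ((norm (y - z))\<^sup>2 * inverse ((norm (y - z))\<^sup>2)) *\<^sub>R (y - z)"
    by (simp add: unit_inversion_def power_inverse)
  also have "\<dots> = y" using \<open>y \<noteq> z\<close> by simp
  finally show ?thesis .
qed

lemma unit_inversion_has_derivative:
  fixes y z :: "'a::euclidean_space"
  assumes "y \<noteq> z"
  shows "(unit_inversion z has_derivative (\<lambda>h. inverse ((norm (y - z))\<^sup>2) *\<^sub>R
     (h + (sgn (y - z) \<bullet> h) *\<^sub>R (- 2 *\<^sub>R sgn (y - z))))) (at y)"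
proof -
  have "y - z \<noteq> 0" using assms by simp
  have ds: "((\<lambda>y. y - z) has_derivative (\<lambda>h. h)) (at y)" by (auto intro!: derivative_eq_intros)
  have pw: "norm v powr (-2) = inverse ((norm v)\<^sup>2)" if "v \<noteq> 0" for v :: 'a
    using that by (simp add: powr_minus)
  have "((\<lambda>y. norm (y - z) powr (-2) *\<^sub>R (y - z)) has_derivative
      (\<lambda>h. norm (y - z) powr (-2) *\<^sub>R (h + (sgn (y - z) \<bullet> h) *\<^sub>R (- 2 *\<^sub>R sgn (y - z))))) (at y)"
    using diff_chain_at[OF ds power_map_has_derivative[OF \<open>y - z \<noteq> 0\<close>, of "-2"]] by (simp add: o_def)
  from has_derivative_add[OF has_derivative_const[of z] this]
  have d: "((\<lambda>y. z + norm (y - z) powr (-2) *\<^sub>R (y - z)) has_derivative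
      (\<lambda>h. norm (y - z) powr (-2) *\<^sub>R (h + (sgn (y - z) \<bullet> h) *\<^sub>R (- 2 *\<^sub>R sgn (y - z))))) (at y)" by simp
  have eq: "z + norm (x - z) powr (-2) *\<^sub>R (x - z) = unit_inversion z x" if "x \<in> - {z}" for x
    using that pw[of "x - z"] by (simp add: unit_inversion_def)
  have "open (- {z})" "y \<in> - {z}" using assms by auto
  from has_derivative_transform_within_open[OF d this eq] show ?thesis
    using pw[OF \<open>y - z \<noteq> 0\<close>] by simp
qed

lemma isCont_unit_inversion: "y \<noteq> z \<Longrightarrow> isCont (unit_inversion z) y"
  using has_derivative_continuous[OF unit_inversion_has_derivative] .

lemma closure_unit_inversion:
  assumes "y \<noteq> z" "y \<in> closure {x. x \<noteq> z \<and> unit_inversion z x \<in> S}"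
  shows "unit_inversion z y \<in> closure S"
proof -
  obtain f where f: "\<And>n. f n \<noteq> z \<and> unit_inversion z (f n) \<in> S" "f \<longlonglongrightarrow> y"
    using assms(2) unfolding closure_sequential by auto
  have "(\<lambda>n. unit_inversion z (f n)) \<longlonglongrightarrow> unit_inversion z y"
    by (rule isCont_tendsto_compose[OF isCont_unit_inversion[OF assms(1)] f(2)])
  then show ?thesis using f(1) unfolding closure_sequential by (intro exI[of _ "\<lambda>n. unit_inversion z (f n)"]) blast
qed

text \<open>The derivative of an inversion is a multiple of this reflection, which makes the inversion conformal.\<close>

lemma norm_reflection:
  fixes \<omega> \<xi> :: "'a::euclidean_space"
  assumes "norm \<omega> = 1"
  shows "norm (\<xi> + ((- 2 *\<^sub>R \<omega>) \<bullet> \<xi>) *\<^sub>R \<omega>) = norm \<xi>"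
proof -
  have "\<omega> \<bullet> \<omega> = 1" using assms by (simp add: norm_eq_1)
  then have "(\<xi> + ((- 2 *\<^sub>R \<omega>) \<bullet> \<xi>) *\<^sub>R \<omega>) \<bullet> (\<xi> + ((- 2 *\<^sub>R \<omega>) \<bullet> \<xi>) *\<^sub>R \<omega>) = \<xi> \<bullet> \<xi>"
    by (simp add: inner_add_left inner_add_right inner_commute algebra_simps)
  then show ?thesis by (simp add: norm_eq_sqrt_inner)
qed

text \<open>A test function \<open>w\<close> for the ball, inverted and turned upside down, is a test function for the image of
  the complement of \<open>G\<close>; the inversion preserves energies.\<close>

lemma condenser_cap_inverted_frontier_zero:
  fixes G :: "'a::euclidean_space set"
  assumes G: "open G" and \<rho>: "0 < \<rho>" and cap0: "condenser_cap G (cball z \<rho>) = 0"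
    and F: "\<And>y. y \<in> F \<Longrightarrow> y \<noteq> z \<Longrightarrow> unit_inversion z y \<notin> G"
  shows "condenser_cap (ball z (2 / \<rho>)) F = 0"
proof -
  let ?n = "DIM('a)" and ?i = "unit_inversion z"
  have step: "condenser_cap (ball z (2 / \<rho>)) F \<le> ennreal (2 ^ ?n) * c0" if c0: "0 < c0" for c0
  proof -
    have "condenser_cap G (cball z \<rho>) < c0" using cap0 c0 by simp
    then obtain w W where w: "\<And>x. (w has_derivative (\<lambda>h. W x \<bullet> h)) (at x)" "continuous_on UNIV W"
      "\<And>x. 0 \<le> w x" "\<And>x. x \<in> cball z \<rho> \<Longrightarrow> 1 \<le> w x" "compact (closure {x. w x \<noteq> 0})" "closure {x. w x \<noteq> 0} \<subseteq> G"
      "(\<integral>\<^sup>+x. ennreal (norm (W x) ^ ?n) \<partial>lborel) < c0"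
      using condenser_smooth_test_function[OF G] by metis
    let ?K = "closure {x. w x \<noteq> 0}"
    have wc: "continuous_on UNIV w" using w(1) by (meson continuous_at_imp_continuous_on has_derivative_continuous)
    have w0: "w x = 0" if "x \<notin> ?K" for x using that closure_subset[of "{x. w x \<noteq> 0}"] by auto
    have W0: "W x = 0" if "x \<notin> ?K" for x using gradient_eq_0_off_support[OF w(1) that] .
    obtain M where M0: "0 \<le> M" and M: "\<And>y. norm (W y) \<le> M"
      using gradient_bounded_compact_support[OF w(1,2,5)] by metis
    have "bounded ((\<lambda>y. y - z) ` ?K)"
      by (intro compact_imp_bounded compact_continuous_image continuous_intros w(5))
    then obtain L0 where "\<forall>y\<in>?K. norm (y - z) \<le> L0" unfolding bounded_iff by auto
    then obtain L where L: "0 < L" "\<And>y. y \<in> ?K \<Longrightarrow> norm (y - z) \<le> L"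
      by (metis le_max_iff_disj max.strict_coboundedI1 zero_less_one max.commute)
    have near: "?i y \<notin> ?K" if "y \<noteq> z" "norm (y - z) < inverse L" for y
    proof
      assume "?i y \<in> ?K"
      then have "inverse (norm (y - z)) \<le> L" using L(2) norm_unit_inversion[of z y] by metis
      moreover have "inverse (inverse L) < inverse (norm (y - z))" using that by (intro less_imp_inverse_less) auto
      ultimately show False by simp
    qed
    \<comment> \<open>Near \<open>z\<close> the inverted points leave the support of \<open>w\<close>, so \<open>u\<close> is constant there and the centre causes no
      singularity; the square makes the truncation \<open>C\<^sup>1\<close>.\<close>
    define u where "u = (\<lambda>y. if y = z then 1 else (max 0 (1 - w (?i y)))\<^sup>2)"
    define c where "c = (\<lambda>y. inverse ((norm (y - z))\<^sup>2))"
    define q where "q = (\<lambda>y. sgn (y - z))"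
    define p where "p = (\<lambda>y. - 2 *\<^sub>R sgn (y - z))"
    define b where "b = (\<lambda>y. - 2 * max 0 (1 - w (?i y)))"
    define U where "U = (\<lambda>y. b y *\<^sub>R (c y *\<^sub>R (W (?i y) + (p y \<bullet> W (?i y)) *\<^sub>R q y)))"
    have b2: "\<bar>b y\<bar> \<le> 2" for y using w(3)[of "?i y"] by (simp add: b_def max_def)
    have u_near: "u y = 1" if "norm (y - z) < inverse L" for y
      using near[of y] w0[of "?i y"] that by (simp add: u_def)
    have der: "(u has_derivative (\<lambda>h. U y \<bullet> h)) (at y)" if y: "y \<noteq> z" for y
    proof -
      have 1: "((\<lambda>x. 1 - w x) has_derivative (\<lambda>h. - (W x \<bullet> h))) (at x)" for x
        using has_derivative_diff[OF has_derivative_const[of 1] w(1)[of x]] by simp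
      have 2: "((\<lambda>x. (max 0 (1 - w x))\<^sup>2) has_derivative (\<lambda>h. 2 * max 0 (1 - w x) * - (W x \<bullet> h))) (at x)" for x
        using diff_chain_at[OF 1[of x] max_0_squared_has_derivative[unfolded has_field_derivative_def]] by (simp add: o_def)
      have 3: "((\<lambda>y. (max 0 (1 - w (?i y)))\<^sup>2) has_derivative
         (\<lambda>h. 2 * max 0 (1 - w (?i y)) * - (W (?i y) \<bullet> (c y *\<^sub>R (h + (q y \<bullet> h) *\<^sub>R p y))))) (at y)"
        using diff_chain_at[OF unit_inversion_has_derivative[OF y] 2] unfolding c_def q_def p_def by (simp add: o_def)
      have 4: "2 * max 0 (1 - w (?i y)) * - (W (?i y) \<bullet> (c y *\<^sub>R (h + (q y \<bullet> h) *\<^sub>R p y))) = U y \<bullet> h" for h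
        unfolding U_def b_def by (simp add: inner_add_right inner_add_left inner_commute algebra_simps)
      have o: "open (- {z})" "y \<in> - {z}" using y by auto
      have eq: "(max 0 (1 - w (?i x)))\<^sup>2 = u x" if "x \<in> - {z}" for x using that by (simp add: u_def)
      from has_derivative_transform_within_open[OF 3[unfolded 4] o eq] show ?thesis .
    qed
    have uc: "continuous_on UNIV u"
      unfolding continuous_on_eq_continuous_at[OF open_UNIV]
    proof
      fix y
      show "isCont u y"
      proof (cases "y = z")
        case True
        have "\<forall>\<^sub>F x in nhds z. u x = 1"
          unfolding eventually_nhds_metric using u_near L(1) by (intro exI[of _ "inverse L"]) (auto simp: dist_norm)
        then show ?thesis unfolding True by (simp add: isCont_cong)
      next
        case False
        then show ?thesis using der has_derivative_continuous by blast
      qed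
    qed
    have q1: "norm (q y) = 1" if "y \<noteq> z" for y using that by (simp add: q_def norm_sgn)
    have norm_refl: "norm (W (?i y) + (p y \<bullet> W (?i y)) *\<^sub>R q y) = norm (W (?i y))" if "y \<noteq> z" for y
      using norm_reflection[OF q1[OF that]] unfolding p_def q_def by simp
    have c0': "0 \<le> c y" for y by (simp add: c_def)
    have normU: "norm (U y) = \<bar>b y\<bar> * (c y * norm (W (?i y)))" if "y \<noteq> z" for y
      using norm_refl[OF that] c0'[of y] by (simp add: U_def abs_mult)
    have sub: "{y. u y \<noteq> 0} \<subseteq> cball z (1 / \<rho>)"
    proof
      fix y assume y: "y \<in> {y. u y \<noteq> 0}"
      show "y \<in> cball z (1 / \<rho>)"
      proof (cases "y = z")
        case False
        then have "w (?i y) < 1" using y by (auto simp: u_def max_def split: if_splits)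
        then have "?i y \<notin> cball z \<rho>" using w(4)[of "?i y"] by fastforce
        then have "\<rho> < inverse (norm (y - z))"
          using norm_unit_inversion[of z y] by (simp add: dist_norm norm_minus_commute)
        then have "inverse (inverse (norm (y - z))) < inverse \<rho>" using \<rho> by (rule less_imp_inverse_less)
        then show ?thesis by (simp add: dist_norm norm_minus_commute inverse_eq_divide)
      qed (use \<rho> in simp)
    qed
    then have cl: "closure {y. u y \<noteq> 0} \<subseteq> cball z (1 / \<rho>)" by (rule closure_minimal) simp
    have "condenser_cap (ball z (2 / \<rho>)) F \<le> (\<integral>\<^sup>+y\<in>-{z}. ennreal (norm (U y) ^ ?n) \<partial>lebesgue)"
    proof (rule piecewise_C1_admissible(2)[OF uc, where B = "2 * (L\<^sup>2 * M)"])
      show "finite {t. line_point i y t \<in> {z}}" if "i \<in> Basis" for i y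
        using finite_line_sphere[OF that, of y z 0] by simp
      show "(u has_derivative (\<lambda>h. U y \<bullet> h)) (at y)" if "y \<notin> {z}" for y using der that by simp
      show "norm (U y) \<le> 2 * (L\<^sup>2 * M)" if "y \<notin> {z}" for y
      proof (cases "norm (y - z) < inverse L")
        case True
        then have "W (?i y) = 0" using near W0 that by simp
        then show ?thesis using normU that M0 by simp
      next
        case False
        then have "(inverse L)\<^sup>2 \<le> (norm (y - z))\<^sup>2" using L by (intro power_mono) auto
        then have "c y \<le> inverse ((inverse L)\<^sup>2)" unfolding c_def using L by (intro le_imp_inverse_le) auto
        then have "c y \<le> L\<^sup>2" by (simp add: power_inverse)
        then have "c y * norm (W (?i y)) \<le> L\<^sup>2 * M" using M c0' by (intro mult_mono) auto
        then show ?thesis using normU[of y] that b2[of y] c0'[of y] by (auto intro!: mult_mono)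
      qed
      show "compact (closure {y. u y \<noteq> 0})"
        using closed_Int_compact[OF closed_closure compact_cball, of "{y. u y \<noteq> 0}" z "1/\<rho>"] cl by (simp add: Int_absorb2)
      have "cball z (1 / \<rho>) \<subseteq> ball z (2 / \<rho>)" using \<rho> by (auto simp: divide_strict_right_mono le_less_trans)
      then show "closure {y. u y \<noteq> 0} \<subseteq> ball z (2 / \<rho>)" using cl by blast
      show "0 \<le> u y" for y by (simp add: u_def)
      show "1 \<le> u y" if "y \<in> F" for y
      proof (cases "y = z")
        case False
        then have "?i y \<notin> ?K" using F[OF that] w(6) by blast
        from w0[OF this] show ?thesis by (simp add: u_def)
      qed (simp add: u_def)
    qed auto
    also have "\<dots> \<le> (\<integral>\<^sup>+y\<in>-{z}. ennreal (\<bar>c y ^ ?n * (1 + q y \<bullet> p y)\<bar> * (2 ^ ?n * norm (W (?i y)) ^ ?n)) \<partial>lebesgue)"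
    proof (intro nn_integral_mono)
      fix y
      show "ennreal (norm (U y) ^ ?n) * indicator (- {z}) y \<le>
        ennreal (\<bar>c y ^ ?n * (1 + q y \<bullet> p y)\<bar> * (2 ^ ?n * norm (W (?i y)) ^ ?n)) * indicator (- {z}) y"
      proof (cases "y = z")
        case False
        have "q y \<bullet> p y = - 2" using q1[OF False] unfolding p_def q_def by (simp add: norm_eq_1)
        then have J: "\<bar>c y ^ ?n * (1 + q y \<bullet> p y)\<bar> = c y ^ ?n" using c0'[of y] by (simp add: abs_mult)
        have "norm (U y) ^ ?n \<le> (2 * (c y * norm (W (?i y)))) ^ ?n"
          unfolding normU[OF False] using b2[of y] c0'[of y] by (intro power_mono mult_right_mono) auto
        also have "\<dots> = c y ^ ?n * (2 ^ ?n * norm (W (?i y)) ^ ?n)" by (simp add: power_mult_distrib)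
        finally show ?thesis using False unfolding J by (auto intro!: ennreal_leI)
      qed simp
    qed
    also have "\<dots> \<le> (\<integral>\<^sup>+x. ennreal (2 ^ ?n * norm (W x) ^ ?n) \<partial>lebesgue)"
    proof (rule nn_integral_substitution_le)
      show "inj_on ?i (- {z})" by (rule inj_on_inverseI[of _ ?i]) (simp add: unit_inversion_involution)
      show "(?i has_derivative (\<lambda>h. c y *\<^sub>R (h + (q y \<bullet> h) *\<^sub>R p y))) (at y)" if "y \<in> - {z}" for y
        using unit_inversion_has_derivative[of y z] that unfolding c_def q_def p_def by simp
      show "continuous_on UNIV (\<lambda>x. 2 ^ ?n * norm (W x) ^ ?n)" by (intro continuous_intros w(2))
      show "2 ^ ?n * norm (W x) ^ ?n = 0" if "x \<notin> ?K" for x using W0[OF that] by (simp add: zero_power)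
    qed (use w(5) in auto)
    also have "\<dots> = (\<integral>\<^sup>+x. ennreal (2 ^ ?n) * ennreal (norm (W x) ^ ?n) \<partial>lborel)"
      by (simp add: nn_integral_completion ennreal_mult)
    also have "\<dots> = ennreal (2 ^ ?n) * (\<integral>\<^sup>+x. ennreal (norm (W x) ^ ?n) \<partial>lborel)"
    proof (rule nn_integral_cmult)
      show "(\<lambda>x. ennreal (norm (W x) ^ ?n)) \<in> borel_measurable lborel"
        using borel_measurable_continuous_onI[OF w(2)] by simp
    qed
    also have "\<dots> \<le> ennreal (2 ^ ?n) * c0" using w(7) by (intro mult_left_mono) auto
    finally show ?thesis .
  qed
  have "condenser_cap (ball z (2 / \<rho>)) F \<le> 0"
  proof (rule ennreal_le_epsilon)
    fix e :: real assume "0 < e"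
    then have "condenser_cap (ball z (2 / \<rho>)) F \<le> ennreal (2 ^ ?n) * ennreal (e / 2 ^ ?n)"
      by (intro step) simp
    also have "\<dots> = ennreal e" using \<open>0 < e\<close> by (simp add: ennreal_mult[symmetric])
    finally show "condenser_cap (ball z (2 / \<rho>)) F \<le> 0 + ennreal e" by simp
  qed
  then show ?thesis by simp
qed

lemma Some_in_ext_boundary:
  assumes "open G"
  shows "Some x \<in> ext_boundary G \<longleftrightarrow> x \<in> frontier G"
proof -
  have int: "extended_space interior_of (Some ` G) = Some ` G"
    by (rule interior_of_openin) (use assms in simp)
  have "Some x \<in> extended_space closure_of (Some ` G) \<longleftrightarrow> x \<in> closure G"
  proof
    assume L: "Some x \<in> extended_space closure_of (Some ` G)"
    show "x \<in> closure G"
    proof (rule ccontr)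
      assume "x \<notin> closure G"
      then have "Some x \<in> Some ` (- closure G)" "openin extended_space (Some ` (- closure G))"
        by auto
      then obtain y where "y \<in> Some ` G" "y \<in> Some ` (- closure G)"
        using L[unfolded in_closure_of, THEN conjunct2, rule_format, of "Some ` (- closure G)"] by blast
      then show False using closure_subset by blast
    qed
  next
    assume R: "x \<in> closure G"
    show "Some x \<in> extended_space closure_of (Some ` G)"
      unfolding in_closure_of
    proof (intro conjI allI impI)
      fix V assume V: "Some x \<in> V \<and> openin extended_space V"
      have "open {y. Some y \<in> V}"
      proof -
        from V have "openin extended_space V" by blast
        then show ?thesis
          unfolding openin_Alexandroff_compactification
        proof (elim disjE exE conjE)
          fix U assume "openin euclidean U" "V = Some ` U"
          then have "{y. Some y \<in> V} = U" "open U" by auto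
          then show ?thesis by simp
        next
          fix C assume "closedin euclidean C" "V = insert None (Some ` (topspace euclidean - C))"
          then have "{y. Some y \<in> V} = - C" "closed C" by auto
          then show ?thesis by auto
        qed
      qed
      then obtain y where "y \<in> G" "Some y \<in> V"
        using R V open_Int_closure_eq_empty[of "{y. Some y \<in> V}" G] by auto
      then show "\<exists>y. y \<in> Some ` G \<and> y \<in> V" by blast
    qed simp
  qed
  then show ?thesis
    unfolding ext_boundary_def frontier_of_def int frontier_def interior_open[OF assms] by auto
qed

lemma None_in_ext_boundary:
  assumes "open (G :: 'a::euclidean_space set)"
  shows "None \<in> ext_boundary G \<longleftrightarrow> \<not> bounded G"
proof -
  have int: "extended_space interior_of (Some ` G) = Some ` G"
    by (rule interior_of_openin) (use assms in simp)
  have "None \<in> extended_space closure_of (Some ` G) \<longleftrightarrow> \<not> bounded G"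
  proof
    assume L: "None \<in> extended_space closure_of (Some ` G)"
    show "\<not> bounded G"
    proof
      assume "bounded G"
      then have C: "compact (closure G)" by simp
      have "openin extended_space (insert None (Some ` (topspace euclidean - closure G)))"
        unfolding openin_Alexandroff_compactification
        using C by (intro disjI2 exI[of _ "closure G"]) auto
      then obtain y where "y \<in> Some ` G" "y \<in> insert None (Some ` (topspace euclidean - closure G))"
        using L unfolding in_closure_of by blast
      then show False using closure_subset by blast
    qed
  next
    assume R: "\<not> bounded G"
    show "None \<in> extended_space closure_of (Some ` G)"
      unfolding in_closure_of
    proof (intro conjI allI impI)
      fix V :: "'a option set" assume V: "None \<in> V \<and> openin extended_space V"
      then obtain C where C: "compact C" "V = insert None (Some ` (UNIV - C))"
        unfolding openin_Alexandroff_compactification by auto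
      have "\<not> G \<subseteq> C" using R C(1) bounded_subset compact_imp_bounded by blast
      then show "\<exists>y. y \<in> Some ` G \<and> y \<in> V" using C(2) by blast
    qed simp
  qed
  then show ?thesis
    unfolding ext_boundary_def frontier_of_def int by auto
qed

text \<open>The inversion about \<open>z\<close> is a Moebius map that carries the extended boundary, including \<open>\<infinity>\<close> when \<open>G\<close> is
  unbounded, to a compact set in the space, to which \<open>condenser_cap_inverted_frontier_zero\<close> applies.\<close>

lemma ext_capacity_zero_if_cball:
  fixes G :: "'a::euclidean_space set"
  assumes G: "open G" and \<rho>: "0 < \<rho>" "cball z \<rho> \<subseteq> G" and cap0: "condenser_cap G (cball z \<rho>) = 0"
    and comp: "compactin extended_space (ext_boundary G)"
  shows "ext_capacity_zero (ext_boundary G)"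
proof -
  let ?i = "unit_inversion z"
  define H where "H = {y. y \<noteq> z \<and> ?i y \<in> G}"
  define F where "F = frontier H"
  have zG: "z \<in> G" using \<rho> by auto
  have H_open: "open H"
  proof -
    have "continuous_on (- {z}) ?i"
      by (rule continuous_at_imp_continuous_on) (use isCont_unit_inversion in auto)
    then have "open (- {z} \<inter> ?i -` G)" by (rule continuous_open_preimage) (use G in auto)
    moreover have "H = - {z} \<inter> ?i -` G" unfolding H_def by auto
    ultimately show ?thesis by simp
  qed
  have F_eq: "F = closure H - H" unfolding F_def frontier_def interior_open[OF H_open] ..
  have F_iff: "y \<in> F \<longleftrightarrow> ?i y \<in> frontier G" if y: "y \<noteq> z" for y
  proof -
    have "y \<in> closure H \<longleftrightarrow> ?i y \<in> closure G"
    proof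
      show "y \<in> closure H \<Longrightarrow> ?i y \<in> closure G" using closure_unit_inversion[OF y] unfolding H_def .
      assume "?i y \<in> closure G"
      moreover have "closure G = closure (G - {z})"
      proof -
        have "closure (G - {z}) = closure G"
        proof (rule antisym)
          show "closure (G - {z}) \<subseteq> closure G" by (rule closure_mono) auto
          have "z \<in> closure (G - {z})"
            using zG G by (simp add: islimpt_in_closure[symmetric] interior_limit_point interior_open)
          then have "G \<subseteq> closure (G - {z})" using closure_subset[of "G - {z}"] by blast
          then show "closure G \<subseteq> closure (G - {z})" by (simp add: closure_minimal)
        qed
        then show ?thesis ..
      qed
      moreover have "G - {z} = {x. x \<noteq> z \<and> ?i x \<in> H}"
      proof -
        have "?i x \<in> H \<longleftrightarrow> x \<in> G" if "x \<noteq> z" for x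
          using unit_inversion_involution[OF that] unit_inversion_neq[OF that] by (simp add: H_def)
        then show ?thesis by blast
      qed
      ultimately have "?i y \<in> closure {x. x \<noteq> z \<and> ?i x \<in> H}" by simp
      then have "?i (?i y) \<in> closure H" by (rule closure_unit_inversion[OF unit_inversion_neq[OF y]])
      then show "y \<in> closure H" by (simp add: unit_inversion_involution[OF y])
    qed
    moreover have "y \<in> H \<longleftrightarrow> ?i y \<in> G" using y by (simp add: H_def)
    ultimately show ?thesis unfolding F_eq frontier_def interior_open[OF G] by blast
  qed
  have z_iff: "z \<in> F \<longleftrightarrow> \<not> bounded G"
  proof -
    have "z \<in> F \<longleftrightarrow> z \<in> closure H" unfolding F_eq by (auto simp: H_def)
    also have "\<dots> \<longleftrightarrow> \<not> bounded G"
    proof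
      assume L: "z \<in> closure H"
      show "\<not> bounded G"
      proof
        assume "bounded G"
        then have "bounded ((\<lambda>x. x - z) ` G)" by (rule bounded_translation_minus)
        then obtain B where B: "0 < B" "\<And>x. x \<in> G \<Longrightarrow> norm (x - z) \<le> B" unfolding bounded_pos by auto
        obtain y where y: "y \<in> H" "dist y z < inverse B" using L B(1) unfolding closure_approachable by (metis positive_imp_inverse_positive)
        have "norm (?i y - z) \<le> B" using y B(2) by (simp add: H_def)
        then have "inverse (norm (y - z)) \<le> B" by (simp add: norm_unit_inversion)
        moreover have "inverse (inverse B) < inverse (norm (y - z))"
          using y by (intro less_imp_inverse_less) (auto simp: dist_norm H_def)
        ultimately show False by simp
      qed
    next
      assume R: "\<not> bounded G"
      show "z \<in> closure H"
        unfolding closure_approachable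
      proof (intro allI impI)
        fix e :: real assume e: "0 < e"
        have "\<not> G \<subseteq> cball z (inverse e)" using R bounded_subset bounded_cball by blast
        then obtain x where x: "x \<in> G" "x \<notin> cball z (inverse e)" by blast
        then have x: "x \<in> G" "inverse e < norm (x - z)" by (simp_all add: dist_norm norm_minus_commute)
        then have xz: "x \<noteq> z" using e by auto
        have "inverse (norm (x - z)) < inverse (inverse e)" using x(2) e by (intro less_imp_inverse_less) auto
        then have "dist (?i x) z < e" by (simp add: dist_norm norm_unit_inversion)
        moreover have "?i x \<in> H" using x xz unit_inversion_involution[OF xz] unit_inversion_neq[OF xz] by (simp add: H_def)
        ultimately show "\<exists>y\<in>H. dist y z < e" by blast
      qed
    qed
    finally show ?thesis .
  qed
  have F_ball: "F \<subseteq> cball z (1 / \<rho>)"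
  proof
    fix y assume "y \<in> F"
    show "y \<in> cball z (1 / \<rho>)"
    proof (cases "y = z")
      case False
      then have "?i y \<notin> G" using F_iff \<open>y \<in> F\<close> G by (auto simp: frontier_def interior_open)
      then have "?i y \<notin> cball z \<rho>" using \<rho> by blast
      then have "\<rho> < inverse (norm (y - z))" using norm_unit_inversion[of z y] by (simp add: dist_norm norm_minus_commute)
      then have "inverse (inverse (norm (y - z))) < inverse \<rho>" using \<rho> by (intro less_imp_inverse_less) auto
      then show ?thesis by (simp add: dist_norm norm_minus_commute inverse_eq_divide)
    qed (use \<rho> in simp)
  qed
  have F_compact: "compact F"
    unfolding compact_eq_bounded_closed using bounded_subset[OF bounded_cball F_ball] by (simp add: F_def)
  have "condenser_cap (ball z (2 / \<rho>)) F = 0"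
    by (rule condenser_cap_inverted_frontier_zero[OF G \<rho>(1) cap0])
       (use F_iff G in \<open>auto simp: frontier_def interior_open\<close>)
  moreover have "F \<subseteq> ball z (2 / \<rho>)"
  proof -
    have "cball z (1 / \<rho>) \<subseteq> ball z (2 / \<rho>)" using \<rho>(1) by (auto simp: divide_strict_right_mono le_less_trans)
    then show ?thesis using F_ball by blast
  qed
  moreover have "ball z (2 / \<rho>) \<noteq> {}" using \<rho>(1) by simp
  ultimately have zero: "capacity_zero F"
    unfolding capacity_zero_def using F_compact by (meson bounded_ball connected_ball open_ball)
  have inv_Some: "sphere_inversion z 1 (Some x) = Some (?i x)" if "x \<noteq> z" for x
    using that by (simp add: sphere_inversion_def unit_inversion_def divide_inverse)
  have inv_None: "sphere_inversion z 1 None = Some z" by (simp add: sphere_inversion_def)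
  have z_frontier: "z \<notin> frontier G" using zG G by (simp add: frontier_def interior_open)
  have "sphere_inversion z 1 ` ext_boundary G = Some ` F"
  proof (intro equalityI subsetI)
    fix v assume "v \<in> sphere_inversion z 1 ` ext_boundary G"
    then obtain o' where o': "o' \<in> ext_boundary G" "v = sphere_inversion z 1 o'" by blast
    show "v \<in> Some ` F"
    proof (cases o')
      case None
      then show ?thesis using o' None_in_ext_boundary[OF G] z_iff inv_None by auto
    next
      case (Some x)
      then have x: "x \<in> frontier G" "x \<noteq> z" using o'(1) Some_in_ext_boundary[OF G] z_frontier by auto
      then have "?i x \<in> F" using F_iff[OF unit_inversion_neq] unit_inversion_involution by metis
      then show ?thesis using o'(2) Some inv_Some[OF x(2)] by simp
    qed
  next
    fix v assume "v \<in> Some ` F"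
    then obtain y where y: "y \<in> F" "v = Some y" by blast
    show "v \<in> sphere_inversion z 1 ` ext_boundary G"
    proof (cases "y = z")
      case True
      then have "None \<in> ext_boundary G" using y z_iff None_in_ext_boundary[OF G] by simp
      then show ?thesis using y True inv_None by (metis imageI)
    next
      case False
      then have "Some (?i y) \<in> ext_boundary G" using y F_iff Some_in_ext_boundary[OF G] by simp
      moreover have "sphere_inversion z 1 (Some (?i y)) = v"
        using inv_Some[OF unit_inversion_neq[OF False]] unit_inversion_involution[OF False] y by simp
      ultimately show ?thesis by (metis imageI)
    qed
  qed
  then show ?thesis
    unfolding ext_capacity_zero_def using comp zero moebius_map.inversion[of 1 z] by force
qed

section \<open>Points, and the capacity test function\<close>

text \<open>Each of the \<open>M\<close> dyadic shells contributes at most a fixed amount, as the integrand scales like the inverse of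
  the volume.\<close>

lemma nn_integral_inverse_norm_power_shell_le:
  fixes z :: "'a::euclidean_space"
  shows "(\<integral>\<^sup>+y. ennreal (indicator {y. (1/2) ^ M < norm (y - z) \<and> norm (y - z) < 1} y * inverse (norm (y - z)) ^ DIM('a)) \<partial>lborel)
    \<le> ennreal (real M * (2 ^ DIM('a) * unit_ball_vol (real DIM('a))))"
proof -
  let ?n = "DIM('a)"
  have pw: "indicator {y. (1/2) ^ M < norm (y - z) \<and> norm (y - z) < 1} y * inverse (norm (y - z)) ^ ?n
     \<le> (\<Sum>j<M. (2 ^ Suc j) ^ ?n * indicator (cball z ((1/2) ^ j)) y)" for y :: 'a
  proof (cases "(1/2) ^ M < norm (y - z) \<and> norm (y - z) < 1")
    case True
    define j where "j = (LEAST j. (1/2::real) ^ j < norm (y - z))"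
    have j: "(1/2::real) ^ j < norm (y - z)" unfolding j_def by (rule LeastI[of _ M]) (use True in simp)
    have "j \<le> M" unfolding j_def by (rule Least_le) (use True in simp)
    have "j \<noteq> 0" using j True by (metis less_asym power_0)
    then obtain i where i: "j = Suc i" by (cases j) auto
    have "\<not> (1/2::real) ^ i < norm (y - z)" using not_less_Least[of i "\<lambda>j. (1/2::real) ^ j < norm (y - z)"] i unfolding j_def by simp
    then have ball: "y \<in> cball z ((1/2) ^ i)" by (simp add: dist_norm norm_minus_commute)
    have "inverse (norm (y - z)) \<le> inverse ((1/2) ^ Suc i)" using j unfolding i by (intro le_imp_inverse_le) auto
    also have "\<dots> = 2 ^ Suc i" by (simp add: power_divide)
    finally have "inverse (norm (y - z)) ^ ?n \<le> (2 ^ Suc i) ^ ?n" by (rule power_mono) simp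
    then have "inverse (norm (y - z)) ^ ?n \<le> (2 ^ Suc i) ^ ?n * indicator (cball z ((1/2) ^ i)) y"
      using ball by (simp only: indicator_simps mult_1_right)
    also have "\<dots> \<le> (\<Sum>j<M. (2 ^ Suc j) ^ ?n * indicator (cball z ((1/2) ^ j)) y)"
      by (rule member_le_sum[where f = "\<lambda>j. (2 ^ Suc j) ^ ?n * indicator (cball z ((1/2) ^ j)) y"])
         (use i \<open>j \<le> M\<close> in auto)
    finally show ?thesis using True by simp
  next
    case False
    then show ?thesis by (auto simp: indicator_def intro!: sum_nonneg)
  qed
  have "(\<integral>\<^sup>+y. ennreal (indicator {y. (1/2) ^ M < norm (y - z) \<and> norm (y - z) < 1} y * inverse (norm (y - z)) ^ ?n) \<partial>lborel)
    \<le> (\<integral>\<^sup>+y. (\<Sum>j<M. ennreal ((2 ^ Suc j) ^ ?n) * indicator (cball z ((1/2) ^ j)) y) \<partial>lborel)"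
  proof (intro nn_integral_mono)
    fix y :: 'a
    have "ennreal (\<Sum>j<M. (2 ^ Suc j) ^ ?n * indicator (cball z ((1/2) ^ j)) y) = (\<Sum>j<M. ennreal ((2 ^ Suc j) ^ ?n) * indicator (cball z ((1/2) ^ j)) y)"
      by (subst sum_ennreal[symmetric]) (auto simp: ennreal_mult' ennreal_indicator intro!: sum.cong)
    then show "ennreal (indicator {y. (1/2) ^ M < norm (y - z) \<and> norm (y - z) < 1} y * inverse (norm (y - z)) ^ ?n)
      \<le> (\<Sum>j<M. ennreal ((2 ^ Suc j) ^ ?n) * indicator (cball z ((1/2) ^ j)) y)"
      using ennreal_leI[OF pw[of y]] by simp
  qed
  also have "\<dots> = (\<Sum>j<M. ennreal ((2 ^ Suc j) ^ ?n) * emeasure lborel (cball z ((1/2) ^ j)))"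
    by (subst nn_integral_sum) (auto simp: nn_integral_cmult_indicator intro!: borel_measurable_times_ennreal borel_measurable_indicator)
  also have "\<dots> = (\<Sum>j<M. ennreal (2 ^ ?n * unit_ball_vol (real ?n)))"
  proof (intro sum.cong refl)
    fix j
    have "(2 ^ Suc j) ^ ?n * (unit_ball_vol (real ?n) * ((1/2) ^ j) ^ ?n) = (2 ^ Suc j * (1/2::real) ^ j) ^ ?n * unit_ball_vol (real ?n)"
      by (simp only: power_mult_distrib mult_ac)
    also have "2 ^ Suc j * (1/2::real) ^ j = 2" by (simp add: power_divide)
    finally have eq: "(2 ^ Suc j) ^ ?n * (unit_ball_vol (real ?n) * ((1/2) ^ j) ^ ?n) = 2 ^ ?n * unit_ball_vol (real ?n)" .
    have em: "emeasure lborel (cball z ((1/2) ^ j)) = ennreal (unit_ball_vol (real ?n) * ((1/2) ^ j) ^ ?n)"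
      by (rule emeasure_cball) simp
    show "ennreal ((2 ^ Suc j) ^ ?n) * emeasure lborel (cball z ((1/2) ^ j)) = ennreal (2 ^ ?n * unit_ball_vol (real ?n))"
      unfolding em eq[symmetric] by (rule ennreal_mult'[symmetric]) simp
  qed
  also have "\<dots> = ennreal (real M * (2 ^ ?n * unit_ball_vol (real ?n)))"
    by (simp add: ennreal_of_nat_eq_real_of_nat ennreal_mult')
  finally show ?thesis .
qed

text \<open>The test functions are truncated multiples of the logarithm of the distance; their energies decay like
  \<open>M ^ (1 - n)\<close>, since \<open>M\<close> shells contribute and the multiple has order \<open>1 / M\<close>.\<close>

lemma condenser_cap_point:
  fixes z :: "'a::euclidean_space"
  assumes n: "2 \<le> DIM('a)"
  shows "condenser_cap (ball z 2) {z} = 0"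
proof -
  let ?n = "DIM('a)"
  define V where "V = 2 ^ ?n * unit_ball_vol (real ?n)"
  have V: "0 < V" by (simp add: V_def)
  have bound: "condenser_cap (ball z 2) {z} \<le> ennreal (V / (ln 2) ^ ?n / real M)" if M: "0 < M" for M
  proof -
    define \<rho> where "\<rho> = (1/2::real) ^ M"
    define L where "L = - ln \<rho>"
    have L: "L = real M * ln 2" by (simp add: L_def \<rho>_def ln_realpow ln_div)
    have L0: "0 < L" using M by (simp add: L)
    have \<rho>: "0 < \<rho>" "\<rho> < 1" using M by (auto simp: \<rho>_def power_less_one_iff)
    define u where "u = (\<lambda>y. - ln (min 1 (max \<rho> (norm (y - z)))) / L)"
    define N where "N = sphere z \<rho> \<union> sphere z 1"
    define U where "U = (\<lambda>y. if \<rho> < norm (y - z) \<and> norm (y - z) < 1 then (- inverse (L * norm (y - z))) *\<^sub>R sgn (y - z) else 0)"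
    have nc: "continuous_on UNIV (\<lambda>y. norm (y - z))" by (intro continuous_intros)
    have uc: "continuous_on UNIV u"
      unfolding u_def divide_inverse
      by (intro continuous_on_mult continuous_on_minus continuous_on_ln continuous_on_min continuous_on_max continuous_on_const nc)
         (use \<rho> in \<open>auto simp: min_def max_def\<close>)
    have der: "(u has_derivative (\<lambda>h. U y \<bullet> h)) (at y)" if y: "y \<notin> N" for y
    proof -
      consider "norm (y - z) < \<rho>" | "\<rho> < norm (y - z)" "norm (y - z) < 1" | "1 < norm (y - z)"
        using y by (force simp: N_def dist_norm norm_minus_commute)
      then show ?thesis
      proof cases
        case 1
        have o: "open {y. norm (y - z) < \<rho>}" by (rule open_Collect_less[OF nc continuous_on_const])
        have eq: "1 = u x" if "x \<in> {y. norm (y - z) < \<rho>}" for x using that \<rho> L0 by (simp add: u_def L_def max_def min_def)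
        have "((\<lambda>_. 1::real) has_derivative (\<lambda>h. 0)) (at y)" by simp
        from has_derivative_transform_within_open[OF this o _ eq] show ?thesis using 1 by (simp add: U_def)
      next
        case 2
        have o: "open ({y. \<rho> < norm (y - z)} \<inter> {y. norm (y - z) < 1})"
          by (intro open_Int open_Collect_less[OF continuous_on_const nc] open_Collect_less[OF nc continuous_on_const])
        have eq: "- ln (norm (x - z)) / L = u x" if "x \<in> {y. \<rho> < norm (y - z)} \<inter> {y. norm (y - z) < 1}" for x
          using that by (simp add: u_def max_def min_def)
        have yz: "y - z \<noteq> 0" "0 < norm (y - z)" using 2 \<rho> by auto
        have "((\<lambda>y. y - z) has_derivative (\<lambda>h. h)) (at y)" by (auto intro!: derivative_eq_intros)
        from diff_chain_at[OF this has_derivative_norm[OF yz(1)]]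
        have 1: "((\<lambda>y. norm (y - z)) has_derivative (\<lambda>h. h \<bullet> sgn (y - z))) (at y)" by (simp add: o_def)
        have "(ln has_derivative (\<lambda>h. h * inverse (norm (y - z)))) (at (norm (y - z)))"
          using DERIV_ln[OF yz(2)] by (simp add: has_field_derivative_def mult_commute_abs)
        from has_derivative_mult_right[OF diff_chain_at[OF 1 this], of "- inverse L"]
        have "((\<lambda>y. - ln (norm (y - z)) / L) has_derivative (\<lambda>h. - inverse L * ((h \<bullet> sgn (y - z)) * inverse (norm (y - z))))) (at y)"
          by (simp add: o_def divide_inverse mult.commute)
        moreover have "(\<lambda>h. - inverse L * ((h \<bullet> sgn (y - z)) * inverse (norm (y - z)))) = (\<lambda>h. U y \<bullet> h)"
          using 2 by (simp add: U_def fun_eq_iff inner_commute)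
        ultimately have "((\<lambda>y. - ln (norm (y - z)) / L) has_derivative (\<lambda>h. U y \<bullet> h)) (at y)" by simp
        from has_derivative_transform_within_open[OF this o _ eq] show ?thesis using 2 by simp
      next
        case 3
        have o: "open {y. 1 < norm (y - z)}" by (rule open_Collect_less[OF continuous_on_const nc])
        have eq: "0 = u x" if "x \<in> {y. 1 < norm (y - z)}" for x using that by (simp add: u_def max_def min_def)
        have "((\<lambda>_. 0::real) has_derivative (\<lambda>h. 0)) (at y)" by simp
        from has_derivative_transform_within_open[OF this o _ eq] show ?thesis using 3 by (simp add: U_def)
      qed
    qed
    have normU: "norm (U y) ^ ?n = inverse L ^ ?n * (indicator {y. \<rho> < norm (y - z) \<and> norm (y - z) < 1} y * inverse (norm (y - z)) ^ ?n)" for y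
    proof (cases "\<rho> < norm (y - z) \<and> norm (y - z) < 1")
      case True
      then have "norm (sgn (y - z)) = 1" using \<rho> by (auto simp: norm_sgn)
      then show ?thesis using True L0 by (simp add: U_def abs_mult power_mult_distrib)
    next
      case False
      then have "U y = 0" "indicator {y. \<rho> < norm (y - z) \<and> norm (y - z) < 1} y = (0::real)" by (auto simp: U_def)
      then show ?thesis by (simp add: zero_power)
    qed
    have sub: "{y. u y \<noteq> 0} \<subseteq> cball z 1"
    proof
      fix y assume "y \<in> {y. u y \<noteq> 0}"
      then have "u y \<noteq> 0" by simp
      moreover have "u y = 0" if "1 \<le> norm (y - z)"
      proof -
        have "min 1 (max \<rho> (norm (y - z))) = 1" using that by (intro min_absorb1) (simp add: le_max_iff_disj)
        then show ?thesis by (simp add: u_def)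
      qed
      ultimately have "\<not> 1 \<le> norm (y - z)" by blast
      then show "y \<in> cball z 1" by (simp add: dist_norm norm_minus_commute)
    qed
    then have cl: "closure {y. u y \<noteq> 0} \<subseteq> cball z 1" by (rule closure_minimal) simp
    have "condenser_cap (ball z 2) {z} \<le> (\<integral>\<^sup>+y\<in>-N. ennreal (norm (U y) ^ ?n) \<partial>lebesgue)"
    proof (rule piecewise_C1_admissible(2)[OF uc, where B = "inverse (L * \<rho>)"])
      show "closed N" unfolding N_def by (intro closed_Un closed_sphere)
      show "negligible N" unfolding N_def by (intro negligible_Un negligible_sphere)
      show "finite {t. line_point i y t \<in> N}" if "i \<in> Basis" for i y
      proof -
        have "{t. line_point i y t \<in> N} = {t. line_point i y t \<in> sphere z \<rho>} \<union> {t. line_point i y t \<in> sphere z 1}"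
          unfolding N_def by blast
        then show ?thesis by (simp only: finite_Un finite_line_sphere[OF that])
      qed
      show "(u has_derivative (\<lambda>h. U y \<bullet> h)) (at y)" if "y \<notin> N" for y by (rule der[OF that])
      show "norm (U y) \<le> inverse (L * \<rho>)" if "y \<notin> N" for y
      proof (cases "\<rho> < norm (y - z) \<and> norm (y - z) < 1")
        case True
        then have "norm (sgn (y - z)) = 1" using \<rho> by (auto simp: norm_sgn)
        then have "norm (U y) = inverse (L * norm (y - z))" using True L0 by (simp add: U_def abs_mult)
        also have "\<dots> \<le> inverse (L * \<rho>)" using True L0 \<rho> by (intro le_imp_inverse_le mult_left_mono) auto
        finally show ?thesis .
      qed (use L0 \<rho> in \<open>auto simp: U_def\<close>)
      show "compact (closure {y. u y \<noteq> 0})"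
        using closed_Int_compact[OF closed_closure compact_cball, of "{y. u y \<noteq> 0}" z 1] cl by (simp add: Int_absorb2)
      show "closure {y. u y \<noteq> 0} \<subseteq> ball z 2" using cl by force
      show "0 \<le> u y" for y
      proof -
        have "0 < min 1 (max \<rho> (norm (y - z)))" using \<rho> by (simp add: less_max_iff_disj)
        moreover have "min 1 (max \<rho> (norm (y - z))) \<le> 1" by simp
        ultimately have "ln (min 1 (max \<rho> (norm (y - z)))) \<le> 0" by (simp only: ln_le_zero_iff)
        then show ?thesis using L0 unfolding u_def by (intro divide_nonneg_pos) auto
      qed
      show "1 \<le> u y" if "y \<in> {z}" for y using that \<rho> L0 by (simp add: u_def L_def max_def min_def)
    qed
    also have "\<dots> \<le> (\<integral>\<^sup>+y. ennreal (norm (U y) ^ ?n) \<partial>lebesgue)"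
      by (intro nn_integral_mono) (auto simp: indicator_def)
    also have "\<dots> = (\<integral>\<^sup>+y. ennreal (inverse L ^ ?n) * ennreal (indicator {y. \<rho> < norm (y - z) \<and> norm (y - z) < 1} y * inverse (norm (y - z)) ^ ?n) \<partial>lborel)"
      unfolding normU using L0 by (simp add: nn_integral_completion ennreal_mult)
    also have "\<dots> = ennreal (inverse L ^ ?n) * (\<integral>\<^sup>+y. ennreal (indicator {y. \<rho> < norm (y - z) \<and> norm (y - z) < 1} y * inverse (norm (y - z)) ^ ?n) \<partial>lborel)"
      by (rule nn_integral_cmult) measurable
    also have "\<dots> \<le> ennreal (inverse L ^ ?n) * ennreal (real M * V)"
      using nn_integral_inverse_norm_power_shell_le[of M z] unfolding \<rho>_def V_def by (intro mult_left_mono) auto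
    also have "\<dots> = ennreal (inverse L ^ ?n * (real M * V))" using L0 by (simp add: ennreal_mult')
    also have "\<dots> \<le> ennreal (V / (ln 2) ^ ?n / real M)"
    proof (rule ennreal_leI)
      have "real M * real M \<le> real M ^ ?n"
      proof -
        have "real M ^ 2 \<le> real M ^ ?n" using n M by (intro power_increasing) auto
        then show ?thesis by (simp add: power2_eq_square)
      qed
      moreover have "0 < ln (2::real) ^ ?n" by simp
      ultimately show "inverse L ^ ?n * (real M * V) \<le> V / (ln 2) ^ ?n / real M"
        unfolding L using M V by (simp add: field_simps power_mult_distrib mult_left_mono)
    qed
    finally show ?thesis .
  qed
  have "(\<lambda>M. ennreal (V / (ln 2) ^ ?n / real M)) \<longlonglongrightarrow> ennreal 0"
    by (intro tendsto_ennrealI lim_const_over_n)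
  then have "condenser_cap (ball z 2) {z} \<le> ennreal 0"
    by (rule LIMSEQ_le_const) (use bound in \<open>auto intro!: exI[of _ 1]\<close>)
  then show ?thesis by simp
qed

lemma ext_capacity_zero_infinity:
  assumes "2 \<le> DIM('a::euclidean_space)" and "compactin extended_space (ext_boundary (UNIV :: 'a set))"
  shows "ext_capacity_zero (ext_boundary (UNIV :: 'a set))"
proof -
  have "p \<in> ext_boundary (UNIV :: 'a set) \<longleftrightarrow> p = None" for p
    using Some_in_ext_boundary[OF open_UNIV] None_in_ext_boundary[OF open_UNIV] not_bounded_UNIV
    by (cases p) auto
  then have "ext_boundary (UNIV :: 'a set) = {None}" by auto
  then have "sphere_inversion (0::'a) 1 ` ext_boundary UNIV = Some ` {0}" by (simp add: sphere_inversion_def)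
  moreover have "capacity_zero {0::'a}"
    unfolding capacity_zero_def
    using condenser_cap_point[OF assms(1), of "0::'a"]
    by (intro conjI exI[of _ "ball 0 2"]) auto
  ultimately show ?thesis
    unfolding ext_capacity_zero_def using assms(2) moebius_map.inversion[of 1 "0::'a"] by force
qed

lemma ball_infdist_frontier_subset:
  fixes G :: "'a::euclidean_space set"
  assumes "z \<in> G"
  shows "ball z (infdist z (frontier G)) \<subseteq> G"
proof (rule ccontr)
  assume "\<not> ?thesis"
  then have "ball z (infdist z (frontier G)) - G \<noteq> {}" by blast
  then have "0 < infdist z (frontier G)" by (metis Diff_eq_empty_iff ball_empty empty_subsetI not_less)
  then have "z \<in> ball z (infdist z (frontier G)) \<inter> G" using assms by simp
  then have "ball z (infdist z (frontier G)) \<inter> G \<noteq> {}" by blast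
  then have "ball z (infdist z (frontier G)) \<inter> frontier G \<noteq> {}"
    using \<open>ball z (infdist z (frontier G)) - G \<noteq> {}\<close> by (intro connected_Int_frontier) auto
  then obtain y where "y \<in> frontier G" "dist z y < infdist z (frontier G)" by auto
  then show False using infdist_le[of y "frontier G" z] by simp
qed

theorem theorem3p7:
  fixes G :: "'a::euclidean_space set" and \<alpha> s :: real
  assumes "DIM('a) \<ge> 2"
    and "open G" and "connected G" and "G \<noteq> {}"
    and "ext_positive_capacity (ext_boundary G)"
    and "0 < \<alpha>" and "\<alpha> < 1"
    and "0 < s" and "s < 1"
    and "(1 + s) * \<alpha> + s < 1"
  shows "continuous_on G (cap_test_function G \<alpha>) \<and>
         harnack_function G (cap_test_function G \<alpha>) s
           ((ln \<alpha> / ln ((1 + s) * \<alpha> + s)) ^ (DIM('a) - 1))"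
proof -
  let ?n = "DIM('a)"
  note n = assms(1) and G = assms(2) and \<alpha> = assms(6,7)
  define d where "d = (\<lambda>z. infdist z (frontier G))"
  define K where "K = (\<lambda>z. cball z (\<alpha> * d z))"
  define u where "u = cap_test_function G \<alpha>"
  define C where "C = (\<lambda>s. (ln \<alpha> / ln ((1 + s) * \<alpha> + s)) ^ (?n - 1))"
  have u_def': "u z = enn2real (condenser_cap G (K z))" for z
    by (simp add: u_def cap_test_function_def K_def d_def)
  have comp: "compactin extended_space (ext_boundary G)" and nz: "\<not> ext_capacity_zero (ext_boundary G)"
    using assms(5) unfolding ext_positive_capacity_def by auto
  have "G \<noteq> UNIV" using ext_capacity_zero_infinity[OF n] comp nz by auto
  then have fr: "frontier G \<noteq> {}" using assms(4) by (simp add: frontier_eq_empty)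
  have d_pos: "0 < d z" if "z \<in> G" for z
    unfolding d_def using that G fr
    by (intro infdist_pos_not_in_closed frontier_closed) (auto simp: frontier_def interior_open)
  have ball_G: "ball z (d z) \<subseteq> G" if "z \<in> G" for z
    unfolding d_def using that by (rule ball_infdist_frontier_subset)
  have K_G: "K z \<subseteq> G" if "z \<in> G" for z
  proof -
    have "\<alpha> * d z < 1 * d z" using \<alpha> d_pos[OF that] by (intro mult_strict_right_mono) auto
    then have "K z \<subseteq> ball z (d z)" unfolding K_def by auto
    then show ?thesis using ball_G[OF that] by blast
  qed
  have fin: "condenser_cap G (K z) < \<infinity>" if "z \<in> G" for z
  proof -
    define \<beta> where "\<beta> = (1 + \<alpha>) / 2"
    have \<beta>: "\<alpha> < \<beta>" "\<beta> < 1" using \<alpha> by (auto simp: \<beta>_def)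
    have dz: "0 < d z" by (rule d_pos[OF that])
    have "\<beta> * d z < d z" using mult_strict_right_mono[OF \<beta>(2) dz] by simp
    then have "cball z (\<beta> * d z) \<subseteq> ball z (d z)" by auto
    then have "cball z (\<beta> * d z) \<subseteq> G" using ball_G[OF that] by blast
    then show ?thesis
      unfolding K_def using \<alpha> \<beta> dz by (intro condenser_cap_cball_finite[of _ "\<beta> * d z"]) (auto intro: mult_strict_right_mono)
  qed
  have pos: "0 < u z" if z: "z \<in> G" for z
  proof -
    have "condenser_cap G (K z) \<noteq> 0"
      using ext_capacity_zero_if_cball[OF G _ K_G[OF z, unfolded K_def] _ comp] nz \<alpha> d_pos[OF z]
      unfolding K_def by auto
    then show ?thesis
      using fin[OF z] unfolding u_def' by (simp add: enn2real_positive_iff zero_less_iff_neq_zero)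
  qed
  have cap_u: "condenser_cap G (K z) = ennreal (u z)" if "z \<in> G" for z
    using fin[OF that] unfolding u_def' by simp
  have C_ge: "1 \<le> C \<sigma>" "0 \<le> C \<sigma>" if "0 \<le> \<sigma>" "(1 + \<sigma>) * \<alpha> + \<sigma> < 1" for \<sigma>
  proof -
    have le: "\<alpha> \<le> (1 + \<sigma>) * \<alpha> + \<sigma>" using that \<alpha> by (simp add: algebra_simps)
    then have "ln \<alpha> \<le> ln ((1 + \<sigma>) * \<alpha> + \<sigma>)" "ln ((1 + \<sigma>) * \<alpha> + \<sigma>) < 0" using \<alpha> that by auto
    then have "1 \<le> ln \<alpha> / ln ((1 + \<sigma>) * \<alpha> + \<sigma>)" by (simp add: le_divide_eq)
    then show "1 \<le> C \<sigma>" "0 \<le> C \<sigma>" unfolding C_def by (auto simp: one_le_power)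
  qed
  have harnack: "x \<in> G \<and> u z \<le> C \<sigma> * u x" if z: "z \<in> G" and \<sigma>: "0 \<le> \<sigma>" "(1 + \<sigma>) * \<alpha> + \<sigma> < 1" and x: "dist z x \<le> \<sigma> * d z" for z x \<sigma>
  proof -
    have dz: "0 < d z" by (rule d_pos[OF z])
    define t where "t = dist z x / d z"
    have t: "0 \<le> t" "t \<le> \<sigma>" "dist z x = t * d z" using dz x by (auto simp: t_def divide_le_eq)
    have "(1 + t) * \<alpha> + t \<le> (1 + \<sigma>) * \<alpha> + \<sigma>" using t \<alpha> by (intro add_mono mult_right_mono) auto
    then have t': "(1 + t) * \<alpha> + t < 1" using \<sigma> by simp
    have "\<sigma> < 1" using \<sigma> \<alpha> by (smt (verit) mult_pos_pos)
    then have "t * d z < 1 * d z" using t dz by (intro mult_strict_right_mono) auto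
    then have xG: "x \<in> G" using ball_G[OF z] t(3) by (simp add: subset_iff)
    have "d z \<le> d x + dist z x" unfolding d_def by (rule infdist_triangle)
    then have "(1 - t) * d z \<le> d x" using t(3) by (simp add: algebra_simps)
    then have "\<alpha> * ((1 - t) * d z) \<le> \<alpha> * d x" using \<alpha> by (intro mult_left_mono) auto
    then have "cball x (\<alpha> * ((1 - t) * d z)) \<subseteq> K x" unfolding K_def by auto
    then have mono: "condenser_cap G (cball x (\<alpha> * ((1 - t) * d z))) \<le> condenser_cap G (K x)" by (rule condenser_cap_mono)
    have "ennreal (u z) \<le> ennreal (C t) * condenser_cap G (cball x (\<alpha> * ((1 - t) * d z)))"
      using condenser_cap_cball_le[OF n G ball_G[OF z] dz \<alpha> t(3) t'] cap_u[OF z] unfolding K_def C_def by simp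
    also have "\<dots> \<le> ennreal (C t) * ennreal (u x)"
      using mono unfolding cap_u[OF xG] by (intro mult_left_mono) auto
    also have "\<dots> = ennreal (C t * u x)" using C_ge(2)[OF t(1) t'] by (simp add: ennreal_mult')
    finally have "u z \<le> C t * u x"
      using pos[OF xG] C_ge(2)[OF t(1) t'] by (simp add: ennreal_le_iff)
    also have "C t \<le> C \<sigma>"
      unfolding C_def
    proof (rule power_mono)
      have b0: "0 < (1 + t) * \<alpha> + t" using t \<alpha> by (simp add: add_pos_nonneg)
      have bl: "(1 + t) * \<alpha> + t \<le> (1 + \<sigma>) * \<alpha> + \<sigma>" by fact
      have "ln ((1 + t) * \<alpha> + t) \<le> ln ((1 + \<sigma>) * \<alpha> + \<sigma>)" "ln ((1 + \<sigma>) * \<alpha> + \<sigma>) < 0" "ln \<alpha> < 0"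
        using b0 bl \<sigma> \<alpha> by auto
      then show "ln \<alpha> / ln ((1 + t) * \<alpha> + t) \<le> ln \<alpha> / ln ((1 + \<sigma>) * \<alpha> + \<sigma>)" "0 \<le> ln \<alpha> / ln ((1 + t) * \<alpha> + t)"
        by (auto intro: divide_left_mono_neg simp: divide_nonpos_neg mult_neg_neg divide_nonpos_nonpos)
    qed
    finally show ?thesis using xG pos[OF xG] by (simp add: mult_right_mono)
  qed
  have cont: "continuous_on G u"
    unfolding continuous_on_eq_continuous_at[OF G]
  proof
    fix z assume z: "z \<in> G"
    have dz: "0 < d z" by (rule d_pos[OF z])
    have dc: "isCont d z" unfolding d_def by (intro continuous_intros)
    have d_lim: "(d \<longlongrightarrow> d z) (at z)" using dc by (simp add: isCont_def)
    \<comment> \<open>the Harnack inequality from \<open>z\<close> to \<open>x\<close> and back, with parameters that tend to \<open>0\<close>\<close>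
    define s1 s2 where "s1 = (\<lambda>x. dist z x / d z)" and "s2 = (\<lambda>x. dist x z / d x)"
    have dist_lim: "((\<lambda>x. dist z x) \<longlongrightarrow> dist z z) (at z)" "((\<lambda>x. dist x z) \<longlongrightarrow> dist z z) (at z)"
      by (intro tendsto_intros)+
    have s1_lim: "(s1 \<longlongrightarrow> 0) (at z)" unfolding s1_def using tendsto_divide[OF dist_lim(1) tendsto_const[of "d z"]] dz by simp
    have s2_lim: "(s2 \<longlongrightarrow> 0) (at z)" unfolding s2_def using tendsto_divide[OF dist_lim(2) d_lim] dz by simp
    have C_cont: "isCont C 0"
      unfolding C_def using \<alpha> by (intro continuous_intros) auto
    have C0: "C 0 = 1" using \<alpha> by (simp add: C_def)
    have C_lim: "((\<lambda>x. C (f x)) \<longlongrightarrow> 1) (at z)" if "(f \<longlongrightarrow> 0) (at z)" for f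
      using isCont_tendsto_compose[OF C_cont that] unfolding C0 .
    have ok: "\<forall>\<^sub>F x in at z. (1 + f x) * \<alpha> + f x < 1" if "(f \<longlongrightarrow> 0) (at z)" for f
    proof (rule order_tendstoD(2))
      show "((\<lambda>x. (1 + f x) * \<alpha> + f x) \<longlongrightarrow> (1 + 0) * \<alpha> + 0) (at z)" by (intro tendsto_intros that)
      show "(1 + 0) * \<alpha> + 0 < 1" using \<alpha> by simp
    qed
    have inG: "\<forall>\<^sub>F x in at z. x \<in> G" using G z by (rule eventually_at_in_open')
    have lower: "\<forall>\<^sub>F x in at z. u z / C (s1 x) \<le> u x"
      using ok[OF s1_lim]
    proof eventually_elim
      case (elim x)
      have s1: "0 \<le> s1 x" using dz by (simp add: s1_def)
      have "u z \<le> C (s1 x) * u x" using harnack[OF z s1 elim, of x] dz by (simp add: s1_def)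
      then show ?case using C_ge(1)[OF s1 elim] by (simp add: divide_le_eq mult.commute)
    qed
    have upper: "\<forall>\<^sub>F x in at z. u x \<le> C (s2 x) * u z"
      using ok[OF s2_lim] inG
    proof eventually_elim
      case (elim x)
      have dx: "0 < d x" by (rule d_pos[OF elim(2)])
      have s2: "0 \<le> s2 x" using dx by (simp add: s2_def)
      show ?case using harnack[OF elim(2) s2 elim(1), of z] dx by (simp add: s2_def)
    qed
    have "(u \<longlongrightarrow> u z) (at z)"
    proof (rule tendsto_sandwich[OF lower upper])
      show "((\<lambda>x. u z / C (s1 x)) \<longlongrightarrow> u z) (at z)"
        using tendsto_divide[OF tendsto_const[of "u z"] C_lim[OF s1_lim]] by simp
      show "((\<lambda>x. C (s2 x) * u z) \<longlongrightarrow> u z) (at z)"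
        using tendsto_mult[OF C_lim[OF s2_lim] tendsto_const[of "u z"]] by simp
    qed
    then show "isCont u z" by (simp add: isCont_def)
  qed
  have C1: "1 < C s"
  proof -
    have "\<alpha> < (1 + s) * \<alpha> + s" using \<open>0 < s\<close> \<alpha> by (simp add: algebra_simps add_pos_pos)
    then have "ln \<alpha> < ln ((1 + s) * \<alpha> + s)" "ln ((1 + s) * \<alpha> + s) < 0" using \<alpha> assms(10) by auto
    then have "1 < ln \<alpha> / ln ((1 + s) * \<alpha> + s)" by (simp add: less_divide_eq)
    then show ?thesis unfolding C_def using n by (intro one_less_power) auto
  qed
  have "harnack_function G u s (C s)"
    unfolding harnack_function_def
  proof (intro conjI ballI)
    show "u z \<le> C s * u x" if "z \<in> G" "x \<in> cball z (s * infdist z (frontier G))" for z x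
      using harnack[OF that(1) _ assms(10), of x] that(2) \<open>0 < s\<close> by (simp add: d_def)
  qed (use \<open>0 < s\<close> \<open>s < 1\<close> C1 cont pos in auto)
  then show ?thesis using cont unfolding u_def C_def by blast
qed

end
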